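(* Let $q=e^{2\pi i z}$, $\eta(z)=q^{1/24}\prod_{n\ge1}(1-q^n)$, and define \[ g_2(z)=\eta^6(4z),\qquad L_2(z)=\frac{\eta^6(8z)}{\eta^2(4z)\eta^4(16z)},\qquad H(z)=g_2(z)L_2^2(z)=\sum_{n\ge -1}C(n)q^n . \] For every prime $p\equiv 3\pmod 4$ and every integer $m\ge 0$, \[ v_p\big(C(p^{2m+1})\big)=2m,\qquad v_p\!\left(\frac{H\,|\,U(p^{2m+1})}{C(p^{2m+1})}-g_2\right)\ge 2m+2 . \]
   Context: $\sum a(n)q^n\,|\,U(m)=\sum a(mn)q^n$. For a formal Laurent series in $q$ with rational coefficients, $v_p$ is the minimum of the $p$-adic valuations of its coefficients ($v_p(0)=\infty$); for a rational number it is the usual $p$-adic valuation. $H$ has integer coefficients, $H=q^{-1}-2q^3-13q^7+\cdots$. *)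

theory Defs
  imports "HOL-Computational_Algebra.Computational_Algebra" "HOL-Library.Extended_Real"
begin

definition vp_rat :: "nat \<Rightarrow> rat \<Rightarrow> ereal" where
  "vp_rat p x = (if x = 0 then \<infinity> else
     (case quotient_of x of (a, b) \<Rightarrow>
        ereal (of_int (int (multiplicity (int p) a) - int (multiplicity (int p) b)))))"

definition vp_fls :: "nat \<Rightarrow> rat fls \<Rightarrow> ereal" where
  "vp_fls p f = (INF n. vp_rat p (fls_nth f n))"

(* the q-expansion of prod_{n>=1} (1 - q^(a n)) as a power series
   (coefficient k is determined by the finite product over n = 1..k) *)
definition euler_prod :: "nat \<Rightarrow> rat fps" where
  "euler_prod a = Abs_fps (\<lambda>k. fps_nth (\<Prod>n\<in>{1..k}. (1 - fps_X ^ (a * n))) k)"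

(* eta^r(a z) = q^{a r/24} (prod_{n>=1} (1-q^{a n}))^r; the exponents below are written
   out with the rational powers of q collected into an integer power *)
definition g2 :: "rat fls" where
  "g2 = fls_X_intpow 1 * fps_to_fls ((euler_prod 4) ^ 6)"
  (* eta^6(4z) = q^{24/24} E4^6 *)

definition L2 :: "rat fls" where
  "L2 = fls_X_intpow (-1) * fps_to_fls ((euler_prod 8) ^ 6)
        / fps_to_fls ((euler_prod 4) ^ 2 * (euler_prod 16) ^ 4)"
  (* q-exponent: (8*6 - 4*2 - 16*4)/24 = -1 *)

definition H :: "rat fls" where
  "H = g2 * L2 ^ 2"

definition C :: "int \<Rightarrow> rat" where
  "C n = fls_nth H n"

lift_definition U_op :: "nat \<Rightarrow> rat fls \<Rightarrow> rat fls" is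
  "\<lambda>m f n. if m = 0 then 0 else f (int m * n)"
proof -
  fix m :: nat and f :: "int \<Rightarrow> rat"
  assume f: "\<forall>\<^sub>\<infinity> n::nat. f (- int n) = 0"
  show "\<forall>\<^sub>\<infinity> n::nat. (if m = 0 then 0 else f (int m * (- int n))) = 0"
  proof (cases "m = 0")
    case True then show ?thesis by simp
  next
    case False
    from f obtain N where N: "\<And>n. n \<ge> N \<Longrightarrow> f (- int n) = 0"
      unfolding MOST_nat_le by blast
    have "\<forall>n\<ge>N. (if m = 0 then 0 else f (int m * (- int n))) = 0"
    proof (intro allI impI)
      fix n assume "n \<ge> N"
      hence "m * n \<ge> N" using False by (cases m) auto
      then show "(if m = 0 then 0 else f (int m * (- int n))) = 0"
        using N[of "m*n"] False by simp
    qed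
    then show ?thesis unfolding MOST_nat_le by blast
  qed
qed

end

(* The forms g2 * L2^k are exactly, up to linear combination, the weight 3 forms of this level and
   character whose only pole is at infinity, and g2 * L2^k is monic in q^(1-k) with integer
   coefficients. This space is stable under T(p), so H | T(p^k) is a combination of the g2 * L2^j; its
   polar part is a multiple of p^(2k), hence so are all coefficients with j >= 1. Thus H | T(p^k) is
   0 mod p^(2k) for even k and a multiple of g2 mod p^(2k) for odd k. The recursion
   U(p^k) = T(p^k) + p^2 V(p) T(p^(k-1)) turns this into the congruence and gives
   C(p^(2m+1)) = p^2 C(p^(2m-1)) mod p^(4m). Finally C(p) is prime to p because, modulo p, it is the
   constant term of H * L2^p = g2 * L2^(p+2), and these constant terms satisfy the recurrence of the
   squares of the central binomial coefficients.

   Stability under T(p) is proved analytically: the inversion formula for eta (from the Eisenstein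
   series of weight 2) gives the behaviour at the three cusps of Gamma(2), and an invariant function
   without poles is constant by the maximum principle. *)

theory Submission
  imports Defs "HOL-Complex_Analysis.Complex_Analysis" "HOL-Number_Theory.Cong"
begin

section \<open>The quasimodularity of the Eisenstein series of weight 2\<close>

text \<open>In the variable t = 8z the forms transform under the principal congruence group of level
  2, with multipliers that are fourth roots of unity; the multiplier of t -> t + 2 records the
  residue mod 4 of the exponents of q. Since p = -1 mod 4, T(p) negates this residue and so
  exchanges the classes k = 2 (that of H) and k = 0 (that of g_2) of the forms g_2 L_2^k. This is
  the source of the distinction between even and odd powers: in the class of H every basis form has
  a pole, in the other class only g_2 has none, so a polar part determines everything except the
  component along g_2. The Hecke argument by itself does not exclude that p divides C(p). For this
  the constant terms are needed: the constant term of g_2 L_2^(4j+1) is binom(2j, j)^2, and p + 2 =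
  4j + 1 with 2j = (p + 1)/2 < p.\<close>

lemma not_Ints_facts:
  fixes z :: complex
  assumes "z \<notin> \<int>"
  shows "z \<notin> \<int>\<^sub>\<le>\<^sub>0" "1 - z \<notin> \<int>\<^sub>\<le>\<^sub>0" "sin (of_real pi * z) \<noteq> 0"
proof -
  have "w \<in> \<int>" if "w \<in> \<int>\<^sub>\<le>\<^sub>0" for w :: complex using that by (auto simp: nonpos_Ints_def)
  moreover have "1 - z \<notin> \<int>"
  proof
    assume "1 - z \<in> \<int>"
    hence "1 - (1 - z) \<in> \<int>" by (intro Ints_diff) auto
    thus False using assms by simp
  qed
  ultimately show "z \<notin> \<int>\<^sub>\<le>\<^sub>0" "1 - z \<notin> \<int>\<^sub>\<le>\<^sub>0" using assms by blast+
  show "sin (of_real pi * z) \<noteq> 0"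
  proof
    assume "sin (of_real pi * z) = 0"
    then obtain n :: int where "of_real pi * z = of_int n * of_real pi" by (auto simp: sin_eq_0)
    hence "z = of_int n" by simp
    thus False using assms by auto
  qed
qed

text \<open>Logarithmic derivative of Euler's formula
  \<open>Gamma z * Gamma (1 - z) = pi / sin (pi z)\<close>, whose two sides vanish nowhere off the
  integers.\<close>

lemma Digamma_reflection:
  fixes z :: complex
  assumes "z \<notin> \<int>"
  shows "Digamma (1 - z) - Digamma z = of_real pi * cot (of_real pi * z)"
proof -
  note z = not_Ints_facts(1,2)[OF assms] and s = not_Ints_facts(3)[OF assms]
  have 1: "((\<lambda>z. Gamma z * Gamma (1 - z)) has_field_derivative
        Gamma z * Gamma (1 - z) * (Digamma z - Digamma (1 - z))) (at z)"
    using z by (auto intro!: derivative_eq_intros simp: algebra_simps)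
  have 2: "((\<lambda>z. of_real pi / sin (of_real pi * z)) has_field_derivative
        - (of_real pi)\<^sup>2 * cos (of_real pi * z) / sin (of_real pi * z) ^ 2) (at z)"
    using s by (auto intro!: derivative_eq_intros simp: power2_eq_square field_simps)
  have "Gamma z * Gamma (1 - z) * (Digamma z - Digamma (1 - z))
      = - (of_real pi)\<^sup>2 * cos (of_real pi * z) / sin (of_real pi * z) ^ 2"
    using 1 2 unfolding Gamma_reflection_complex by (rule DERIV_unique)
  also have "\<dots> = Gamma z * Gamma (1 - z) * (- (of_real pi * cot (of_real pi * z)))"
    unfolding Gamma_reflection_complex using s by (simp add: cot_def power2_eq_square)
  finally have "Digamma z - Digamma (1 - z) = - (of_real pi * cot (of_real pi * z))"
    by (subst (asm) mult_left_cancel) (use s in \<open>simp_all add: Gamma_reflection_complex\<close>)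
  thus ?thesis by (simp add: algebra_simps)
qed

lemma Polygamma1_reflection:
  fixes z :: complex
  assumes "z \<notin> \<int>"
  shows "Polygamma 1 z + Polygamma 1 (1 - z) = (of_real pi)\<^sup>2 / sin (of_real pi * z) ^ 2"
proof -
  note z = not_Ints_facts(1,2)[OF assms] and s = not_Ints_facts(3)[OF assms]
  have 1: "((\<lambda>z. Digamma (1 - z) - Digamma z) has_field_derivative
        - Polygamma 1 (1 - z) - Polygamma 1 z) (at z)"
    using z by (auto intro!: derivative_eq_intros)
  have 2: "((\<lambda>z. of_real pi * cot (of_real pi * z)) has_field_derivative
        - (of_real pi)\<^sup>2 / sin (of_real pi * z) ^ 2) (at z)"
    by (rule DERIV_cong[OF DERIV_cmult[OF DERIV_chain'[OF DERIV_cmult[OF DERIV_ident] DERIV_cot]]])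
       (use s in \<open>auto simp: power2_eq_square field_simps\<close>)
  have ev: "eventually (\<lambda>w. Digamma (1 - w) - Digamma w = of_real pi * cot (of_real pi * w)) (nhds z)"
    by (rule eventually_mono[OF eventually_nhds_in_open[of "- \<int>"]])
       (use assms in \<open>auto simp: Digamma_reflection open_Compl\<close>)
  have "((\<lambda>z. of_real pi * cot (of_real pi * z)) has_field_derivative
        - Polygamma 1 (1 - z) - Polygamma 1 z) (at z)"
    using DERIV_cong_ev[OF refl ev refl] 1 by blast
  from DERIV_unique[OF this 2] show ?thesis by (simp add: algebra_simps)
qed

text \<open>The terms at n and -n belong to the series of \<open>Polygamma 1\<close> at z (without
  its first term) and at 1 - z, so the differentiated reflection formula sums them. It evaluates
  both the rows and the columns of the lattice series below.\<close>

lemma inverse_square_pair_sums: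
  fixes z :: complex
  assumes "z \<notin> \<int>"
  shows "(\<lambda>n. 1 / (z + of_nat (Suc n))\<^sup>2 + 1 / (z - of_nat (Suc n))\<^sup>2) sums
           ((of_real pi)\<^sup>2 / sin (of_real pi * z) ^ 2 - 1 / z\<^sup>2)"
proof -
  have z: "z \<noteq> 0" "1 - z \<noteq> 0" using assms by auto
  have "(\<lambda>n. inverse ((z + of_nat n) ^ Suc 1)) sums ((-1) ^ Suc 1 * Polygamma 1 z / fact 1)"
    by (rule Polygamma_LIMSEQ) (use z in auto)
  hence 1: "(\<lambda>n. inverse ((z + of_nat n) ^ 2)) sums Polygamma 1 z" by (simp add: numeral_2_eq_2)
  hence 1: "(\<lambda>n. inverse ((z + of_nat (Suc n)) ^ 2)) sums (Polygamma 1 z - 1 / z^2)"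
    by (subst sums_Suc_iff) (simp add: field_simps)
  have "(\<lambda>n. inverse ((1 - z + of_nat n) ^ Suc 1)) sums ((-1) ^ Suc 1 * Polygamma 1 (1-z) / fact 1)"
    by (rule Polygamma_LIMSEQ) (use z in auto)
  hence 2: "(\<lambda>n. inverse ((1 - z + of_nat n) ^ 2)) sums Polygamma 1 (1-z)" by (simp add: numeral_2_eq_2)
  have *: "(1 - z + of_nat n)^2 = (z - of_nat (Suc n))^2" for n by (simp add: power2_eq_square algebra_simps)
  from sums_add[OF 1 2] show ?thesis
    unfolding * Polygamma1_reflection[OF assms, symmetric] by (simp add: field_simps)
qed

text \<open>After partial fractions this is a difference of two digamma series. Each diverges by
  itself, so partial sums are compared; the shift of index between them leaves the boundary term
  \<open>inverse (w + of_nat M)\<close>.\<close>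

lemma cot_pair_sums:
  fixes w :: complex
  assumes "w \<notin> \<int>"
  shows "(\<lambda>m. 2 * w / ((of_nat (Suc m))\<^sup>2 - w\<^sup>2)) sums (1 / w - of_real pi * cot (of_real pi * w))"
proof -
  have z: "w \<noteq> 0" "1 - w \<noteq> 0" using assms by auto
  have nz: "w + of_nat m \<noteq> 0" "of_nat m - w \<noteq> 0" for m
    using assms by (metis Ints_minus Ints_of_nat add.commute add_eq_0_iff)
      (metis assms Ints_of_nat eq_iff_diff_eq_0)
  have l: "(\<lambda>m. (\<Sum>n<m. inverse (w + of_nat n)) - (\<Sum>n<m. inverse (1 - w + of_nat n))) \<longlonglongrightarrow> of_real pi * cot (of_real pi * w)"
    using tendsto_diff[OF Digamma_LIMSEQ[OF z(2)] Digamma_LIMSEQ[OF z(1)]]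
    unfolding Digamma_reflection[OF assms] by (simp add: algebra_simps)
  have f: "(\<Sum>m<M. 2 * w / ((of_nat (Suc m))\<^sup>2 - w\<^sup>2)) =
     1 / w - inverse (w + of_nat M) - ((\<Sum>n<M. inverse (w + of_nat n)) - (\<Sum>n<M. inverse (1 - w + of_nat n)))" for M
  proof (induction M)
    case (Suc M)
    have "2 * w / ((of_nat (Suc M))\<^sup>2 - w\<^sup>2) = inverse (of_nat (Suc M) - w) - inverse (w + of_nat (Suc M))"
    proof -
      have "(of_nat (Suc M))\<^sup>2 - w\<^sup>2 = (of_nat (Suc M) - w) * (w + of_nat (Suc M))"
        by (simp add: power2_eq_square algebra_simps)
      thus ?thesis using nz[of "Suc M"] by (simp add: divide_simps)
    qed
    hence "(\<Sum>m<Suc M. 2 * w / ((of_nat (Suc m))\<^sup>2 - w\<^sup>2)) = 1 / w - inverse (w + of_nat M) - ((\<Sum>n<M. inverse (w + of_nat n)) - (\<Sum>n<M. inverse (1 - w + of_nat n))) + (inverse (of_nat (Suc M) - w) - inverse (w + of_nat (Suc M)))"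
      using Suc by simp
    also have "of_nat (Suc M) - w = 1 - w + of_nat M" by simp
    finally show ?case by simp
  qed (simp add: field_simps)
  have "(\<lambda>M. inverse (w + of_nat M)) \<longlonglongrightarrow> 0"
    by (rule tendsto_inverse_0[THEN filterlim_compose])
       (intro tendsto_add_filterlim_at_infinity[OF tendsto_const] tendsto_of_nat)
  from tendsto_diff[OF tendsto_diff[OF tendsto_const[of "1/w"] this] l]
  show ?thesis unfolding sums_def f by simp
qed

text \<open>Lipschitz's formula: with q = exp (2 pi i z) one has pi^2 / sin^2 (pi z) = -4 pi^2 q /
  (1 - q)^2, which is then expanded geometrically.\<close>

lemma pi_sin_square_sums:
  fixes z :: complex
  assumes "Im z > 0"
  shows "(\<lambda>n. - 4 * (of_real pi)\<^sup>2 * (of_nat n * exp (2 * of_real pi * \<i> * z) ^ n)) sums ((of_real pi)\<^sup>2 / sin (of_real pi * z) ^ 2)"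
proof -
  define u where "u = exp (of_real pi * \<i> * z)"
  define q where "q = exp (2 * of_real pi * \<i> * z)"
  have q: "q = u ^ 2" unfolding u_def q_def exp_of_nat_mult[symmetric] by (simp add: algebra_simps)
  have u0: "u \<noteq> 0" by (simp add: u_def)
  have "norm q < 1" using assms by (simp add: q_def norm_exp_eq_Re)
  hence q1: "norm q < 1" "q \<noteq> 1" by auto
  have "sin (of_real pi * z) = (u - inverse u) / (2 * \<i>)"
    by (simp add: sin_exp_eq u_def exp_minus algebra_simps)
  hence "sin (of_real pi * z) ^ 2 = - ((u - inverse u) ^ 2 / 4)" by (simp add: power_divide power_mult_distrib)
  also have "(u - inverse u)^2 = (1 - q)^2 / q" using u0 by (simp add: q field_simps power2_eq_square)
  finally have s: "(of_real pi)\<^sup>2 / sin (of_real pi * z) ^ 2 = - 4 * (of_real pi)\<^sup>2 * (q / (1-q)^2)"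
    using q1 u0 by (simp add: field_simps)
  have "(\<lambda>n. of_nat (Suc n) * q ^ n) sums (1 / (1 - q)\<^sup>2)"
    by (rule geometric_deriv_sums) (use q1 in auto)
  from sums_mult[OF this, of q] have "(\<lambda>n. of_nat (Suc n) * q ^ Suc n) sums (q / (1 - q)\<^sup>2)"
    by (simp add: algebra_simps)
  hence "(\<lambda>n. of_nat n * q ^ n) sums (q / (1 - q)\<^sup>2)"
    by (subst (asm) sums_Suc_iff) auto
  from sums_mult[OF this, of "- 4 * (of_real pi)\<^sup>2"] show ?thesis unfolding s q_def .
qed

section \<open>Double series over the lattice\<close>

text \<open>A majorant of product form makes the double family absolutely summable, so both iterated
  sums equal the sum over all pairs. Row and column sums enter as data because they are evaluated by
  different closed formulas.\<close>

lemma sums_swap_of_product_bound: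
  fixes B :: "nat \<Rightarrow> nat \<Rightarrow> complex"
  assumes bd: "\<And>m n. norm (B m n) \<le> a m * b n" and a: "summable a" and b: "summable b"
    and nn: "\<And>m. a m \<ge> 0" "\<And>n. b n \<ge> 0"
    and row: "\<And>m. (\<lambda>n. B m n) sums r m" and col: "\<And>n. (\<lambda>m. B m n) sums c n"
    and r: "r sums R"
  shows "c sums R"
proof -
  have sa: "a summable_on UNIV" "b summable_on UNIV"
    using a b nn by (auto intro: summable_nonneg_imp_summable_on)
  have "(\<lambda>x. norm (case x of (m, n) \<Rightarrow> a m * b n)) summable_on (UNIV \<times> UNIV)"
    using sa nn by (subst Infinite_Sum.abs_summable_on_Sigma_iff)
      (auto simp: abs_mult infsum_cmult_right' intro!: summable_on_cmult_right summable_on_cmult_left)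
  hence "(\<lambda>x. norm (case x of (m, n) \<Rightarrow> B m n)) summable_on (UNIV \<times> UNIV)"
    by (rule Infinite_Sum.abs_summable_on_comparison_test)
       (use bd nn in \<open>auto simp: abs_mult\<close>)
  hence sm: "(\<lambda>(m, n). B m n) summable_on (UNIV \<times> UNIV)" by (rule abs_summable_summable)
  then obtain S where S: "((\<lambda>(m, n). B m n) has_sum S) (UNIV \<times> UNIV)" by (auto simp: summable_on_def)
  have "((\<lambda>n. B m n) has_sum r m) UNIV" for m
  proof (rule norm_summable_imp_has_sum[OF _ row])
    show "summable (\<lambda>n. norm (B m n))"
      by (rule summable_comparison_test'[OF summable_mult[OF b, of "a m"], of 0]) (use bd in auto)
  qed
  from has_sum_SigmaD[OF S, of r] this have "(r has_sum S) UNIV" by auto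
  hence RS: "S = R" using r by (metis has_sum_imp_sums sums_unique2)
  from S have S': "((\<lambda>(n, m). B m n) has_sum S) (UNIV \<times> UNIV)"
    by (subst (asm) has_sum_swap) (simp add: case_prod_unfold)
  have "((\<lambda>m. B m n) has_sum c n) UNIV" for n
  proof (rule norm_summable_imp_has_sum[OF _ col])
    show "summable (\<lambda>m. norm (B m n))"
      by (rule summable_comparison_test'[OF summable_mult2[OF a, of "b n"], of 0]) (use bd in auto)
  qed
  from has_sum_SigmaD[OF S', of c] this have "(c has_sum S) UNIV" by auto
  thus ?thesis using RS by (auto intro: has_sum_imp_sums)
qed

text \<open>|m t + x|^2 = (m |t| - |x|)^2 + 2 m (|t| |x| + x Re t). Dropping the square leaves a
  product of a factor in m and a factor in x, the shape that the majorant must have.\<close>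

lemma norm_lattice_point_ge:
  fixes t :: complex and m x :: real
  assumes "m \<ge> 0"
  shows "(norm (of_real m * t + of_real x))\<^sup>2 \<ge> 2 * (norm t - \<bar>Re t\<bar>) * m * \<bar>x\<bar>"
proof -
  have n: "(norm t)\<^sup>2 = (Re t)\<^sup>2 + (Im t)\<^sup>2" by (rule cmod_power2)
  have "(norm (of_real m * t + of_real x))\<^sup>2 = (m * Re t + x)\<^sup>2 + (m * Im t)\<^sup>2"
    by (simp add: cmod_power2)
  also have "\<dots> = (m * norm t - \<bar>x\<bar>)\<^sup>2 + 2 * m * norm t * \<bar>x\<bar> + 2 * m * (Re t * x)"
    using n by (simp add: power2_eq_square algebra_simps)
  also have "\<dots> \<ge> 2 * m * norm t * \<bar>x\<bar> + 2 * m * (- (\<bar>Re t\<bar> * \<bar>x\<bar>))"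
    using assms abs_ge_minus_self[of "Re t * x"] abs_mult[of "Re t" x]
    by (intro add_mono mult_left_mono) auto
  finally show ?thesis by (simp add: algebra_simps)
qed

text \<open>The quartic is the denominator left after the telescoping correction of
  \<open>1 / z^2\<close>. As |x| = n + 1 >= 1, the numbers x + 1/2 and x - 1/2 are still at least (n
  + 1)/2 in absolute value, so the product bound applies to z and to z + 1/2, z - 1/2; the latter
  two account for the 1/2 in the constant.\<close>

lemma norm_lattice_quartic_ge:
  fixes t :: complex and m n :: nat
  assumes "\<bar>x\<bar> = real (Suc n)"
  defines "c \<equiv> 2 * (norm t - \<bar>Re t\<bar>)" and "z \<equiv> of_nat (Suc m) * t + of_real x"
  shows "norm (z\<^sup>2 * (z\<^sup>2 - 1 / 4)) \<ge> (c\<^sup>2 / 2) * ((real (Suc m))\<^sup>2 * (real (Suc n))\<^sup>2)"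
proof -
  define M N where "M = real (Suc m)" and "N = real (Suc n)"
  have MN: "M \<ge> 0" "N \<ge> 1" by (auto simp: M_def N_def)
  have c: "c \<ge> 0" using abs_Re_le_cmod[of t] by (simp add: c_def)
  have z: "z = of_real M * t + of_real x" by (simp add: z_def M_def)
  have g: "(norm (of_real M * t + of_real y))\<^sup>2 \<ge> c * M * (N / 2)" if "\<bar>y\<bar> \<ge> N / 2" for y
  proof -
    have "c * M * (N / 2) \<le> c * M * \<bar>y\<bar>" using that c MN by (intro mult_left_mono) auto
    also have "\<dots> \<le> (norm (of_real M * t + of_real y))\<^sup>2"
      using norm_lattice_point_ge[of M t y] MN by (simp add: c_def)
    finally show ?thesis .
  qed
  have x: "\<bar>x + 1 / 2\<bar> \<ge> N / 2" "\<bar>x - 1 / 2\<bar> \<ge> N / 2"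
    using assms(1) MN unfolding N_def[symmetric] by (auto simp: abs_if split: if_splits)
  have 1: "norm (z\<^sup>2) \<ge> c * M * N"
    using norm_lattice_point_ge[of M t x] MN assms(1) by (simp add: c_def z norm_power N_def)
  have "(norm (z\<^sup>2 - 1/4))\<^sup>2 = (norm (z + 1/2))\<^sup>2 * (norm (z - 1/2))\<^sup>2"
    unfolding power_mult_distrib[symmetric] norm_mult[symmetric]
    by (simp add: power2_eq_square algebra_simps)
  also have "\<dots> \<ge> (c * M * (N / 2)) * (c * M * (N / 2))"
    using g[OF x(1)] g[OF x(2)] c MN by (intro mult_mono) (auto simp: z algebra_simps)
  finally have "(c * M * (N / 2))\<^sup>2 \<le> (norm (z\<^sup>2 - 1/4))\<^sup>2" by (simp add: power2_eq_square)
  hence 2: "c * M * (N / 2) \<le> norm (z\<^sup>2 - 1/4)" by (rule power2_le_imp_le) auto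
  have "(c * M * N) * (c * M * (N / 2)) \<le> norm (z\<^sup>2) * norm (z\<^sup>2 - 1/4)"
    using 1 2 c MN by (intro mult_mono) auto
  thus ?thesis unfolding norm_mult M_def[symmetric] N_def[symmetric]
    by (simp add: power2_eq_square algebra_simps)
qed

text \<open>Im (1/t) < 0, so the argument runs off into the lower half plane, where cot tends to i.
  This limit is the origin of the term \<open>pi i / t\<close> in the inversion of E_2.\<close>

lemma tendsto_cot_lower:
  fixes t :: complex
  assumes "Im t > 0"
  shows "(\<lambda>N. cot (of_real pi * ((of_nat N + 1 / 2) / t))) \<longlonglongrightarrow> \<i>"
proof -
  have t: "t \<noteq> 0" using assms by auto
  define v where "v = (\<lambda>N::nat. exp (- (2 * \<i> * of_real pi * ((of_nat N + 1 / 2) / t))))"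
  define r where "r = exp (- (2 * \<i> * of_real pi / t))"
  have "Im (inverse t) < 0" using assms t by (simp add: divide_neg_pos complex_eq_0 sum_power2_gt_zero_iff add_pos_nonneg)
  hence "norm r < 1" by (simp add: r_def norm_exp_eq_Re divide_inverse mult_less_0_iff)
  moreover have v: "v N = exp (- (\<i> * of_real pi / t)) * r ^ N" for N
    unfolding r_def v_def exp_of_nat_mult[symmetric] exp_add[symmetric]
    by (rule arg_cong[of _ _ exp]) (use t in \<open>simp add: field_simps\<close>)
  ultimately have v0: "v \<longlonglongrightarrow> 0"
    unfolding v[abs_def] by (intro tendsto_mult_right_zero LIMSEQ_power_zero)
  have "cot (of_real pi * ((of_nat N + 1 / 2) / t)) = \<i> * ((1 + v N) / (1 - v N))" for N
  proof -
    define y where "y = of_real pi * ((of_nat N + 1 / 2) / t)"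
    define u where "u = exp (\<i> * y)"
    have u: "u \<noteq> 0" "v N = inverse (u ^ 2)"
      by (simp_all add: u_def v_def y_def exp_of_nat_mult[symmetric] exp_minus[symmetric] algebra_simps)
    have "cot y = \<i> * ((u + inverse u) / (u - inverse u))"
      by (simp add: cot_def sin_exp_eq cos_exp_eq u_def exp_minus divide_simps)
    also have "(u + inverse u) / (u - inverse u) = (1 + v N) / (1 - v N)"
    proof (cases "u ^ 2 = 1")
      case True
      hence "inverse u = u" using u(1) by (simp add: field_simps power2_eq_square)
      thus ?thesis using True u(2) by simp
    next
      case False
      hence "u - inverse u \<noteq> 0" "1 - v N \<noteq> 0" using u by (auto simp: field_simps power2_eq_square)
      thus ?thesis using u by (simp add: divide_simps power2_eq_square) (auto simp: algebra_simps)
    qed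
    finally show ?thesis by (simp add: y_def)
  qed
  moreover have "(\<lambda>N. \<i> * ((1 + v N) / (1 - v N))) \<longlonglongrightarrow> \<i> * ((1 + 0) / (1 - 0))"
    by (intro tendsto_intros v0) auto
  ultimately show ?thesis by simp
qed


lemma telescope_inverse_pair:
  fixes w :: complex
  shows "(\<Sum>n<N. (1 / (w + of_real (real (Suc n) - 1 / 2)) - 1 / (w + of_real (real (Suc n) + 1 / 2)))
            + (1 / (w - of_real (real (Suc n) + 1 / 2)) - 1 / (w - of_real (real (Suc n) - 1 / 2)))) =
         1 / (w + 1 / 2) - 1 / (w - 1 / 2) - 1 / (w + of_real (real N + 1 / 2)) + 1 / (w - of_real (real N + 1 / 2))"
  by (induction N) (simp_all add: algebra_simps)

lemma inverse_diff_half: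
  fixes w y :: complex
  assumes "w + y \<noteq> 0" "w - y \<noteq> 0"
  shows "1 / (w + y) - 1 / (w - y) = - 2 * y / (w\<^sup>2 - y\<^sup>2)"
proof -
  have "w\<^sup>2 - y\<^sup>2 = (w + y) * (w - y)" by (simp add: power2_eq_square algebra_simps)
  thus ?thesis using assms by (simp add: divide_simps)
qed

lemma lattice_point_nonzero:
  fixes t :: complex
  assumes "Im t > 0" "m > 0"
  shows "of_nat m * t + of_real x \<noteq> 0" "of_nat m * t - of_real x \<noteq> 0"
proof -
  have "Im (of_nat m * t + of_real x) \<noteq> 0" "Im (of_nat m * t - of_real x) \<noteq> 0" using assms by auto
  thus "of_nat m * t + of_real x \<noteq> 0" "of_nat m * t - of_real x \<noteq> 0" by (metis zero_complex.sel(2))+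
qed

lemma cot_pair_lattice_sums:
  fixes t :: complex
  assumes "Im t > 0" "x > 0"
  shows "(\<lambda>m. 2 * of_real x / ((of_nat (Suc m) * t)\<^sup>2 - (of_real x)\<^sup>2)) sums
    ((1 / t) * (1 / (of_real x / t) - of_real pi * cot (of_real pi * (of_real x / t))))"
proof -
  have t: "t \<noteq> 0" using assms by auto
  define w where "w = of_real x / t"
  have w: "w \<notin> \<int>"
  proof
    assume "w \<in> \<int>"
    then obtain k where k: "w = of_int k" by (auto elim: Ints_cases)
    hence "of_real x = of_int k * t" using t by (simp add: w_def field_simps)
    hence "Im (of_real x :: complex) = of_int k * Im t" by simp
    hence "k = 0" using assms by auto
    with k show False using assms t by (simp add: w_def)
  qed
  have "(1 / t) * (2 * w / ((of_nat (Suc m))\<^sup>2 - w\<^sup>2)) = 2 * of_real x / ((of_nat (Suc m) * t)\<^sup>2 - (of_real x)\<^sup>2)" for m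
  proof -
    have "(of_nat (Suc m))\<^sup>2 - w\<^sup>2 = ((of_nat (Suc m) * t)\<^sup>2 - (of_real x)\<^sup>2) / t ^ 2"
      using t by (simp add: w_def power_mult_distrib power_divide diff_divide_distrib)
    thus ?thesis using t by (simp add: w_def power2_eq_square)
  qed
  note eq = this
  show ?thesis
    using sums_mult[OF cot_pair_sums[OF w], of "1 / t"] unfolding eq unfolding w_def .
qed

text \<open>Hurwitz's argument: subtracting from \<open>1 / z\<^sup>2\<close> the telescoping term
  \<open>1 / (z - 1/2) - 1 / (z + 1/2)\<close> makes the double series over the lattice absolutely convergent;
  the anomaly comes from the two orders of summation of the telescoping term.\<close>

lemma eisenstein2_inversion:
  fixes t :: complex
  defines "R \<equiv> \<lambda>z::complex. (of_real pi)\<^sup>2 / sin (of_real pi * z) ^ 2"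
  assumes t: "Im t > 0" and S: "(\<lambda>m. R (of_nat (Suc m) * t)) sums S"
    and S': "(\<lambda>m. R (of_nat (Suc m) * (- 1 / t))) sums S'"
  shows "S' / t\<^sup>2 + (of_real pi)\<^sup>2 / 6 / t ^ 2 = S + (of_real pi)\<^sup>2 / 6 - of_real pi * \<i> / t"
proof -
  define z2 :: complex where "z2 = (of_real pi)\<^sup>2 / 6"
  have t0: "t \<noteq> 0" using t by auto
  note nz = lattice_point_nonzero[OF t zero_less_Suc]
  \<comment> \<open>Rows are indexed by m, columns by n, both shifted by one. \<open>P\<close> pairs
    the lattice points m t + n and m t - n, \<open>d\<close> holds the telescoping corrections of
    the same two points, and \<open>B\<close> is their absolutely summable difference.\<close>
  define P where "P = (\<lambda>m n. 1 / (of_nat (Suc m) * t + of_nat (Suc n))\<^sup>2 + 1 / (of_nat (Suc m) * t - of_nat (Suc n))\<^sup>2)"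
  define d where "d = (\<lambda>m n. (1 / (of_nat (Suc m) * t + of_real (real (Suc n) - 1 / 2)) - 1 / (of_nat (Suc m) * t + of_real (real (Suc n) + 1 / 2)))
            + (1 / (of_nat (Suc m) * t - of_real (real (Suc n) + 1 / 2)) - 1 / (of_nat (Suc m) * t - of_real (real (Suc n) - 1 / 2))))"
  define B where "B = (\<lambda>m n. P m n - d m n)"
  define c where "c = 2 * (norm t - \<bar>Re t\<bar>)"
  have c: "c > 0"
  proof -
    have "\<bar>Re t\<bar> < norm t" using t by (simp add: cmod_def real_less_rsqrt)
    thus ?thesis by (simp add: c_def)
  qed
  have z2: "(\<lambda>n. 1 / (of_nat (Suc n))\<^sup>2) sums z2"
    using sums_of_real[OF inverse_squares_sums, where ?'a = complex] by (simp add: z2_def add_ac)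
  have one: "1 / z\<^sup>2 - (1 / (z - 1/2) - 1 / (z + 1/2)) = - (1/4) / (z\<^sup>2 * (z\<^sup>2 - 1/4))"
    if "z \<noteq> 0" "z - 1/2 \<noteq> 0" "z + 1/2 \<noteq> 0" for z :: complex
  proof -
    have e: "z\<^sup>2 - 1/4 = (z - 1/2) * (z + 1/2)" by (simp add: power2_eq_square algebra_simps)
    show ?thesis unfolding e using that by (simp add: divide_simps) (simp add: algebra_simps power2_eq_square)
  qed
  have bd: "norm (B m n) \<le> 1 / c\<^sup>2 * (1 / (real (Suc m))\<^sup>2) * (1 / (real (Suc n))\<^sup>2)" for m n
  proof -
    define z1 z2 where "z1 = of_nat (Suc m) * t + of_real (real (Suc n))"
      and "z2 = of_nat (Suc m) * t + of_real (- real (Suc n))"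
    define K where "K = c\<^sup>2 / 2 * ((real (Suc m))\<^sup>2 * (real (Suc n))\<^sup>2)"
    have K: "K > 0" using c by (simp add: K_def)
    have z12: "norm (z1\<^sup>2 * (z1\<^sup>2 - 1 / 4)) \<ge> K" "norm (z2\<^sup>2 * (z2\<^sup>2 - 1 / 4)) \<ge> K"
      unfolding z1_def z2_def c_def K_def by (rule norm_lattice_quartic_ge; simp)+
    have zn: "z1 \<noteq> 0" "z1 - 1/2 \<noteq> 0" "z1 + 1/2 \<noteq> 0" "z2 \<noteq> 0" "z2 - 1/2 \<noteq> 0" "z2 + 1/2 \<noteq> 0"
    proof -
      have e: "z1 - 1/2 = of_nat (Suc m) * t + of_real (real (Suc n) - 1/2)" "z1 + 1/2 = of_nat (Suc m) * t + of_real (real (Suc n) + 1/2)"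
        "z2 - 1/2 = of_nat (Suc m) * t + of_real (- real (Suc n) - 1/2)" "z2 + 1/2 = of_nat (Suc m) * t + of_real (- real (Suc n) + 1/2)"
        by (simp_all add: z1_def z2_def)
      show "z1 - 1/2 \<noteq> 0" "z1 + 1/2 \<noteq> 0" "z2 - 1/2 \<noteq> 0" "z2 + 1/2 \<noteq> 0" unfolding e by (rule nz)+
      show "z1 \<noteq> 0" "z2 \<noteq> 0" unfolding z1_def z2_def by (rule nz)+
    qed
    have "B m n = (1 / z1\<^sup>2 - (1 / (z1 - 1/2) - 1 / (z1 + 1/2))) + (1 / z2\<^sup>2 - (1 / (z2 - 1/2) - 1 / (z2 + 1/2)))"
      unfolding B_def P_def d_def z1_def z2_def by (simp add: algebra_simps)
    also have "\<dots> = - (1/4) / (z1\<^sup>2 * (z1\<^sup>2 - 1/4)) + - (1/4) / (z2\<^sup>2 * (z2\<^sup>2 - 1/4))"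
      using zn by (subst (1 2) one) auto
    also have "norm \<dots> \<le> (1/4) / K + (1/4) / K"
    proof -
      have "norm (- (1/4) / w) \<le> (1/4) / K" if "K \<le> norm w" for w :: complex
        using that K unfolding norm_divide by (intro frac_le) auto
      thus ?thesis using z12 by (intro norm_triangle_le add_mono) auto
    qed
    also have "\<dots> = 1 / c\<^sup>2 * (1 / (real (Suc m))\<^sup>2) * (1 / (real (Suc n))\<^sup>2)"
      using c by (simp add: K_def)
    finally show ?thesis .
  qed
  have sq: "summable (\<lambda>n. 1 / (real (Suc n))\<^sup>2)"
    using inverse_squares_sums by (auto simp: sums_iff add_ac)
  \<comment> \<open>Minus the total of \<open>d\<close> when rows are summed first: each row
    telescopes to \<open>- 1 / ((m t)^2 - 1/4)\<close>.\<close>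
  define Z where "Z = (1 / t) * (1 / (of_real (1/2) / t) - of_real pi * cot (of_real pi * (of_real (1/2) / t)))"
  have Z: "(\<lambda>m. 1 / ((of_nat (Suc m) * t)\<^sup>2 - 1 / 4)) sums Z"
    using cot_pair_lattice_sums[OF t, of "1/2"] unfolding Z_def[symmetric] by (simp add: power_divide)
  have notint: "of_nat (Suc k) * w \<notin> \<int>" if "Im w \<noteq> 0" for w k
  proof
    assume "of_nat (Suc k) * w \<in> \<int>"
    then obtain j where "of_nat (Suc k) * w = of_int j" by (auto elim: Ints_cases)
    hence "Im (of_nat (Suc k) * w) = Im (of_int j)" by simp
    thus False using that by simp
  qed
  have dsum: "(\<Sum>n<N. d m n) = - 1 / ((of_nat (Suc m) * t)\<^sup>2 - 1 / 4)
      + 2 * of_real (real N + 1/2) / ((of_nat (Suc m) * t)\<^sup>2 - (of_real (real N + 1/2))\<^sup>2)" for m N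
  proof -
    have "(\<Sum>n<N. d m n) = (1 / (of_nat (Suc m) * t + 1/2) - 1 / (of_nat (Suc m) * t - 1/2))
       - (1 / (of_nat (Suc m) * t + of_real (real N + 1/2)) - 1 / (of_nat (Suc m) * t - of_real (real N + 1/2)))"
      unfolding d_def telescope_inverse_pair by simp
    also have "1 / (of_nat (Suc m) * t + 1/2) - 1 / (of_nat (Suc m) * t - 1/2) = - 1 / ((of_nat (Suc m) * t)\<^sup>2 - 1 / 4)"
      using inverse_diff_half[of "of_nat (Suc m) * t" "1/2"] nz[of m "1/2"] by (simp add: power_divide)
    also have "1 / (of_nat (Suc m) * t + of_real (real N + 1/2)) - 1 / (of_nat (Suc m) * t - of_real (real N + 1/2))
       = - 2 * of_real (real N + 1/2) / ((of_nat (Suc m) * t)\<^sup>2 - (of_real (real N + 1/2))\<^sup>2)"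
      by (rule inverse_diff_half) (rule nz)+
    finally show ?thesis by (simp only: mult_minus_left minus_divide_left[symmetric] diff_minus_eq_add)
  qed
  have row: "(\<lambda>n. B m n) sums (R (of_nat (Suc m) * t) - 1 / (of_nat (Suc m) * t)\<^sup>2 + 1 / ((of_nat (Suc m) * t)\<^sup>2 - 1 / 4))" for m
  proof -
    have 1: "(\<lambda>n. P m n) sums (R (of_nat (Suc m) * t) - 1 / (of_nat (Suc m) * t)\<^sup>2)"
      unfolding P_def R_def by (rule inverse_square_pair_sums) (use notint t in auto)
    have inf: "filterlim (\<lambda>N. w + of_real (real N + 1/2) :: complex) at_infinity sequentially" for w
    proof -
      have "filterlim (\<lambda>N. (w + 1/2) + of_nat N :: complex) at_infinity sequentially"
        by (intro tendsto_add_filterlim_at_infinity[OF tendsto_const] tendsto_of_nat)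
      thus ?thesis by (simp add: algebra_simps)
    qed
    have i0: "(\<lambda>N. 1 / (w + of_real (real N + 1/2)) :: complex) \<longlonglongrightarrow> 0" for w
      using filterlim_compose[OF tendsto_inverse_0 inf[of w]] by (simp only: inverse_eq_divide)
    have i1: "(\<lambda>N. 1 / (w - of_real (real N + 1/2)) :: complex) \<longlonglongrightarrow> 0" for w
    proof -
      have "1 / (w - of_real (real N + 1/2)) = - (1 / (- w + of_real (real N + 1/2)))" for N
        by (metis add_uminus_conv_diff minus_diff_eq minus_divide_right uminus_add_conv_diff)
      thus ?thesis using tendsto_minus[OF i0[of "- w"]] by simp
    qed
    have "(\<lambda>n. d m n) sums (1 / (of_nat (Suc m) * t + 1/2) - 1 / (of_nat (Suc m) * t - 1/2) - 0 + 0)"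
      unfolding sums_def d_def telescope_inverse_pair by (intro tendsto_intros i0 i1)
    moreover have "1 / (of_nat (Suc m) * t + 1/2) - 1 / (of_nat (Suc m) * t - 1/2) = - 1 / ((of_nat (Suc m) * t)\<^sup>2 - 1 / 4)"
      using inverse_diff_half[of "of_nat (Suc m) * t" "1/2"] nz[of m "1/2"] by (simp add: power_divide)
    ultimately have "(\<lambda>n. d m n) sums (- 1 / ((of_nat (Suc m) * t)\<^sup>2 - 1 / 4))" by simp
    from sums_diff[OF 1 this] show ?thesis by (simp add: B_def)
  qed
  have rowsum: "(\<lambda>m. R (of_nat (Suc m) * t) - 1 / (of_nat (Suc m) * t)\<^sup>2 + 1 / ((of_nat (Suc m) * t)\<^sup>2 - 1 / 4)) sums (S - z2 / t\<^sup>2 + Z)"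
    using sums_add[OF sums_diff[OF S sums_divide[OF z2, of "t\<^sup>2"]] Z] by (simp add: power_mult_distrib)
  have Pcol: "(\<lambda>m. P m n) sums (R (of_nat (Suc n) * (- 1 / t)) / t\<^sup>2 - 1 / (of_nat (Suc n))\<^sup>2)" for n
  proof -
    define w where "w = of_nat (Suc n) / t"
    have "w \<notin> \<int>"
      using notint[of "1 / t" n] t t0 by (simp add: w_def Im_divide)
    from sums_divide[OF inverse_square_pair_sums[OF this], of "t\<^sup>2"]
    have "(\<lambda>m. (1 / (w + of_nat (Suc m))\<^sup>2 + 1 / (w - of_nat (Suc m))\<^sup>2) / t\<^sup>2) sums ((R w - 1 / w\<^sup>2) / t\<^sup>2)"
      unfolding R_def .
    moreover have "(1 / (w + of_nat (Suc m))\<^sup>2 + 1 / (w - of_nat (Suc m))\<^sup>2) / t\<^sup>2 = P m n" for m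
    proof -
      have "(w + of_nat (Suc m))\<^sup>2 * t\<^sup>2 = (of_nat (Suc m) * t + of_nat (Suc n))\<^sup>2"
        "(w - of_nat (Suc m))\<^sup>2 * t\<^sup>2 = (of_nat (Suc m) * t - of_nat (Suc n))\<^sup>2"
        using t0 by (simp_all add: w_def power_mult_distrib[symmetric] algebra_simps del: of_nat_Suc)
          (simp_all add: power2_eq_square algebra_simps)
      thus ?thesis by (simp add: P_def add_divide_distrib)
    qed
    moreover have "R w = R (of_nat (Suc n) * (- 1 / t))"
    proof -
      have "of_real pi * (of_nat (Suc n) * (- 1 / t)) = - (of_real pi * w)" by (simp add: w_def)
      thus ?thesis unfolding R_def by simp
    qed
    moreover have "1 / w\<^sup>2 / t\<^sup>2 = 1 / (of_nat (Suc n))\<^sup>2" using t0 by (simp add: w_def power_divide)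
    ultimately show ?thesis by (simp add: diff_divide_distrib)
  qed
  \<comment> \<open>The total over m of the first N entries of the rows of \<open>d\<close>. Column
    n of \<open>d\<close> then sums to \<open>D (Suc n) - D n\<close>, and summing columns first
    gives lim D - D 0 = - Z - pi i / t, against - Z in the other order.\<close>
  define D where "D = (\<lambda>N. - Z + (1 / t) * (1 / (of_real (real N + 1/2) / t) - of_real pi * cot (of_real pi * (of_real (real N + 1/2) / t))))"
  have Dcol: "(\<lambda>m. \<Sum>n<N. d m n) sums D N" for N
    unfolding dsum D_def using sums_add[OF sums_minus[OF Z] cot_pair_lattice_sums[OF t, of "real N + 1/2"]] by simp
  define col where "col = (\<lambda>n. (R (of_nat (Suc n) * (- 1 / t)) / t\<^sup>2 - 1 / (of_nat (Suc n))\<^sup>2) - (D (Suc n) - D n))"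
  have "(\<lambda>m. d m n) sums (D (Suc n) - D n)" for n
    using sums_diff[OF Dcol[of "Suc n"] Dcol[of n]] by simp
  hence col: "(\<lambda>m. B m n) sums col n" for n
    unfolding B_def col_def by (intro sums_diff Pcol)
  have "col sums (S - z2 / t\<^sup>2 + Z)"
    by (rule sums_swap_of_product_bound[OF bd _ sq _ _ row col rowsum]) (use summable_mult[OF sq, of "1 / c\<^sup>2"] in auto)
  moreover have "col sums (S' / t\<^sup>2 - z2 - (- Z - of_real pi * \<i> / t - D 0))"
  proof -
    have "(\<lambda>N. (of_nat N + 1/2) :: complex) = (\<lambda>N. of_real (real N + 1/2))" by (auto simp: fun_eq_iff)
    hence ct: "(\<lambda>N. cot (of_real pi * (of_real (real N + 1/2) / t))) \<longlonglongrightarrow> \<i>"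
      using tendsto_cot_lower[OF t] by (simp add: fun_eq_iff)
    have "(\<lambda>N. t * inverse (1/2 + of_nat N)) \<longlonglongrightarrow> t * 0"
      by (rule tendsto_mult[OF tendsto_const filterlim_compose[OF tendsto_inverse_0
            tendsto_add_filterlim_at_infinity[OF tendsto_const tendsto_of_nat]]])
    hence iv: "(\<lambda>N. 1 / (of_real (real N + 1/2) / t)) \<longlonglongrightarrow> 0"
    proof -
      have "t * inverse (1/2 + of_nat N) = 1 / (of_real (real N + 1/2) / t)" for N
        by (simp add: inverse_eq_divide add.commute)
      thus ?thesis using \<open>(\<lambda>N. t * inverse (1/2 + of_nat N)) \<longlonglongrightarrow> t * 0\<close> by simp
    qed
    have "D \<longlonglongrightarrow> - Z + (1 / t) * (0 - of_real pi * \<i>)"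
      unfolding D_def by (intro tendsto_intros iv ct)
    hence "(\<lambda>n. D (Suc n) - D n) sums (- Z + (1 / t) * (0 - of_real pi * \<i>) - D 0)"
      by (rule telescope_sums)
    from sums_diff[OF sums_diff[OF sums_divide[OF S', of "t\<^sup>2"] z2] this]
    show ?thesis unfolding col_def by simp
  qed
  ultimately have "S - z2 / t\<^sup>2 + Z = S' / t\<^sup>2 - z2 - (- Z - of_real pi * \<i> / t - D 0)"
    by (rule sums_unique2)
  moreover have "D 0 = 0" by (simp add: D_def Z_def)
  ultimately show ?thesis by (simp add: z2_def[symmetric] algebra_simps)
qed

section \<open>The inversion formula for the eta function\<close>

definition divsum :: "nat \<Rightarrow> nat" where "divsum k = \<Sum>{d. d dvd k}"

text \<open>Every natural number divides 0, and a sum over an infinite set is 0 by convention; so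
  the series below may start at k = 0.\<close>

lemma divsum_0 [simp]: "divsum 0 = 0"
  by (simp add: divsum_def infinite_UNIV_nat)

lemma divsum_1 [simp]: "divsum (Suc 0) = 1"
  by (simp add: divsum_def)

lemma divsum_le: "divsum k \<le> k ^ 2"
proof (cases "k = 0")
  case False
  have "divsum k \<le> card {d. d dvd k} * k"
    unfolding divsum_def using False by (intro sum_bounded_above[THEN order_trans]) (auto intro: dvd_imp_le)
  also have "card {d. d dvd k} \<le> card {1..k}"
    using False by (intro card_mono) (auto intro: dvd_imp_le Suc_leI)
  finally show ?thesis by (simp add: power2_eq_square)
qed simp

text \<open>The divisors of 2k are those of k together with their doubles, and the overlap consists
  of the doubles of the divisors of k/2. This is the coefficient form of an identity between four
  eta functions.\<close>

lemma divsum_double: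
  assumes "k > 0"
  shows "divsum (2 * k) + (if even k then 2 * divsum (k div 2) else 0) = 3 * divsum k"
proof -
  let ?D = "\<lambda>k::nat. {d. d dvd k}"
  have fin: "finite (?D k)" "finite ((*) 2 ` ?D k)" using assms by auto
  have "?D (2 * k) = ?D k \<union> (*) 2 ` ?D k"
  proof (intro equalityI subsetI)
    fix d assume d: "d \<in> ?D (2 * k)"
    show "d \<in> ?D k \<union> (*) 2 ` ?D k"
    proof (cases "even d")
      case True
      then obtain e where "d = 2 * e" by auto
      thus ?thesis using d by auto
    next
      case False
      hence "coprime d 2" by simp
      thus ?thesis using d by (simp add: coprime_dvd_mult_right_iff)
    qed
  qed auto
  moreover have "?D k \<inter> (*) 2 ` ?D k = (if even k then (*) 2 ` ?D (k div 2) else {})"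
  proof (cases "even k")
    case True
    then obtain j where "k = 2 * j" by auto
    thus ?thesis by auto
  next
    case False
    thus ?thesis by (auto dest: dvd_mult_left)
  qed
  moreover have s2: "sum id ((*) 2 ` S) = 2 * sum id S" for S :: "nat set"
    by (subst sum.reindex) (auto simp: inj_on_def sum_distrib_left)
  ultimately have "sum id (?D (2 * k)) + sum id (if even k then (*) 2 ` ?D (k div 2) else {}) = sum id (?D k) + 2 * sum id (?D k)"
    using sum.union_inter[OF fin, of id] by simp
  thus ?thesis using s2[of "?D (k div 2)"] by (auto simp: divsum_def id_def)
qed

text \<open>The logarithm of \<open>\<Prod>n. 1 - x ^ n\<close>.\<close>
definition log_euler :: "complex fps" where
  "log_euler = Abs_fps (\<lambda>k. - of_nat (divsum k) / of_nat k)"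

lemma log_euler_nth: "fps_nth log_euler k = - of_nat (divsum k) / of_nat k"
  by (simp add: log_euler_def)

lemma log_euler_0 [simp]: "fps_nth log_euler 0 = 0"
  by (simp add: log_euler_nth)

lemma fps_deriv_log_euler_nth: "fps_nth (fps_deriv log_euler) k = - of_nat (divsum (Suc k))"
  by (simp add: log_euler_nth del: of_nat_Suc)


lemma fps_conv_radius_log_euler: "fps_conv_radius log_euler \<ge> 1"
  unfolding fps_conv_radius_def
proof (rule conv_radius_geI_ex)
  fix r :: real assume r: "0 < r" "ereal r < 1"
  have "summable (\<lambda>k. norm (of_nat (Suc k) * r ^ k))"
    using geometric_deriv_sums[of r] r by (auto simp: sums_iff abs_mult)
  hence "summable (\<lambda>k. fps_nth log_euler k * of_real r ^ k)"
  proof (rule summable_comparison_test'[where N = 0])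
    fix k :: nat
    have "real (divsum k) / real k \<le> real k"
    proof -
      have "real (divsum k) \<le> real k * real k"
        using divsum_le[of k] by (simp add: power2_eq_square flip: of_nat_mult)
      thus ?thesis by (cases "k = 0") (simp_all add: divide_le_eq)
    qed
    hence "real (divsum k) / real k \<le> real (Suc k)" by simp
    thus "norm (fps_nth log_euler k * of_real r ^ k) \<le> norm (of_nat (Suc k) * r ^ k)"
      using r mult_right_mono[of "real (divsum k) / real k" "real (Suc k)" "r ^ k"]
      by (simp add: log_euler_nth norm_mult norm_divide norm_power del: of_nat_Suc)
  qed
  thus "\<exists>z. norm z = r \<and> summable (\<lambda>n. fps_nth log_euler n * z ^ n)"
    using r by (intro exI[of _ "of_real r"]) auto
qed

definition log_E :: "complex \<Rightarrow> complex" where "log_E = eval_fps log_euler"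

lemma log_E_sums:
  assumes "norm x < 1"
  shows "(\<lambda>k. - of_nat (divsum k) / of_nat k * x ^ k) sums log_E x"
proof -
  have "ereal (norm x) < fps_conv_radius log_euler"
    using assms fps_conv_radius_log_euler by (metis ereal_less(3) less_le_trans)
  from sums_eval_fps[OF this] show ?thesis by (simp add: log_E_def log_euler_nth)
qed

text \<open>At x = q, E_2 is 1 minus 24 times this series.\<close>

definition divsum_series :: "complex \<Rightarrow> complex" where
  "divsum_series x = (\<Sum>k. of_nat (divsum k) * x ^ k)"

lemma log_E_has_field_derivative:
  assumes "norm x < 1"
  shows "\<exists>D. (log_E has_field_derivative D) (at x) \<and> x * D = - divsum_series x"
    and "summable (\<lambda>k. of_nat (divsum k) * x ^ k)"
proof -
  have r: "ereal (norm x) < fps_conv_radius log_euler"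
    using assms fps_conv_radius_log_euler by (metis ereal_less(3) less_le_trans)
  hence r': "ereal (norm x) < fps_conv_radius (fps_deriv log_euler)"
    using fps_conv_radius_deriv less_le_trans by blast
  define D where "D = eval_fps (fps_deriv log_euler) x"
  have "(\<lambda>k. - of_nat (divsum (Suc k)) * x ^ k) sums D"
    using sums_eval_fps[OF r'] unfolding fps_deriv_log_euler_nth D_def .
  from sums_mult[OF this, of "- x"]
  have "(\<lambda>k. of_nat (divsum (Suc k)) * x ^ Suc k) sums (- x * D)" by (simp add: mult_ac)
  hence s: "(\<lambda>k. of_nat (divsum k) * x ^ k) sums (- x * D)"
    by (subst (asm) sums_Suc_iff) simp
  thus "summable (\<lambda>k. of_nat (divsum k) * x ^ k)" by (auto simp: sums_iff)
  have "(log_E has_field_derivative D) (at x)"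
    unfolding log_E_def D_def by (rule has_field_derivative_eval_fps[OF r])
  moreover have "x * D = - divsum_series x" using s by (simp add: divsum_series_def sums_iff)
  ultimately show "\<exists>D. (log_E has_field_derivative D) (at x) \<and> x * D = - divsum_series x" by blast
qed

lemma holomorphic_log_E: "log_E holomorphic_on ball 0 1"
proof -
  have "\<exists>D. (log_E has_field_derivative D) (at x)" if "x \<in> ball 0 1" for x
    using log_E_has_field_derivative(1)[of x] that by auto
  thus ?thesis by (simp add: holomorphic_on_open)
qed

lemma holomorphic_log_E_compose [holomorphic_intros]:
  assumes "f holomorphic_on A" "\<And>z. z \<in> A \<Longrightarrow> norm (f z) < 1"
  shows "(\<lambda>z. log_E (f z)) holomorphic_on A"
proof -
  have "f ` A \<subseteq> ball 0 1" using assms(2) by auto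
  from holomorphic_on_compose_gen[OF assms(1) holomorphic_log_E this] show ?thesis by (simp add: o_def)
qed

text \<open>Logarithm of E(x) E(-x) E(x^4) = E(x^2)^3 for the Euler product E. Odd powers cancel
  between x and -x, and the even ones reduce to \<open>divsum_double\<close>.\<close>

lemma log_E_quadruple:
  assumes "norm x < 1"
  shows "log_E x + log_E (- x) + log_E (x ^ 4) = 3 * log_E (x\<^sup>2)"
proof -
  define a :: "nat \<Rightarrow> complex" where "a = (\<lambda>k. - of_nat (divsum k) / of_nat k)"
  have sm: "strict_mono (\<lambda>n::nat. 2 * n)" by (auto simp: strict_mono_def)
  have rng: "odd n" if "n \<notin> range (\<lambda>n::nat. 2 * n)" for n using that by (auto elim: evenE)
  have n: "norm (x ^ 4) < 1" "norm (x\<^sup>2) < 1" using assms by (simp_all add: norm_power power_less_one_iff)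
  have 1: "(\<lambda>k. a k * x ^ k + a k * (- x) ^ k) sums (log_E x + log_E (- x))"
    unfolding a_def by (intro sums_add log_E_sums) (use assms in auto)
  have "(\<lambda>k. a (2 * k) * x ^ (2 * k) + a (2 * k) * (- x) ^ (2 * k)) sums (log_E x + log_E (- x))"
    by (subst sums_mono_reindex[OF sm]) (use 1 rng in auto)
  hence 1: "(\<lambda>k. 2 * a (2 * k) * (x\<^sup>2) ^ k) sums (log_E x + log_E (- x))"
  proof -
    have "x ^ (2 * k) = (x\<^sup>2) ^ k" "(- x) ^ (2 * k) = (x\<^sup>2) ^ k" for k by (simp_all add: power_mult)
    thus ?thesis using \<open>(\<lambda>k. a (2 * k) * x ^ (2 * k) + a (2 * k) * (- x) ^ (2 * k)) sums (log_E x + log_E (- x))\<close>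
      by (simp add: algebra_simps)
  qed
  have "(\<lambda>k. if even k then a (k div 2) * (x\<^sup>2) ^ k else 0) sums log_E (x ^ 4)"
  proof (subst sums_mono_reindex[OF sm, symmetric])
    show "(\<lambda>n. if even (2 * n) then a (2 * n div 2) * (x\<^sup>2) ^ (2 * n) else 0) sums log_E (x ^ 4)"
      using log_E_sums[OF n(1)] by (simp add: a_def flip: power_mult)
  qed (use rng in auto)
  from sums_add[OF 1 this]
  have "(\<lambda>k. 2 * a (2 * k) * (x\<^sup>2) ^ k + (if even k then a (k div 2) * (x\<^sup>2) ^ k else 0)) sums
     (log_E x + log_E (- x) + log_E (x ^ 4))" .
  moreover have "2 * a (2 * k) * (x\<^sup>2) ^ k + (if even k then a (k div 2) * (x\<^sup>2) ^ k else 0) = 3 * (a k * (x\<^sup>2) ^ k)" for k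
  proof (cases "k = 0")
    case False
    have "of_nat (divsum (2 * k) + (if even k then 2 * divsum (k div 2) else 0)) = (of_nat (3 * divsum k) :: complex)"
      using divsum_double[of k] False by simp
    hence e: "of_nat (divsum (2 * k)) + (if even k then 2 * of_nat (divsum (k div 2)) else 0) = (3 * of_nat (divsum k) :: complex)"
      by (auto split: if_splits)
    have "2 * a (2 * k) + (if even k then a (k div 2) else 0) = 
       - (of_nat (divsum (2 * k)) + (if even k then 2 * of_nat (divsum (k div 2)) else 0)) / of_nat k"
      using False by (auto simp: a_def field_simps elim!: evenE)
    also have "\<dots> = 3 * a k" unfolding e by (simp add: a_def)
    finally have e2: "2 * a (2 * k) + (if even k then a (k div 2) else 0) = 3 * a k" .
    have "2 * a (2 * k) * (x\<^sup>2) ^ k + (if even k then a (k div 2) * (x\<^sup>2) ^ k else 0) =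
       (2 * a (2 * k) + (if even k then a (k div 2) else 0)) * (x\<^sup>2) ^ k" by (simp add: algebra_simps)
    thus ?thesis unfolding e2 by simp
  qed (simp add: a_def)
  ultimately have "(\<lambda>k. 3 * (a k * (x\<^sup>2) ^ k)) sums (log_E x + log_E (- x) + log_E (x ^ 4))" by simp
  moreover have "(\<lambda>k. 3 * (a k * (x\<^sup>2) ^ k)) sums (3 * log_E (x\<^sup>2))"
    using sums_mult[OF log_E_sums[OF n(2)], of 3] by (simp add: a_def)
  ultimately show ?thesis by (rule sums_unique2)
qed

text \<open>Two ways of summing d q^k over the pairs with d | k: grouping by k gives the divisor
  sums, grouping by the cofactor k / d gives the Lambert series.\<close>

lemma divsum_series_lambert:
  fixes q :: complex
  assumes q: "norm q < 1"
  shows "(\<lambda>m. \<Sum>n. of_nat n * (q ^ Suc m) ^ n) sums divsum_series q"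
proof -
  define f where "f = (\<lambda>(k::nat, d::nat). of_nat d * q ^ k)"
  let ?D = "\<lambda>k::nat. {d. d dvd k}"
  let ?A = "Sigma {0<..} ?D"
  have fin: "finite (?D k)" if "k \<in> {0<..}" for k using that by auto
  have nf: "(\<Sum>\<^sub>\<infinity>d\<in>?D k. norm (f (k, d))) = real (divsum k) * norm q ^ k" if "k \<in> {0<..}" for k
    using fin[OF that] by (simp add: f_def divsum_def norm_mult norm_power sum_distrib_right)
  have "summable (\<lambda>k. real (divsum k) * norm q ^ k)"
  proof -
    have "summable (\<lambda>k. of_nat (divsum k) * (of_real (norm q)) ^ k :: complex)"
      by (rule log_E_has_field_derivative(2)) (use q in auto)
    hence "summable (\<lambda>k. complex_of_real (real (divsum k) * norm q ^ k))" by simp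
    thus ?thesis by (subst (asm) summable_of_real_iff)
  qed
  hence "(\<lambda>k. real (divsum k) * norm q ^ k) summable_on UNIV"
    by (rule summable_nonneg_imp_summable_on) auto
  hence "(\<lambda>k. real (divsum k) * norm q ^ k) summable_on {0<..}"
    by (rule summable_on_subset_banach) auto
  hence "(\<lambda>k. norm (\<Sum>\<^sub>\<infinity>d\<in>?D k. norm (f (k, d)))) summable_on {0<..}"
    by (rule summable_on_cong[THEN iffD1, rotated]) (use nf in \<open>simp add: infsum_nonneg\<close>)
  hence "(\<lambda>x. norm (f x)) summable_on ?A"
    by (subst Infinite_Sum.abs_summable_on_Sigma_iff) (use fin in auto)
  hence "f summable_on ?A" by (rule abs_summable_summable)
  then obtain S where S: "(f has_sum S) ?A" by (auto simp: summable_on_def)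
  have "((\<lambda>k. of_nat (divsum k) * q ^ k) has_sum S) {0<..}"
  proof (rule has_sum_SigmaD[OF S])
    fix k :: nat assume k: "k \<in> {0<..}"
    have "((\<lambda>d. f (k, d)) has_sum (\<Sum>d\<in>?D k. f (k, d))) (?D k)" by (rule has_sum_finite) (rule fin[OF k])
    thus "((\<lambda>d. f (k, d)) has_sum of_nat (divsum k) * q ^ k) (?D k)"
      by (simp add: f_def divsum_def sum_distrib_right)
  qed
  hence "((\<lambda>k. of_nat (divsum k) * q ^ k) has_sum S) UNIV"
    by (rule has_sum_cong_neutral[THEN iffD1, rotated -1]) (auto simp: not_less)
  hence S1: "S = divsum_series q" unfolding divsum_series_def
    using has_sum_imp_sums sums_unique by blast
  \<comment> \<open>The divisor is n and the cofactor is m + 1; the pairs with n = 0 are left out,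
    and their terms vanish.\<close>
  have "bij_betw (\<lambda>(m, n). (Suc m * n, n)) (UNIV \<times> {0<..}) ?A"
    by (rule bij_betwI[of _ _ _ "\<lambda>(k, d). (k div d - 1, d)"])
       (auto elim!: dvdE simp del: mult_Suc)
  from has_sum_reindex_bij_betw[OF this, of f S] S
  have "((\<lambda>x. f (case x of (m, n) \<Rightarrow> (Suc m * n, n))) has_sum S) (UNIV \<times> {0<..})" by simp
  hence "((\<lambda>(m, n). of_nat n * (q ^ Suc m) ^ n) has_sum S) (UNIV \<times> {0<..})"
    by (simp add: f_def case_prod_unfold power_mult flip: power_mult power_Suc mult_Suc)
  hence "((\<lambda>m. \<Sum>n. of_nat n * (q ^ Suc m) ^ n) has_sum S) UNIV"
  proof (rule has_sum_SigmaD)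
    fix m :: nat
    have l: "norm (q ^ Suc m) < 1" using q by (simp add: norm_power power_less_one_iff del: power_Suc)
    have "summable (\<lambda>n. norm (of_nat (Suc n) * (q ^ Suc m) ^ n))"
      using geometric_deriv_sums[of "norm (q ^ Suc m)"] l
      by (auto simp: sums_iff norm_mult norm_power simp del: of_nat_Suc power_Suc)
    hence ns: "summable (\<lambda>n. norm (of_nat n * (q ^ Suc m) ^ n))"
      by (rule summable_comparison_test'[of _ 0]) (simp add: norm_mult mult_right_mono del: of_nat_Suc power_Suc)
    have "((\<lambda>n. of_nat n * (q ^ Suc m) ^ n) has_sum (\<Sum>n. of_nat n * (q ^ Suc m) ^ n)) UNIV"
      by (rule norm_summable_imp_has_sum[OF ns summable_sums[OF summable_norm_cancel[OF ns]]])
    hence "((\<lambda>n. of_nat n * (q ^ Suc m) ^ n) has_sum (\<Sum>n. of_nat n * (q ^ Suc m) ^ n)) {0<..}"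
      by (rule has_sum_cong_neutral[THEN iffD1, rotated -1]) auto
    thus "((\<lambda>y. case (m, y) of (m, n) \<Rightarrow> of_nat n * (q ^ Suc m) ^ n) has_sum (\<Sum>n. of_nat n * (q ^ Suc m) ^ n)) {0<..}"
      by simp
  qed
  thus ?thesis unfolding S1 by (rule has_sum_imp_sums)
qed


text \<open>\<open>\<eta>(t)\<^sup>2\<close>\<close>
definition eta2 :: "complex \<Rightarrow> complex" where
  "eta2 t = exp (of_real pi * \<i> * t / 6 + 2 * log_E (exp (2 * of_real pi * \<i> * t)))"

lemma norm_nome:
  assumes "Im t > 0"
  shows "norm (exp (2 * of_real pi * \<i> * t)) < 1"
  using assms by (simp add: norm_exp_eq_Re)

lemma eta2_nonzero [simp]: "eta2 t \<noteq> 0"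
  by (simp add: eta2_def)

text \<open>The logarithmic derivative of eta^2 is (pi i / 6) E_2, written so that the bracket is
  pi^2 / 6 plus the lattice sum of \<open>eisenstein2_inversion\<close>.\<close>

lemma eta2_log_deriv:
  assumes t: "Im t > 0"
  shows "(eta2 has_field_derivative eta2 t * (\<i> / of_real pi *
     ((of_real pi)\<^sup>2 / 6 + (- 4 * (of_real pi)\<^sup>2 * divsum_series (exp (2 * of_real pi * \<i> * t)))))) (at t)"
proof -
  define q where "q = exp (2 * of_real pi * \<i> * t)"
  obtain D where D: "(log_E has_field_derivative D) (at q)" and qD: "q * D = - divsum_series q"
    using log_E_has_field_derivative(1)[of q] norm_nome[OF t] unfolding q_def by blast
  have e: "((\<lambda>t. exp (2 * of_real pi * \<i> * t)) has_field_derivative (2 * of_real pi * \<i> * q)) (at t)"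
    by (auto intro!: derivative_eq_intros simp: q_def)
  have "((\<lambda>t. log_E (exp (2 * of_real pi * \<i> * t))) has_field_derivative D * (2 * of_real pi * \<i> * q)) (at t)"
    by (rule DERIV_chain2[of log_E D "\<lambda>t. exp (2 * of_real pi * \<i> * t)", OF _ e]) (use D in \<open>simp add: q_def\<close>)
  hence "(eta2 has_field_derivative (eta2 t * (of_real pi * \<i> / 6 + 2 * (D * (2 * of_real pi * \<i> * q))))) (at t)"
    unfolding eta2_def[abs_def] by (auto intro!: derivative_eq_intros simp: algebra_simps)
  moreover have "of_real pi * \<i> / 6 + 2 * (D * (2 * of_real pi * \<i> * q)) =
      \<i> / of_real pi * ((of_real pi)\<^sup>2 / 6 + (- 4 * (of_real pi)\<^sup>2 * divsum_series q))"
  proof -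
    have "2 * (D * (2 * of_real pi * \<i> * q)) = 4 * of_real pi * \<i> * (q * D)" by simp
    also have "\<dots> = - 4 * of_real pi * \<i> * divsum_series q" unfolding qD by simp
    finally have e2: "2 * (D * (2 * of_real pi * \<i> * q)) = - 4 * of_real pi * \<i> * divsum_series q" .
    show ?thesis unfolding e2 by (simp add: field_simps power2_eq_square)
  qed
  ultimately show ?thesis by (simp add: q_def)
qed

text \<open>Lipschitz's formula expands each row of the lattice sum, and the rows together form the
  Lambert series of the divisor sums.\<close>

lemma sin_lattice_sums:
  assumes t: "Im t > 0"
  shows "(\<lambda>m. (of_real pi)\<^sup>2 / sin (of_real pi * (of_nat (Suc m) * t)) ^ 2) sums
     (- 4 * (of_real pi)\<^sup>2 * divsum_series (exp (2 * of_real pi * \<i> * t)))"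
proof -
  define q where "q = exp (2 * of_real pi * \<i> * t)"
  have q: "norm q < 1" using norm_nome[OF t] by (simp add: q_def)
  have "(of_real pi)\<^sup>2 / sin (of_real pi * (of_nat (Suc m) * t)) ^ 2 =
    - 4 * (of_real pi)\<^sup>2 * (\<Sum>n. of_nat n * (q ^ Suc m) ^ n)" for m
  proof -
    have e: "exp (2 * of_real pi * \<i> * (of_nat (Suc m) * t)) = q ^ Suc m"
      unfolding q_def exp_of_nat_mult[symmetric] by (simp add: algebra_simps)
    have "Im (of_nat (Suc m) * t) > 0" using t by simp
    have c: "inverse (- 4 * (of_real pi)\<^sup>2) * (- 4 * (of_real pi)\<^sup>2 * w) = w" for w :: complex by simp
    from sums_mult[OF pi_sin_square_sums[OF \<open>Im (of_nat (Suc m) * t) > 0\<close>, unfolded e], of "inverse (- 4 * (of_real pi)\<^sup>2)", unfolded c]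
    have "(\<lambda>n. of_nat n * (q ^ Suc m) ^ n) sums (inverse (- 4 * (of_real pi)\<^sup>2) * ((of_real pi)\<^sup>2 / sin (of_real pi * (of_nat (Suc m) * t)) ^ 2))" .
    hence "(\<Sum>n. of_nat n * (q ^ Suc m) ^ n) = inverse (- 4 * (of_real pi)\<^sup>2) * ((of_real pi)\<^sup>2 / sin (of_real pi * (of_nat (Suc m) * t)) ^ 2)"
      by (rule sums_unique[symmetric])
    thus ?thesis by (simp del: of_nat_Suc power_Suc)
  qed
  with sums_mult[OF divsum_series_lambert[OF q], of "- 4 * (of_real pi)\<^sup>2"] show ?thesis
    by (simp add: q_def del: of_nat_Suc power_Suc)
qed

lemma Im_minus_inverse:
  assumes "Im t > 0"
  shows "Im (- 1 / t) > 0"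
proof -
  have "t \<noteq> 0" using assms by auto
  have "Im (- 1 / t) = Im t / (norm t)\<^sup>2" by (simp add: Im_divide cmod_power2)
  thus ?thesis using assms \<open>t \<noteq> 0\<close> by simp
qed

text \<open>By the quasimodularity of E_2 both sides have the same logarithmic derivative, the
  anomaly matching the 1/t contributed by the factor t. The constant is found at the fixed point i
  of the inversion.\<close>

lemma eta2_inversion:
  assumes t: "Im t > 0"
  shows "eta2 (- 1 / t) = - \<i> * t * eta2 t"
proof -
  let ?U = "{t. Im t > 0}"
  define F where "F = (\<lambda>t. eta2 (- 1 / t) / (t * eta2 t))"
  have "\<exists>c. \<forall>t\<in>?U. F t = c"
  proof (rule has_field_derivative_zero_constant)
    show "convex ?U" by (rule convex_halfspace_Im_gt)
    fix t assume "t \<in> ?U"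
    hence t: "Im t > 0" and t0: "t \<noteq> 0" by auto
    define S where "S = (\<lambda>t. - 4 * (of_real pi)\<^sup>2 * divsum_series (exp (2 * of_real pi * \<i> * t)))"
    define l where "l = (\<lambda>t. \<i> / of_real pi * ((of_real pi)\<^sup>2 / 6 + S t))"
    have d: "(eta2 has_field_derivative eta2 t * l t) (at t)" if "Im t > 0" for t
      using eta2_log_deriv[OF that] by (simp add: l_def S_def)
    have m: "S (- 1 / t) / t\<^sup>2 + (of_real pi)\<^sup>2 / 6 / t ^ 2 = S t + (of_real pi)\<^sup>2 / 6 - of_real pi * \<i> / t"
      unfolding S_def using eisenstein2_inversion[OF t sin_lattice_sums[OF t] sin_lattice_sums[OF Im_minus_inverse[OF t]]] by simp
    have i: "((\<lambda>t. - 1 / t) has_field_derivative 1 / t\<^sup>2) (at t)"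
      using t0 by (auto intro!: derivative_eq_intros simp: power2_eq_square)
    have "l (- 1 / t) / t\<^sup>2 = \<i> / of_real pi * (S (- 1 / t) / t\<^sup>2 + (of_real pi)\<^sup>2 / 6 / t ^ 2)"
      using t0 by (simp add: l_def field_simps)
    also have "\<dots> = l t + 1 / t" unfolding m l_def using t0 by (simp add: field_simps)
    finally have l: "l (- 1 / t) / t\<^sup>2 = l t + 1 / t" .
    have "((\<lambda>t. eta2 (- 1 / t)) has_field_derivative eta2 (- 1 / t) * l (- 1 / t) * (1 / t\<^sup>2)) (at t)"
      by (rule DERIV_chain2[of eta2 _ "\<lambda>t. - 1 / t", OF d[OF Im_minus_inverse[OF t]] i])
    hence d1: "((\<lambda>t. eta2 (- 1 / t)) has_field_derivative eta2 (- 1 / t) * (l t + 1 / t)) (at t)"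
      unfolding l[symmetric] by (simp add: mult.assoc)
    have d2: "((\<lambda>t. t * eta2 t) has_field_derivative (eta2 t + t * (eta2 t * l t))) (at t)"
      using DERIV_mult[OF DERIV_ident d[OF t]] by (simp add: algebra_simps)
    have "(F has_field_derivative (eta2 (- 1 / t) * (l t + 1 / t) * (t * eta2 t) - eta2 (- 1 / t) * (eta2 t + t * (eta2 t * l t))) / ((t * eta2 t) * (t * eta2 t))) (at t)"
      unfolding F_def by (rule DERIV_divide[OF d1 d2]) (use t0 in simp)
    moreover have "eta2 (- 1 / t) * (l t + 1 / t) * (t * eta2 t) - eta2 (- 1 / t) * (eta2 t + t * (eta2 t * l t)) = 0"
      using t0 by (simp add: field_simps)
    ultimately have "(F has_field_derivative 0) (at t)" by (metis div_0)
    thus "(F has_field_derivative 0) (at t within ?U)" by (rule has_field_derivative_at_within)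
  qed
  then obtain c where c: "\<And>t. Im t > 0 \<Longrightarrow> F t = c" by auto
  have "c = F \<i>" using c[of \<i>] by simp
  also have "- 1 / \<i> = \<i>" by (simp add: divide_i)
  hence "F \<i> = - \<i>" unfolding F_def by (simp add: field_simps)
  finally have "F t = - \<i>" using c[OF t] by simp
  moreover have "t * eta2 t \<noteq> 0" using t by auto
  ultimately show ?thesis unfolding F_def by (metis divide_eq_eq mult.assoc)
qed

section \<open>Hecke operators and the action of the modular group\<close>

text \<open>The weight 3 action of t -> -1/t. The weight is odd, so applying it twice gives
  -f.\<close>

definition inv3 :: "(complex \<Rightarrow> complex) \<Rightarrow> complex \<Rightarrow> complex" where
  "inv3 f t = f (- 1 / t) / t ^ 3"

text \<open>The nontrivial character mod 4. It is evaluated below at the lower right entry of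
  matrices of determinant 1 with even off-diagonal entries, hence at odd integers.\<close>

definition chi4 :: "int \<Rightarrow> complex" where
  "chi4 d = (if d mod 4 = 1 then 1 else - 1)"

lemma inv3_inv3:
  assumes "Im t > 0"
  shows "inv3 (inv3 f) t = - f t"
proof -
  have "t \<noteq> 0" using assms by auto
  thus ?thesis by (simp add: inv3_def field_simps)
qed

lemma eq_inv3:
  assumes "Im t > 0"
  shows "f (- 1 / t) = t ^ 3 * inv3 f t"
proof -
  have "t \<noteq> 0" using assms by auto
  thus ?thesis by (simp add: inv3_def)
qed

lemma power_int_cong_4:
  fixes a :: complex
  assumes "a ^ 4 = 1" "4 dvd m - n"
  shows "a powi m = a powi n"
proof -
  have a0: "a \<noteq> 0" using assms(1) by auto
  obtain k where "m - n = 4 * k" using assms(2) by auto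
  hence "m = n + 4 * k" by simp
  hence "a powi m = a powi n * (a powi 4) powi k" using a0 by (simp add: power_int_add power_int_mult)
  also have "a powi 4 = a ^ 4" by simp
  finally show ?thesis using assms(1) by simp
qed

lemma shift_2_int:
  fixes f :: "complex \<Rightarrow> complex" and k :: int
  assumes T: "\<And>t. Im t > 0 \<Longrightarrow> f (t + 2) = a * f t" and a0: "a \<noteq> 0" and t: "Im t > 0"
  shows "f (t + 2 * of_int k) = a powi k * f t"
proof (induction k rule: int_induct[where k = 0])
  case (step1 i)
  have "f (t + 2 * of_int (i + 1)) = f ((t + 2 * of_int i) + 2)" by (simp add: algebra_simps)
  also have "\<dots> = a * f (t + 2 * of_int i)" by (rule T) (use t in simp)
  finally show ?case using step1 a0 by (simp add: power_int_add)
next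
  case (step2 i)
  have "f (t + 2 * of_int i) = f ((t + 2 * of_int (i - 1)) + 2)" by (simp add: algebra_simps)
  also have "\<dots> = a * f (t + 2 * of_int (i - 1))" by (rule T) (use t in simp)
  finally show ?case using step2 a0 by (simp add: power_int_diff field_simps)
qed simp

lemma moebius_denominator_nonzero:
  fixes c d :: int
  assumes "Im t > 0" "c \<noteq> 0 \<or> d \<noteq> 0"
  shows "of_int c * t + of_int d \<noteq> (0 :: complex)"
proof
  assume e: "of_int c * t + of_int d = (0 :: complex)"
  hence "Im (of_int c * t + of_int d) = 0" by simp
  hence "c = 0" using assms by auto
  thus False using e assms by simp
qed

lemma Im_lower_unipotent:
  assumes "Im t > 0"
  shows "Im (t / (1 - 2 * of_int s * t)) > 0" "1 - 2 * of_int s * t \<noteq> 0"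
proof -
  have nz: "of_int (- 2 * s) * t + of_int 1 \<noteq> 0" by (rule moebius_denominator_nonzero[OF assms]) simp
  thus nz': "1 - 2 * of_int s * t \<noteq> 0" by simp
  have t0: "t \<noteq> 0" using assms by auto
  have "Im (- 1 / (- 1 / t + 2 * of_int s)) > 0"
    using assms by (intro Im_minus_inverse) (use Im_minus_inverse[OF assms] in simp)
  moreover have "- 1 / (- 1 / t + 2 * of_int s) = t / (1 - 2 * of_int s * t)"
  proof -
    have "- 1 / t + 2 * of_int s = - ((1 - 2 * of_int s * t) / t)" using t0 by (simp add: field_simps)
    thus ?thesis using t0 nz' by (simp add: field_simps)
  qed
  ultimately show "Im (t / (1 - 2 * of_int s * t)) > 0" by (simp only:)
qed

text \<open>With y = -1/t + 2s the new point is -1/y, so the map is a shift by 2s conjugated by the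
  inversion. The multiplier of \<open>inv3 f\<close> enters to the power s, and the two weight
  factors combine into the automorphy factor.\<close>

lemma lower_unipotent_action:
  fixes f :: "complex \<Rightarrow> complex"
  assumes S: "\<And>t. Im t > 0 \<Longrightarrow> inv3 f (t + 2) = b * inv3 f t" and b0: "b \<noteq> 0" and t: "Im t > 0"
  shows "f (t / (1 - 2 * of_int s * t)) = b powi s * (1 - 2 * of_int s * t) ^ 3 * f t"
proof -
  have t0: "t \<noteq> 0" using t by auto
  note nz = Im_lower_unipotent[OF t, of s]
  define y where "y = - 1 / t + 2 * of_int s"
  have y: "y = - ((1 - 2 * of_int s * t) / t)" using t0 by (simp add: y_def field_simps)
  have iy: "Im y > 0" using Im_minus_inverse[OF t] by (simp add: y_def)
  have "f (t / (1 - 2 * of_int s * t)) = f (- 1 / y)" using t0 nz by (simp add: y field_simps)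
  also have "\<dots> = y ^ 3 * inv3 f y" by (rule eq_inv3[OF iy])
  also have "inv3 f y = b powi s * inv3 f (- 1 / t)"
    unfolding y_def by (rule shift_2_int[of "inv3 f"]) (use S b0 Im_minus_inverse[OF t] in auto)
  also have "inv3 f (- 1 / t) = - (t ^ 3) * f t" using t0 by (simp add: inv3_def field_simps)
  also have "y ^ 3 * (b powi s * (- (t ^ 3) * f t)) = b powi s * (- (y * t)) ^ 3 * f t"
    by (simp add: power_mult_distrib)
  also have "- (y * t) = 1 - 2 * of_int s * t" using t0 by (simp add: y)
  finally show ?thesis .
qed

text \<open>The group \<open>\<Gamma>(2)\<close> is generated by \<open>-1\<close> and the two unipotents, so the two
  multipliers determine the character; the formula is found by checking it on the generators.\<close>

lemma gamma2_character:
  fixes f :: "complex \<Rightarrow> complex" and a b c d :: int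
  assumes T: "\<And>t. Im t > 0 \<Longrightarrow> f (t + 2) = \<alpha> * f t" and \<alpha>: "\<alpha> ^ 4 = 1"
    and S: "\<And>t. Im t > 0 \<Longrightarrow> inv3 f (t + 2) = \<beta> * inv3 f t" and \<beta>: "\<beta> ^ 4 = 1"
    and "a * d - b * c = 1" "even b" "even c" "Im t > 0"
  shows "f ((of_int a * t + of_int b) / (of_int c * t + of_int d)) =
     chi4 d * \<alpha> powi (b * d div 2) * \<beta> powi (- (c * d div 2)) * (of_int c * t + of_int d) ^ 3 * f t"
  using assms(5-)
\<comment> \<open>Euclidean algorithm on the lower row (c, d). As c is even and d odd, |c| and |d|
  differ, and changing the larger entry by twice the smaller, with the right sign s, shortens the
  row while preserving the parities.\<close>
proof (induction "nat \<bar>c\<bar> + nat \<bar>d\<bar>" arbitrary: a b c d t rule: less_induct)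
  case less
  have a0: "\<alpha> \<noteq> 0" and b0: "\<beta> \<noteq> 0" using \<alpha> \<beta> by auto
  have half: "x div 2 = y" if "x = 2 * y" for x y :: int using that by simp
  have oa: "odd a" and od: "odd d"
  proof -
    have "odd (a * d - b * c)" unfolding less.prems(1) by simp
    hence "odd (a * d)" using less.prems(2) by simp
    thus "odd a" "odd d" by simp_all
  qed
  have "c = 0 \<or> \<bar>c\<bar> < \<bar>d\<bar> \<and> c \<noteq> 0 \<or> \<bar>d\<bar> < \<bar>c\<bar>"
  proof -
    have "\<bar>c\<bar> \<noteq> \<bar>d\<bar>"
    proof
      assume "\<bar>c\<bar> = \<bar>d\<bar>"
      hence "c = d \<or> c = - d" by linarith
      thus False using od less.prems(3) by auto
    qed
    thus ?thesis by linarith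
  qed
  then consider "c = 0" | "\<bar>c\<bar> < \<bar>d\<bar>" "c \<noteq> 0" | "\<bar>d\<bar> < \<bar>c\<bar>" by blast
  thus ?case
  proof cases
    case 1
    hence "a * d = 1" using less.prems by simp
    hence ad: "a = 1 \<and> d = 1 \<or> a = - 1 \<and> d = - 1" by (metis zmult_eq_1_iff)
    obtain k where k: "b = 2 * k" using less.prems by auto
    show ?thesis using ad
    proof
      assume "a = 1 \<and> d = 1"
      thus ?thesis using 1 k shift_2_int[of f \<alpha> t k, OF T a0 less.prems(4)] by (simp add: chi4_def)
    next
      assume "a = - 1 \<and> d = - 1"
      moreover have "- (2 * k) div 2 = - k" by presburger
      ultimately show ?thesis using 1 k shift_2_int[of f \<alpha> t "- k", OF T a0 less.prems(4)] by (simp add: chi4_def)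
    qed
  next
    case 2
    define s :: int where "s = (if (c > 0) = (d > 0) then 1 else - 1)"
    define b' d' where "b' = b - 2 * s * a" and "d' = d - 2 * s * c"
    have s2: "s * s = 1" by (simp add: s_def)
    have "\<bar>d'\<bar> < \<bar>d\<bar>" using 2 by (auto simp: d'_def s_def abs_if split: if_splits)
    hence "nat \<bar>c\<bar> + nat \<bar>d'\<bar> < nat \<bar>c\<bar> + nat \<bar>d\<bar>" by simp
    moreover have "a * d' - b' * c = 1" using less.prems(1) by (simp add: b'_def d'_def algebra_simps)
    moreover have "even b'" using less.prems by (simp add: b'_def)
    moreover have "Im (t + 2 * of_int s) > 0" using less.prems by simp
    ultimately have IH: "f ((of_int a * (t + 2 * of_int s) + of_int b') / (of_int c * (t + 2 * of_int s) + of_int d')) =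
     chi4 d' * \<alpha> powi (b' * d' div 2) * \<beta> powi (- (c * d' div 2)) * (of_int c * (t + 2 * of_int s) + of_int d') ^ 3 * f (t + 2 * of_int s)"
      using less.hyps[of c d' a b' "t + 2 * of_int s"] less.prems by blast
    have e: "of_int a * (t + 2 * of_int s) + of_int b' = of_int a * t + of_int b"
      "of_int c * (t + 2 * of_int s) + of_int d' = of_int c * t + of_int d"
      by (simp_all add: b'_def d'_def algebra_simps)
    have f: "f (t + 2 * of_int s) = \<alpha> powi s * f t" by (rule shift_2_int[of f, OF T a0 less.prems(4)])
    obtain b2 c2 where b2: "b = 2 * b2" and c2: "c = 2 * c2" using less.prems by (auto elim!: evenE)
    have det: "a * d = 1 + 4 * b2 * c2" using less.prems(1) by (simp add: b2 c2)
    have chi: "chi4 d' = chi4 d"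
    proof -
      have "d' = d + 4 * (- (s * c2))" unfolding d'_def c2 by simp
      hence "d' mod 4 = d mod 4" by (simp only: mod_mult_self2)
      thus ?thesis by (simp add: chi4_def)
    qed
    have h1: "b' * d' div 2 = (b2 - s * a) * d'" "b * d div 2 = b2 * d" "c * d' div 2 = c2 * d'" "c * d div 2 = c2 * d"
      by (rule half, simp add: b'_def b2 c2 algebra_simps)+
    \<comment> \<open>The exponents of \<alpha> on both sides have to agree mod 4; the determinant
      relation a d = 1 + 4 b2 c2 and s^2 = 1 make their difference a multiple of 4.\<close>
    have "(b2 - s * a) * d' + s - b2 * d = - s * (a * d) + s + 4 * (s * s) * a * c2 - 4 * s * b2 * c2"
      by (simp add: d'_def c2 algebra_simps)
    also have "\<dots> = 4 * (a * c2 - 2 * s * b2 * c2)" unfolding det s2 by (simp add: algebra_simps)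
    finally have h2: "4 dvd (b2 - s * a) * d' + s - b2 * d" by simp
    have h3: "4 dvd - (c2 * d') - - (c2 * d)" by (simp add: d'_def c2 algebra_simps)
    have "\<alpha> powi (b' * d' div 2) * \<alpha> powi s = \<alpha> powi (b * d div 2)"
      unfolding h1 using power_int_cong_4[OF \<alpha> h2] a0 by (simp add: power_int_add)
    moreover have "\<beta> powi (- (c * d' div 2)) = \<beta> powi (- (c * d div 2))"
      unfolding h1 by (rule power_int_cong_4[OF \<beta> h3])
    ultimately show ?thesis using IH unfolding e f chi by (simp add: mult_ac)
  next
    case 3
    define s :: int where "s = (if (c > 0) = (d > 0) then - 1 else 1)"
    define a' c' where "a' = a + 2 * s * b" and "c' = c + 2 * s * d"
    define w where "w = t / (1 - 2 * of_int s * t)"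
    note nz = Im_lower_unipotent[OF less.prems(4), of s]
    have d0: "d \<noteq> 0" using od by auto
    have "c' = c - 2 * d \<and> (c > 0 \<longleftrightarrow> d > 0) \<or> c' = c + 2 * d \<and> (c > 0 \<longleftrightarrow> \<not> d > 0)"
      by (simp add: c'_def s_def)
    hence "\<bar>c'\<bar> < \<bar>c\<bar>" using 3 d0 by linarith
    hence "nat \<bar>c'\<bar> + nat \<bar>d\<bar> < nat \<bar>c\<bar> + nat \<bar>d\<bar>" by simp
    moreover have "a' * d - b * c' = 1" using less.prems(1) by (simp add: a'_def c'_def algebra_simps)
    moreover have "even c'" using less.prems by (simp add: c'_def)
    moreover have "Im w > 0" using nz by (simp add: w_def)
    ultimately have IH: "f ((of_int a' * w + of_int b) / (of_int c' * w + of_int d)) =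
     chi4 d * \<alpha> powi (b * d div 2) * \<beta> powi (- (c' * d div 2)) * (of_int c' * w + of_int d) ^ 3 * f w"
      using less.hyps[of c' d a' b w] less.prems by blast
    have e: "of_int a' * w + of_int b = (of_int a * t + of_int b) / (1 - 2 * of_int s * t)"
      "of_int c' * w + of_int d = (of_int c * t + of_int d) / (1 - 2 * of_int s * t)"
      using nz by (simp_all add: a'_def c'_def w_def field_simps)
    have f: "f w = \<beta> powi s * (1 - 2 * of_int s * t) ^ 3 * f t"
      unfolding w_def by (rule lower_unipotent_action[of f, OF S b0 less.prems(4)])
    obtain c2 where c2: "c = 2 * c2" using less.prems by (auto elim!: evenE)
    have h1: "c' * d div 2 = (c2 + s * d) * d" "c * d div 2 = c2 * d"
      by (rule half, simp add: c'_def c2 algebra_simps)+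
    obtain k where k: "d = 2 * k + 1" using od by (auto elim!: oddE)
    have "- ((c2 + s * d) * d) + s - - (c2 * d) = 4 * (- s * k * k - s * k)"
      by (simp add: k algebra_simps)
    hence h2: "4 dvd - ((c2 + s * d) * d) + s - - (c2 * d)" by simp
    have h: "\<beta> powi (- (c' * d div 2)) * \<beta> powi s = \<beta> powi (- (c * d div 2))"
      unfolding h1 power_int_add[OF disjI1[OF b0], symmetric] by (rule power_int_cong_4[OF \<beta> h2])
    have "f ((of_int a * t + of_int b) / (of_int c * t + of_int d)) =
      chi4 d * \<alpha> powi (b * d div 2) * (\<beta> powi (- (c' * d div 2)) * \<beta> powi s) * (of_int c * t + of_int d) ^ 3 * f t"
    proof -
      have "(x / (1 - 2 * of_int s * t)) / (y / (1 - 2 * of_int s * t)) = x / y" for x y using nz(2) by simp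
      moreover have "(x / (1 - 2 * of_int s * t)) ^ 3 * (u * (1 - 2 * of_int s * t) ^ 3 * v) = u * x ^ 3 * v" for x u v
        using nz(2) by (simp add: power_divide)
      ultimately show ?thesis using IH unfolding e f by (simp only: mult.assoc)
    qed
    thus ?thesis unfolding h .
  qed
qed

text \<open>The operator \<open>T(p)\<close> of weight 3 with nebentypus value \<open>\<chi>(p) = -1\<close>; a shift of \<open>t\<close> by 8 is a shift of
  \<open>z\<close> by 1.\<close>
definition hecke :: "nat \<Rightarrow> (complex \<Rightarrow> complex) \<Rightarrow> complex \<Rightarrow> complex" where
  "hecke p f t = (\<Sum>j<p. f ((t + 8 * of_nat j) / of_nat p)) / of_nat p - of_nat p ^ 2 * f (of_nat p * t)"

text \<open>The inversion permutes the p + 1 terms of T(p). It exchanges p t with t / p, and it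
  sends the term of j > 0 to that of k with 64 j k = -1 mod p, through the matrix with rows (p, -8k)
  and (-8j, e), where p e = 64 j k + 1. The off-diagonal entries are multiples of 8, so the
  multipliers in \<open>gamma2_character\<close> are trivial, and e = 3 mod 4 makes the character
  -1.\<close>

lemma hecke_inv3:
  fixes f :: "complex \<Rightarrow> complex"
  assumes T: "\<And>t. Im t > 0 \<Longrightarrow> f (t + 2) = \<alpha> * f t" and \<alpha>: "\<alpha> ^ 4 = 1"
    and S: "\<And>t. Im t > 0 \<Longrightarrow> inv3 f (t + 2) = \<beta> * inv3 f t" and \<beta>: "\<beta> ^ 4 = 1"
    and p: "prime p" "p mod 4 = 3" and t: "Im t > 0"
  shows "inv3 (hecke p f) t = - hecke p (inv3 f) t"
proof -
  have p0: "p > 0" using p prime_gt_0_nat by simp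
  have t0: "t \<noteq> 0" using t by auto
  have T': "inv3 (inv3 f) (t + 2) = \<alpha> * inv3 (inv3 f) t" if "Im t > 0" for t
    using that T by (simp add: inv3_inv3)
  define g where "g = inv3 f"
  have ex: "\<exists>!k. k \<in> {1..<p} \<and> [64 * j * k + 1 = 0] (mod p)" if "j \<in> {1..<p}" for j
  proof -
    have "coprime (64 * j) p"
    proof -
      have "\<not> p dvd 2 ^ 6 * j"
      proof
        assume "p dvd 2 ^ 6 * j"
        hence "p dvd 2 \<or> p dvd j" using p(1) prime_dvd_multD prime_dvd_power by blast
        hence "p dvd 2" using that by (auto dest: dvd_imp_le)
        hence "p \<le> 2" by (auto dest: dvd_imp_le)
        thus False using p(2) by (cases "p = 0 \<or> p = 1 \<or> p = 2") auto
      qed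
      hence "coprime p (64 * j)" using p(1) by (intro prime_imp_coprime) auto
      thus ?thesis by (simp only: coprime_commute)
    qed
    then obtain x where x: "[64 * j * x = 1] (mod p)" using cong_solve_coprime_nat by (metis One_nat_def)
    \<comment> \<open>x inverts 64 j modulo p, and p - 1 stands for -1, which keeps the argument
      within the natural numbers.\<close>
    define k where "k = (p - 1) * x mod p"
    have 1: "[64 * j * k + 1 = 0] (mod p)"
    proof -
      have "[64 * j * k + 1 = 64 * j * ((p - 1) * x) + 1] (mod p)"
        unfolding k_def by (intro cong_add cong_mult cong_refl) (simp add: cong_def)
      also have "64 * j * ((p - 1) * x) + 1 = (p - 1) * (64 * j * x) + 1" by (simp add: mult_ac)
      also have "[(p - 1) * (64 * j * x) + 1 = (p - 1) * 1 + 1] (mod p)"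
        by (intro cong_add cong_mult cong_refl x)
      also have "(p - 1) * 1 + 1 = p" using p0 by simp
      finally show ?thesis by (simp add: cong_def)
    qed
    have k0: "k \<noteq> 0"
    proof
      assume "k = 0"
      hence "[1 = 0] (mod p)" using 1 by simp
      thus False using p(1) by (simp add: cong_0_iff)
    qed
    show ?thesis
    proof (rule ex1I[of _ k])
      show "k \<in> {1..<p} \<and> [64 * j * k + 1 = 0] (mod p)" using 1 k0 p0 by (auto simp: k_def)
      fix l assume l: "l \<in> {1..<p} \<and> [64 * j * l + 1 = 0] (mod p)"
      hence "[64 * j * l + 1 = 64 * j * k + 1] (mod p)" using 1 by (meson cong_sym cong_trans)
      hence "[64 * j * l = 64 * j * k] (mod p)" by (simp only: cong_add_rcancel_nat)
      hence "[l = k] (mod p)" by (rule cong_mult_lcancel_nat[OF \<open>coprime (64 * j) p\<close>, THEN iffD1])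
      moreover have "k < p" "l < p" using l p0 by (auto simp: k_def)
      ultimately show "l = k" by (simp add: cong_def)
    qed
  qed
  define \<phi> where "\<phi> j = (THE k. k \<in> {1..<p} \<and> [64 * j * k + 1 = 0] (mod p))" for j
  have \<phi>': "\<phi> j \<in> {1..<p} \<and> [64 * j * \<phi> j + 1 = 0] (mod p)" if "j \<in> {1..<p}" for j
    unfolding \<phi>_def by (rule theI'[OF ex[OF that]])
  note \<phi> = \<phi>'[THEN conjunct1] \<phi>'[THEN conjunct2]
  have \<phi>\<phi>: "\<phi> (\<phi> j) = j" if "j \<in> {1..<p}" for j
  proof -
    have "[64 * \<phi> j * j + 1 = 0] (mod p)" using \<phi>(2)[OF that] by (simp add: mult_ac)
    thus ?thesis unfolding \<phi>_def[of "\<phi> j"]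
      by (intro the1_equality[OF ex[OF \<phi>(1)[OF that]]] conjI) (use that in auto)
  qed
  have trm: "f ((- 1 / t + 8 * of_nat j) / of_nat p) = - (t ^ 3) * g ((t + 8 * of_nat (\<phi> j)) / of_nat p)"
    if j: "j \<in> {1..<p}" for j
  proof -
    define k where "k = \<phi> j"
    define w where "w = (t + 8 * of_nat k) / of_nat p"
    have w: "of_nat p * w = t + 8 * of_nat k" using p0 by (simp add: w_def)
    have iw: "Im w > 0" using t p0 by (simp add: w_def)
    obtain e :: nat where e: "64 * j * k + 1 = p * e" using \<phi>(2)[OF j] by (auto simp: cong_0_iff k_def elim!: dvdE)
    have ie: "64 * int j * int k + 1 = int p * int e" using arg_cong[OF e, of int] by simp
    have ce: "64 * of_nat j * of_nat k + 1 = (of_nat p * of_nat e :: complex)"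
      using arg_cong[OF e, of "of_nat :: nat \<Rightarrow> complex"] by (simp add: add.commute)
    have "int e mod 4 = 3"
    proof -
      have "(64 * x + 1) mod 4 = 1" for x :: nat by presburger
      from this[of "j * k"] have "(p * e) mod 4 = 1" unfolding e[symmetric] by (simp add: mult.assoc)
      hence "((p mod 4) * (e mod 4)) mod 4 = 1" by (simp add: mod_mult_eq)
      hence "(3 * (e mod 4)) mod 4 = 1" using p(2) by simp
      moreover have "e mod 4 = 0 \<or> e mod 4 = 1 \<or> e mod 4 = 2 \<or> e mod 4 = 3" by linarith
      ultimately have "e mod 4 = 3" by auto
      thus ?thesis using of_nat_mod[of e 4, where ?'a = int] by simp
    qed
    hence chi: "chi4 (int e) = - 1" by (simp add: chi4_def)
    have h8: "- 8 * x * y div 2 = 4 * (- x * y)" for x y :: int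
    proof -
      have "- 8 * x * y = (4 * (- x * y)) * 2" by simp
      thus ?thesis by (metis nonzero_mult_div_cancel_right zero_neq_numeral)
    qed
    define c where "c = of_int (- 8 * int j) * w + of_int (int e)"
    have c0: "c \<noteq> 0" unfolding c_def
      by (rule moebius_denominator_nonzero[OF iw]) (use j in auto)
    have "g ((of_int (int p) * w + of_int (- 8 * int k)) / (of_int (- 8 * int j) * w + of_int (int e))) =
       chi4 (int e) * \<beta> powi (- 8 * int k * int e div 2) * \<alpha> powi (- (- 8 * int j * int e div 2)) *
       (of_int (- 8 * int j) * w + of_int (int e)) ^ 3 * g w"
      unfolding g_def by (rule gamma2_character[OF S \<beta> T' \<alpha> _ _ _ iw]) (use ie in \<open>auto simp: algebra_simps\<close>)
    also have "\<beta> powi (- 8 * int k * int e div 2) = \<beta> powi 0"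
      by (rule power_int_cong_4[OF \<beta>]) (simp only: h8 diff_0_right dvd_triv_left dvd_minus_iff)
    also have "\<alpha> powi (- (- 8 * int j * int e div 2)) = \<alpha> powi 0"
      by (rule power_int_cong_4[OF \<alpha>]) (simp only: h8 diff_0_right dvd_triv_left dvd_minus_iff)
    also have "\<beta> powi 0 = 1" by simp
    also have "\<alpha> powi 0 = 1" by simp
    finally have G: "g (t / c) = - (c ^ 3) * g w"
      unfolding chi c_def[symmetric] using w by simp
    define y where "y = (- 1 / t + 8 * of_nat j) / of_nat p"
    have "Im y = Im (- 1 / t) / real p" by (simp add: y_def Im_divide_of_nat)
    hence iy: "Im y > 0" using divide_pos_pos[OF Im_minus_inverse[OF t], of "real p"] p0 by (simp only: of_nat_0_less_iff)
    have "- c * of_nat p = 8 * of_nat j * (of_nat p * w) - of_nat p * of_nat e" by (simp add: c_def algebra_simps)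
    also have "\<dots> = 8 * of_nat j * t - 1" unfolding w ce[symmetric] by (simp add: algebra_simps)
    finally have "- c * of_nat p = 8 * of_nat j * t - 1" .
    moreover have "y * t * of_nat p = 8 * of_nat j * t - 1" using t0 p0 by (simp add: y_def field_simps)
    ultimately have "y * t * of_nat p = - c * of_nat p" by simp
    hence "y * t = - c" using p0 by (simp only: mult_cancel_right of_nat_eq_0_iff) auto
    hence y: "y = - c / t" using t0 by (simp add: field_simps)
    have iy': "- 1 / y = t / c" "- 1 / (t / c) = y" using t0 c0 by (simp_all add: y)
    have "Im (t / c) > 0" using Im_minus_inverse[OF iy] unfolding iy' .
    have "f ((- 1 / t + 8 * of_nat j) / of_nat p) = (t / c) ^ 3 * g (t / c)"
      unfolding g_def using eq_inv3[OF \<open>Im (t / c) > 0\<close>, of f] unfolding iy' y_def .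
    also have "\<dots> = - (t ^ 3) * g w" unfolding G using c0 by (simp add: field_simps)
    finally show ?thesis by (simp add: w_def k_def)
  qed
  have split: "{..<p} = insert 0 {1..<p}" using p0 by auto
  have s1: "(\<Sum>j\<in>{1..<p}. f ((- 1 / t + 8 * of_nat j) / of_nat p)) = - (t ^ 3) * (\<Sum>j\<in>{1..<p}. g ((t + 8 * of_nat j) / of_nat p))"
  proof -
    have "(\<Sum>j\<in>{1..<p}. f ((- 1 / t + 8 * of_nat j) / of_nat p)) = (\<Sum>j\<in>{1..<p}. - (t ^ 3) * g ((t + 8 * of_nat j) / of_nat p))"
      by (rule sum.reindex_bij_witness[of _ \<phi> \<phi>]) (use \<phi> \<phi>\<phi> trm in auto)
    thus ?thesis by (simp add: sum_distrib_left)
  qed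
  have i1: "Im (of_nat p * t) > 0" "Im (t / of_nat p) > 0" using t p0 by auto
  have s2: "f (- 1 / t / of_nat p) = (of_nat p * t) ^ 3 * g (of_nat p * t)"
    using eq_inv3[OF i1(1), of f] by (simp add: g_def mult.commute)
  have s3: "f (of_nat p * (- 1 / t)) = (t / of_nat p) ^ 3 * g (t / of_nat p)"
    using eq_inv3[OF i1(2), of f] by (simp add: g_def)
  have "hecke p f (- 1 / t) = ((of_nat p * t) ^ 3 * g (of_nat p * t) - (t ^ 3) * (\<Sum>j\<in>{1..<p}. g ((t + 8 * of_nat j) / of_nat p))) / of_nat p
     - of_nat p ^ 2 * ((t / of_nat p) ^ 3 * g (t / of_nat p))"
    unfolding hecke_def split s3 using s1 s2 by simp
  also have "\<dots> = - (t ^ 3) * hecke p g t"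
    unfolding hecke_def split using p0 by (simp add: field_simps power3_eq_cube power2_eq_square)
  finally show ?thesis using t0 by (simp add: inv3_def g_def)
qed


lemma sum_periodic_shift:
  fixes h :: "int \<Rightarrow> 'a :: ab_group_add"
  assumes h: "\<And>j. h (j + int p) = h j"
  shows "(\<Sum>j<p. h (int j - int r)) = (\<Sum>j<p. h (int j))"
proof (induction r)
  case (Suc r)
  define k where "k = (\<lambda>j::nat. h (int j - int (Suc r)))"
  have "(\<Sum>j<p. k (Suc j)) - (\<Sum>j<p. k j) = k p - k 0"
    unfolding sum_subtractf[symmetric] by (rule sum_lessThan_telescope)
  also have "k p = k 0" using h[of "- int (Suc r)"] by (simp add: k_def algebra_simps)
  finally have "(\<Sum>j<p. k (Suc j)) = (\<Sum>j<p. k j)" by simp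
  moreover have "k (Suc j) = h (int j - int r)" for j by (simp add: k_def)
  ultimately show ?case using Suc by (simp add: k_def)
qed simp

text \<open>As p^2 = 1 + 8r, one has (t + 1 + 8j)/p = (t + 8(j - r))/p + p: the translation by 1
  becomes a translation by p and a cyclic shift of j. The translation by p consists of one by 1 and
  (p - 1)/2 by 2, whence the power of \<alpha>.\<close>

lemma hecke_shift:
  fixes f :: "complex \<Rightarrow> complex"
  assumes f8: "\<And>t. Im t > 0 \<Longrightarrow> f (t + 8) = f t"
    and g: "\<And>t. Im t > 0 \<Longrightarrow> f (t + 1 + 2) = \<alpha> * f (t + 1)" and \<alpha>: "\<alpha> \<noteq> 0"
    and p: "odd p" and t: "Im t > 0"
  shows "hecke p f (t + 1) = \<alpha> ^ ((p - 1) div 2) * hecke p (\<lambda>t. f (t + 1)) t"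
proof -
  define G where "G = (\<lambda>t. f (t + 1))"
  define n where "n = (p - 1) div 2"
  obtain k where k: "p = 2 * k + 1" using p by (auto elim: oddE)
  have n: "n = k" by (simp add: n_def k)
  have p0: "p > 0" by (simp add: k)
  have G2: "G (t + 2) = \<alpha> * G t" if "Im t > 0" for t using g[OF that] by (simp add: G_def algebra_simps)
  have G8: "G (t + 8) = G t" if "Im t > 0" for t using f8[of "t + 1"] that by (simp add: G_def algebra_simps)
  have key: "f (w + of_nat p) = \<alpha> ^ n * G w" if w: "Im w > 0" for w
  proof -
    have "f (w + of_nat p) = G (w + 2 * of_int (int k))" by (simp add: G_def k algebra_simps)
    also have "\<dots> = \<alpha> powi int k * G w" by (rule shift_2_int[of G, OF G2 \<alpha> w])
    finally show ?thesis by (simp add: n)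
  qed
  obtain r where r: "p * p = 1 + 8 * r"
  proof -
    have "even (k * (k + 1))" by simp
    then obtain s where s: "k * (k + 1) = 2 * s" by (elim evenE)
    have "p * p = 4 * (k * (k + 1)) + 1" by (simp add: k algebra_simps)
    thus ?thesis using that[of s] unfolding s by simp
  qed
  have cr: "of_nat p * of_nat p = 1 + 8 * (of_nat r :: complex)"
    using arg_cong[OF r, of "of_nat :: nat \<Rightarrow> complex"] by simp
  define h where "h = (\<lambda>j::int. G ((t + 8 * of_int j) / of_nat p))"
  have per: "h (j + int p) = h j" for j
  proof -
    have "(t + 8 * of_int (j + int p)) / of_nat p = (t + 8 * of_int j) / of_nat p + 8"
      using p0 by (simp add: field_simps)
    moreover have "Im ((t + 8 * of_int j) / of_nat p) > 0" using t p0 by simp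
    ultimately show ?thesis by (simp add: h_def G8)
  qed
  have "f ((t + 1 + 8 * of_nat j) / of_nat p) = \<alpha> ^ n * h (int j - int r)" for j
  proof -
    have "(t + 8 * of_int (int j - int r)) / of_nat p + of_nat p = (t + 8 * (of_nat j - of_nat r) + of_nat p * of_nat p) / of_nat p"
      using p0 by (simp add: add_divide_distrib)
    also have "\<dots> = (t + 1 + 8 * of_nat j) / of_nat p" unfolding cr by (simp add: algebra_simps)
    finally have "(t + 8 * of_int (int j - int r)) / of_nat p + of_nat p = (t + 1 + 8 * of_nat j) / of_nat p" .
    moreover have "Im ((t + 8 * of_int (int j - int r)) / of_nat p) > 0" using t p0 by simp
    ultimately show ?thesis using key[of "(t + 8 * of_int (int j - int r)) / of_nat p"] by (simp add: h_def)
  qed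
  hence "(\<Sum>j<p. f ((t + 1 + 8 * of_nat j) / of_nat p)) = \<alpha> ^ n * (\<Sum>j<p. h (int j - int r))"
    by (simp add: sum_distrib_left)
  also have "(\<Sum>j<p. h (int j - int r)) = (\<Sum>j<p. h (int j))" by (rule sum_periodic_shift[of h p r, OF per])
  finally have s: "(\<Sum>j<p. f ((t + 1 + 8 * of_nat j) / of_nat p)) = \<alpha> ^ n * (\<Sum>j<p. G ((t + 8 * of_nat j) / of_nat p))"
    by (simp add: h_def)
  have "f (of_nat p * (t + 1)) = \<alpha> ^ n * G (of_nat p * t)"
    using key[of "of_nat p * t"] t p0 by (simp add: algebra_simps)
  with s show ?thesis unfolding hecke_def n_def[symmetric] by (simp add: G_def algebra_simps)
qed

section \<open>Expansions at infinity\<close>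

text \<open>Expansions in \<open>q = exp (\<pi> \<i> t / 4)\<close>; the variable of the theorem is \<open>z = t / 8\<close>.\<close>

definition qpow :: "int \<Rightarrow> complex \<Rightarrow> complex" where
  "qpow n t = exp (of_real pi * \<i> * of_int n * t / 4)"

text \<open>Unconditional sums over all integers allow exponents to be relabelled freely, as the
  Hecke operators require; the lower bound on the support makes expansions unique.\<close>

definition has_qexp :: "(complex \<Rightarrow> complex) \<Rightarrow> (int \<Rightarrow> complex) \<Rightarrow> bool" where
  "has_qexp f c \<longleftrightarrow> (\<exists>N. \<forall>n<N. c n = 0) \<and> (\<forall>t. Im t > 0 \<longrightarrow> ((\<lambda>n. c n * qpow n t) has_sum f t) UNIV)"

lemma qpow_add: "qpow (m + n) t = qpow m t * qpow n t"
  by (simp add: qpow_def exp_add[symmetric] field_simps)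

lemma qpow_nonzero [simp]: "qpow n t \<noteq> 0"
  by (simp add: qpow_def)

lemma qpow_0 [simp]: "qpow 0 t = 1"
  by (simp add: qpow_def)

lemma qpow_mult_nat: "qpow (n * int k) t = qpow n t ^ k"
  by (simp add: qpow_def exp_of_nat_mult[symmetric] algebra_simps)

lemma norm_qpow: "norm (qpow n t) = exp (- pi * of_int n * Im t / 4)"
  by (simp add: qpow_def norm_exp_eq_Re)

lemma norm_qpow_less_1:
  assumes "Im t > 0" "n > 0"
  shows "norm (qpow n t) < 1"
  using assms by (simp add: norm_qpow)

lemma ex_qpow:
  assumes "x \<noteq> 0" "norm x < 1" "s > 0"
  obtains t where "Im t > 0" "qpow s t = x"
proof
  define t where "t = 4 * Ln x / (of_real pi * \<i> * of_int s)"
  have "Im t = - 4 * ln (norm x) / (pi * of_int s)"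
  proof -
    have "t = of_real (4 / (pi * of_int s)) * (- \<i> * Ln x)" using assms by (simp add: t_def field_simps)
    hence "Im t = 4 / (pi * of_int s) * Im (- \<i> * Ln x)" by (simp del: of_real_divide of_real_mult)
    thus ?thesis using assms by (simp add: Re_Ln)
  qed
  thus "Im t > 0" using assms by (simp add: divide_neg_pos mult_pos_neg)
  show "qpow s t = x" using assms by (simp add: qpow_def t_def)
qed

lemma has_qexp_fpsI:
  assumes u: "fps_conv_radius u \<ge> 1" and s: "s > 0"
    and f: "\<And>t. Im t > 0 \<Longrightarrow> f t = qpow r t * eval_fps u (qpow s t)"
  shows "has_qexp f (\<lambda>n. if r \<le> n \<and> s dvd n - r then fps_nth u (nat ((n - r) div s)) else 0)"
  unfolding has_qexp_def
proof (intro conjI allI impI)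
  show "\<exists>N. \<forall>n<N. (if r \<le> n \<and> s dvd n - r then fps_nth u (nat ((n - r) div s)) else 0) = 0"
    by (intro exI[of _ r]) auto
next
  fix t :: complex assume t: "Im t > 0"
  define x where "x = qpow s t"
  have x1: "ereal (norm x) < fps_conv_radius u"
    using norm_qpow_less_1[OF t s] u unfolding x_def by (metis ereal_less(3) less_le_trans)
  have "summable (\<lambda>j. norm (fps_nth u j * x ^ j))"
    using abs_summable_in_conv_radius[of x "fps_nth u"] x1 by (simp add: fps_conv_radius_def)
  hence "((\<lambda>j. fps_nth u j * x ^ j) has_sum eval_fps u x) UNIV"
    by (rule norm_summable_imp_has_sum) (rule sums_eval_fps[OF x1])
  hence "((\<lambda>j. qpow r t * (fps_nth u j * x ^ j)) has_sum f t) UNIV"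
    unfolding f[OF t] x_def by (rule has_sum_cmult_right)
  moreover have "qpow r t * (fps_nth u j * x ^ j) = fps_nth u j * qpow (r + s * int j) t" for j
    by (simp add: x_def qpow_add qpow_mult_nat)
  ultimately have "((\<lambda>j. fps_nth u j * qpow (r + s * int j) t) has_sum f t) UNIV" by simp
  moreover define g where "g = (\<lambda>n. (if r \<le> n \<and> s dvd n - r then fps_nth u (nat ((n - r) div s)) else 0) * qpow n t)"
  define h where "h = (\<lambda>j::nat. r + s * int j)"
  have "fps_nth u j * qpow (r + s * int j) t = (g \<circ> h) j" for j using s by (simp add: g_def h_def)
  ultimately have "((g \<circ> h) has_sum f t) UNIV" by (simp only: o_def)
  moreover have "inj h" using s by (auto simp: inj_on_def h_def)
  ultimately have "(g has_sum f t) (range h)" by (simp add: has_sum_reindex)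
  moreover have "g n = 0" if "n \<notin> range h" for n
  proof (rule ccontr)
    assume "g n \<noteq> 0"
    hence n: "r \<le> n" "s dvd n - r" by (auto simp: g_def split: if_splits)
    then obtain k where k: "n - r = s * k" by auto
    hence "k \<ge> 0" using n s by (metis diff_ge_0_iff_ge zero_le_mult_iff not_less)
    hence "n = h (nat k)" using k by (simp add: h_def)
    thus False using that by auto
  qed
  ultimately show "((\<lambda>n. (if r \<le> n \<and> s dvd n - r then fps_nth u (nat ((n - r) div s)) else 0) * qpow n t) has_sum f t) UNIV"
    unfolding g_def[symmetric] by (subst has_sum_cong_neutral[of "range h" UNIV g g]) auto
qed

text \<open>Every point of the punctured unit disc is a value of \<open>qpow s\<close>, so
  summability throughout the half plane forces the radius of convergence to be at least 1.\<close>

lemma has_qexp_fpsD: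
  assumes f: "has_qexp f c" and s: "s > 0" and c: "\<And>n. c n \<noteq> 0 \<Longrightarrow> r \<le> n \<and> s dvd n - r"
  shows "fps_conv_radius (Abs_fps (\<lambda>j. c (r + s * int j))) \<ge> 1" (is "fps_conv_radius ?u \<ge> 1")
    and "Im t > 0 \<Longrightarrow> f t = qpow r t * eval_fps (Abs_fps (\<lambda>j. c (r + s * int j))) (qpow s t)"
proof -
  have sums: "(\<lambda>j. c (r + s * int j) * qpow s t ^ j) sums (f t / qpow r t)" if t: "Im t > 0" for t
  proof -
    define h where "h = (\<lambda>j::nat. r + s * int j)"
    define g where "g = (\<lambda>n. c n * qpow n t)"
    have "(g has_sum f t) UNIV" using f t by (simp add: has_qexp_def g_def)
    moreover have "g n = 0" if "n \<notin> range h" for n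
    proof (rule ccontr)
      assume "g n \<noteq> 0"
      hence n: "r \<le> n" "s dvd n - r" using c[of n] by (auto simp: g_def)
      then obtain k where k: "n - r = s * k" by auto
      hence "k \<ge> 0" using n s by (metis diff_ge_0_iff_ge zero_le_mult_iff not_less)
      hence "n = h (nat k)" using k by (simp add: h_def)
      thus False using that by auto
    qed
    ultimately have "(g has_sum f t) (range h)" by (subst (asm) has_sum_cong_neutral[of "range h" UNIV g g]) auto
    moreover have "inj h" using s by (auto simp: inj_on_def h_def)
    ultimately have "((g \<circ> h) has_sum f t) UNIV" by (simp add: has_sum_reindex)
    hence "(\<lambda>j. (g \<circ> h) j) sums f t" by (rule has_sum_imp_sums)
    hence "(\<lambda>j. (g \<circ> h) j / qpow r t) sums (f t / qpow r t)" by (rule sums_divide)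
    thus ?thesis by (simp add: g_def h_def qpow_add qpow_mult_nat)
  qed
  show r1: "fps_conv_radius ?u \<ge> 1"
    unfolding fps_conv_radius_def
  proof (rule conv_radius_geI_ex)
    fix \<rho> :: real assume "0 < \<rho>" "ereal \<rho> < 1"
    then obtain t where t: "Im t > 0" "qpow s t = of_real \<rho>" using ex_qpow[of "of_real \<rho>" s] s by auto
    thus "\<exists>z. norm z = \<rho> \<and> summable (\<lambda>n. fps_nth ?u n * z ^ n)"
      using sums[OF t(1)] \<open>0 < \<rho>\<close> by (intro exI[of _ "of_real \<rho>"]) (auto simp: sums_iff)
  qed
  assume t: "Im t > 0"
  have "ereal (norm (qpow s t)) < fps_conv_radius ?u"
    using norm_qpow_less_1[OF t s] r1 by (metis ereal_less(3) less_le_trans)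
  from sums_eval_fps[OF this] sums[OF t] have "eval_fps ?u (qpow s t) = f t / qpow r t"
    by (simp add: sums_iff)
  thus "f t = qpow r t * eval_fps ?u (qpow s t)" by simp
qed

lemma has_qexp_lower: 
  assumes "has_qexp f c"
  obtains N where "\<And>n. c n \<noteq> 0 \<Longrightarrow> N \<le> n"
  using assms unfolding has_qexp_def by (meson not_le)

lemma has_qexp_add:
  assumes "has_qexp f c" "has_qexp g d"
  shows "has_qexp (\<lambda>t. f t + g t) (\<lambda>n. c n + d n)"
proof -
  obtain N M where "\<And>n. c n \<noteq> 0 \<Longrightarrow> N \<le> n" "\<And>n. d n \<noteq> 0 \<Longrightarrow> M \<le> n"
    using assms has_qexp_lower by metis
  hence "\<forall>n<min N M. c n + d n = 0" by (metis add_0 min_less_iff_conj not_le)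
  moreover have "((\<lambda>n. (c n + d n) * qpow n t) has_sum (f t + g t)) UNIV" if "Im t > 0" for t
    using has_sum_add[of "\<lambda>n. c n * qpow n t" UNIV "f t" "\<lambda>n. d n * qpow n t" "g t"] assms that
    by (simp add: has_qexp_def algebra_simps)
  ultimately show ?thesis unfolding has_qexp_def by blast
qed

lemma has_qexp_cmult:
  assumes "has_qexp f c"
  shows "has_qexp (\<lambda>t. a * f t) (\<lambda>n. a * c n)"
proof -
  have "((\<lambda>n. (a * c n) * qpow n t) has_sum (a * f t)) UNIV" if "Im t > 0" for t
    using has_sum_cmult_right[of "\<lambda>n. c n * qpow n t" UNIV "f t" a] assms that
    by (simp add: has_qexp_def algebra_simps)
  thus ?thesis using assms unfolding has_qexp_def by (metis mult_zero_right)
qed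

lemma has_qexp_sum:
  assumes "\<And>i. i \<in> I \<Longrightarrow> has_qexp (f i) (c i)" "finite I"
  shows "has_qexp (\<lambda>t. \<Sum>i\<in>I. f i t) (\<lambda>n. \<Sum>i\<in>I. c i n)"
  using assms(2,1)
proof (induction I rule: finite_induct)
  case empty
  show ?case by (auto simp: has_qexp_def)
next
  case (insert i I)
  thus ?case using has_qexp_add[of "f i" "c i"] by simp
qed

lemma has_qexp_cong:
  assumes "has_qexp f c" "\<And>t. Im t > 0 \<Longrightarrow> f t = g t"
  shows "has_qexp g c"
  using assms by (simp add: has_qexp_def)

lemma has_qexp_unique:
  assumes f: "has_qexp f c" and g: "has_qexp f d"
  shows "c = d"
proof -
  define e where "e = (\<lambda>n. c n + (- 1) * d n)"
  have "has_qexp (\<lambda>t. f t + (- 1) * f t) e"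
    unfolding e_def by (intro has_qexp_add has_qexp_cmult f g)
  hence e: "has_qexp (\<lambda>t. 0) e" by simp
  obtain M where M: "\<And>n. e n \<noteq> 0 \<Longrightarrow> M \<le> n" using has_qexp_lower[OF e] by blast
  \<comment> \<open>Starting one below the support makes the coefficient at N zero. This settles the
    point x = 0, which \<open>qpow\<close> never reaches.\<close>
  define N where "N = M - 1"
  define u where "u = Abs_fps (\<lambda>j. e (N + int j))"
  have supp: "N \<le> n \<and> 1 dvd n - N" if "e n \<noteq> 0" for n using M[OF that] by (simp add: N_def)
  have u1: "Abs_fps (\<lambda>j. e (N + 1 * int j)) = u" by (simp add: u_def)
  note D = has_qexp_fpsD[of "\<lambda>t. 0" e 1 N, OF e zero_less_one supp, unfolded u1]
  have "u = 0"
  proof (rule eval_fps_eqD)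
    have "fps_conv_radius u \<ge> 1" using D(1) by simp
    thus "fps_conv_radius u > 0" by (rule less_le_trans[rotated]) simp
    show "fps_conv_radius (0 :: complex fps) > 0" by simp
    have z: "eval_fps u x = eval_fps 0 x" if x: "x \<in> ball 0 1" for x
    proof (cases "x = 0")
      case True
      have "e N = 0" using M[of N] by (auto simp: N_def)
      thus ?thesis using True by (simp add: u_def eval_fps_at_0)
    next
      case False
      then obtain t where t: "Im t > 0" "qpow 1 t = x" using ex_qpow[of x 1] x by auto
      thus ?thesis using D(2)[OF _ t(1)] by simp
    qed
    show "eventually (\<lambda>x. eval_fps u x = eval_fps 0 x) (nhds 0)"
      by (rule eventually_mono[OF eventually_nhds_in_open[of "ball 0 1"]]) (use z in auto)
  qed
  have "e n = 0" for n
  proof (rule ccontr)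
    assume n: "e n \<noteq> 0"
    hence "n = N + int (nat (n - N))" using supp by simp
    moreover have "fps_nth u (nat (n - N)) = 0" by (simp add: \<open>u = 0\<close>)
    ultimately show False using n by (simp add: u_def)
  qed
  thus ?thesis by (auto simp: e_def)
qed

lemma has_qexp_deriv:
  assumes "has_qexp f c"
  shows "\<exists>f'. (\<forall>t. Im t > 0 \<longrightarrow> (f has_field_derivative f' t) (at t)) \<and>
           has_qexp f' (\<lambda>n. of_real pi * \<i> * of_int n / 4 * c n)"
proof -
  obtain N where N: "\<And>n. c n \<noteq> 0 \<Longrightarrow> N \<le> n" using has_qexp_lower[OF assms] by blast
  define u where "u = Abs_fps (\<lambda>j. c (N + int j))"
  have supp: "N \<le> n \<and> 1 dvd n - N" if "c n \<noteq> 0" for n using N[OF that] by simp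
  have u1: "Abs_fps (\<lambda>j. c (N + 1 * int j)) = u" by (simp add: u_def)
  note D = has_qexp_fpsD[of f c 1 N, OF assms zero_less_one supp, unfolded u1]
  define k where "k = of_real pi * \<i> / 4"
  define v where "v = fps_const k * (fps_const (of_int N) * u + fps_X * fps_deriv u)"
  define f' where "f' = (\<lambda>t. qpow N t * eval_fps v (qpow 1 t))"
  have du: "fps_conv_radius (fps_deriv u) \<ge> 1" using D(1) fps_conv_radius_deriv order_trans by blast
  have r1: "fps_conv_radius (fps_const (of_int N) * u) \<ge> 1"
    by (rule order_trans[OF _ fps_conv_radius_mult]) (use D(1) in simp)
  have r2: "fps_conv_radius (fps_X * fps_deriv u) \<ge> 1"
    by (rule order_trans[OF _ fps_conv_radius_mult]) (use du in simp)
  have r3: "fps_conv_radius (fps_const (of_int N) * u + fps_X * fps_deriv u) \<ge> 1"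
    by (rule order_trans[OF _ fps_conv_radius_add]) (use r1 r2 in simp)
  have rv: "fps_conv_radius v \<ge> 1"
    unfolding v_def by (rule order_trans[OF _ fps_conv_radius_mult]) (use r3 in simp)
  have lt: "ereal (norm x) < fps_conv_radius w" if "norm x < 1" "fps_conv_radius w \<ge> 1" for w :: "complex fps" and x :: complex
    using that by (metis ereal_less(3) less_le_trans)
  have ev: "eval_fps v x = k * (of_int N * eval_fps u x + x * eval_fps (fps_deriv u) x)" if "norm x < 1" for x
    unfolding v_def using lt[OF that] r1 r2 r3 D(1) du
    by (simp add: eval_fps_mult eval_fps_add)
  have "(f has_field_derivative f' t) (at t)" if t: "Im t > 0" for t
  proof -
    define x where "x = qpow 1 t"
    have x1: "norm x < 1" unfolding x_def by (rule norm_qpow_less_1[OF t]) simp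
    have dq: "(qpow m has_field_derivative k * of_int m * qpow m t) (at t)" for m
      unfolding qpow_def[abs_def] by (auto intro!: derivative_eq_intros simp: k_def)
    have "((\<lambda>t. eval_fps u (qpow 1 t)) has_field_derivative eval_fps (fps_deriv u) x * (k * of_int 1 * qpow 1 t)) (at t)"
      by (rule DERIV_chain2[OF _ dq]) (use has_field_derivative_eval_fps[OF lt[OF x1 D(1)]] in \<open>simp add: x_def\<close>)
    from DERIV_mult[OF dq[of N] this]
    have "((\<lambda>t. qpow N t * eval_fps u (qpow 1 t)) has_field_derivative f' t) (at t)"
      unfolding f'_def using ev[OF x1] by (simp add: x_def algebra_simps)
    thus ?thesis
      by (rule DERIV_cong_ev[THEN iffD1, OF refl _ refl, rotated])
         (rule eventually_mono[OF eventually_nhds_in_open[OF open_halfspace_Im_gt[of 0]]],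
           use t D(2) in auto)
  qed
  moreover have "has_qexp f' (\<lambda>n. if N \<le> n \<and> 1 dvd n - N then fps_nth v (nat ((n - N) div 1)) else 0)"
    by (rule has_qexp_fpsI[OF rv]) (auto simp: f'_def)
  moreover have "(\<lambda>n. if N \<le> n \<and> 1 dvd n - N then fps_nth v (nat ((n - N) div 1)) else 0) =
     (\<lambda>n. of_real pi * \<i> * of_int n / 4 * c n)"
  proof
    fix n
    show "(if N \<le> n \<and> 1 dvd n - N then fps_nth v (nat ((n - N) div 1)) else 0) = of_real pi * \<i> * of_int n / 4 * c n"
    proof (cases "N \<le> n")
      case True
      define j where "j = nat (n - N)"
      have n: "n = N + int j" using True by (simp add: j_def)
      have "fps_nth v j = k * (of_int N + of_nat j) * c n"
        unfolding v_def n by (cases j) (simp_all add: u_def algebra_simps)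
      thus ?thesis using True by (simp add: j_def[symmetric] k_def n)
    next
      case False
      hence "c n = 0" using N by auto
      thus ?thesis using False by simp
    qed
  qed
  ultimately show ?thesis by auto
qed

section \<open>Bounded invariant functions\<close>

text \<open>Translate until |Re s| <= 1/2. If still Im s < 1/2, then |s|^2 <= 1/2 and the inversion
  at least doubles the imaginary part; the threshold 1/2, below the usual sqrt 3 / 2, buys this
  fixed factor and with it termination. The value type of P is arbitrary because P will be
  set-valued.\<close>

lemma reduce_to_half_plane:
  fixes P :: "complex \<Rightarrow> 'a"
  assumes T: "\<And>t. Im t > 0 \<Longrightarrow> P (t + 1) = P t" and S: "\<And>t. Im t > 0 \<Longrightarrow> P (- 1 / t) = P t"
    and t: "Im t > 0"
  shows "\<exists>w. Im w \<ge> 1 / 2 \<and> P w = P t"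
proof -
  have Tk: "P (t + of_int k) = P t" if t: "Im t > 0" for t k
  proof (induction k rule: int_induct[where k = 0])
    case (step1 i)
    have "P (t + of_int (i + 1)) = P ((t + of_int i) + 1)" by (simp add: algebra_simps)
    also have "\<dots> = P (t + of_int i)" by (rule T) (use t in simp)
    finally show ?case using step1 by simp
  next
    case (step2 i)
    have "P (t + of_int i) = P ((t + of_int (i - 1)) + 1)" by (simp add: algebra_simps)
    also have "\<dots> = P (t + of_int (i - 1))" by (rule T) (use t in simp)
    finally show ?case using step2 by simp
  qed simp
  have "\<exists>w. Im w \<ge> 1 / 2 \<and> P w = P t" if "Im t \<ge> (1 / 2) / 2 ^ n" for n t
    using that
  proof (induction n arbitrary: t)
    case 0
    thus ?case by auto
  next
    case (Suc n)
    have t0: "Im t > 0" using Suc.prems by (rule less_le_trans[rotated]) simp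
    show ?case
    proof (cases "Im t \<ge> 1 / 2")
      case False
      define s where "s = t + of_int (- round (Re t))"
      have s: "Im s = Im t" "P s = P t" using Tk[OF t0, of "- round (Re t)"] by (auto simp: s_def)
      have "\<bar>Re s\<bar> \<le> 1 / 2" using of_int_round_abs_le[of "Re t"] by (simp add: s_def abs_minus_commute)
      hence "(Re s)\<^sup>2 \<le> (1 / 2)\<^sup>2" by (subst abs_le_square_iff[symmetric]) simp
      moreover have "(Im s)\<^sup>2 \<le> (1 / 2)\<^sup>2" using False s t0 by (intro power_mono) auto
      ultimately have n2: "(norm s)\<^sup>2 \<le> 1 / 2" unfolding cmod_power2 by (simp add: power_divide)
      have s0: "s \<noteq> 0" using s t0 by auto
      have "Im (- 1 / s) = Im s / (norm s)\<^sup>2" by (simp add: Im_divide cmod_power2)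
      also have "\<dots> \<ge> Im s / (1 / 2)"
        using n2 s0 s t0 by (intro divide_left_mono) auto
      finally have "Im (- 1 / s) \<ge> 2 * Im s" by simp
      moreover have "2 * Im s \<ge> (1 / 2) / 2 ^ n" using Suc.prems s by (simp add: field_simps)
      ultimately have "Im (- 1 / s) \<ge> (1 / 2) / 2 ^ n" by linarith
      from Suc.IH[OF this] show ?thesis using S[of s] s t0 by auto
    qed auto
  qed
  moreover obtain n where "(1 / 2 :: real) / 2 ^ n \<le> Im t"
  proof -
    obtain n where "(1 / 2) ^ n < Im t" using real_arch_pow_inv[of "Im t" "1 / 2"] t by auto
    hence "(1 / 2 :: real) / 2 ^ n \<le> Im t" by (simp add: power_divide field_simps)
    thus ?thesis using that by blast
  qed
  ultimately show ?thesis by blast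
qed

text \<open>The maximum principle needs a maximum in the open disc. Every value of the three
  functions already occurs, for one of them, on a compact part of the disc, because it can be moved
  to a point with imaginary part at least 1/2 by the full modular group.\<close>

lemma gamma2_invariant_constant:
  fixes \<Phi> J J0 J1 :: "complex \<Rightarrow> complex"
  assumes hol: "J holomorphic_on ball 0 1" "J0 holomorphic_on ball 0 1" "J1 holomorphic_on ball 0 1"
    and J: "\<And>t. Im t > 0 \<Longrightarrow> \<Phi> t = J (qpow 4 t)"
    and J0: "\<And>t. Im t > 0 \<Longrightarrow> \<Phi> (- 1 / t) = J0 (qpow 4 t)"
    and J1: "\<And>t. Im t > 0 \<Longrightarrow> \<Phi> (1 - 1 / t) = J1 (qpow 4 t)"
  obtains c where "\<And>t. Im t > 0 \<Longrightarrow> \<Phi> t = c"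
proof -
  define F where "F i t = (if i = (0::nat) then \<Phi> t else if i = 1 then \<Phi> (- 1 / t) else \<Phi> (1 - 1 / t))" for i t
  define G where "G i = (if i = (0::nat) then J else if i = 1 then J0 else J1)" for i
  have FG: "F i t = G i (qpow 4 t)" if "Im t > 0" for i t
    using J[OF that] J0[OF that] J1[OF that] by (auto simp: F_def G_def)
  have q2: "qpow 4 (t + 2) = qpow 4 t" for t
  proof -
    have "qpow 4 (t + 2) = qpow 4 t * exp (2 * of_real pi * \<i>)"
      unfolding qpow_def exp_add[symmetric] by (rule arg_cong[of _ _ exp]) (simp add: field_simps)
    thus ?thesis by simp
  qed
  have F2: "F i (t + 2) = F i t" if "Im t > 0" for i t
    using FG[of t] FG[of "t + 2"] that q2 by simp
  have \<Phi>2: "\<Phi> (t + 2) = \<Phi> t" if "Im t > 0" for t using F2[OF that, of 0] by (simp add: F_def)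
  define I where "I = {0, 1, 2::nat}"
  \<comment> \<open>The values of \<Phi> at six coset representatives of \<Gamma>(2) in the modular
    group; as a set it is invariant under both generators.\<close>
  define V where "V t = (\<lambda>i. F i t) ` I \<union> (\<lambda>i. F i (t + 1)) ` I" for t
  have VT: "V (t + 1) = V t" if "Im t > 0" for t
    using F2[OF that] by (simp add: V_def add.assoc Un_commute)
  have VS1: "V (- 1 / t) \<subseteq> V t" if t: "Im t > 0" for t
  proof -
    have t0: "t \<noteq> 0" "t - 1 \<noteq> 0" using t by auto
    have im: "Im (t - 1) > 0" "Im (- 1 / t) > 0" "Im (- 1 / (t - 1)) > 0" "Im (t + 1) > 0"
      using t Im_minus_inverse[of t] Im_minus_inverse[of "t - 1"] by auto
    have m: "F i (t - 1) = F i (t + 1)" for i using F2[OF im(1), of i] by (simp add: algebra_simps)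
    have e: "- 1 / (- 1 / t + 1) = - 1 / (t - 1) - 1" "1 - 1 / (- 1 / t + 1) = - 1 / (t - 1)"
      using t0 by (simp_all add: field_simps)
    have "F 0 (- 1 / t) = F 1 t" by (simp add: F_def)
    moreover have "F 1 (- 1 / t) = F 0 t" using t0 by (simp add: F_def)
    moreover have "F 2 (- 1 / t) = F 0 (t + 1)" using t0 by (simp add: F_def add.commute)
    moreover have "F 0 (- 1 / t + 1) = F 2 t" by (simp add: F_def)
    moreover have "F 1 (- 1 / t + 1) = F 2 (t - 1)"
    proof -
      have "F 1 (- 1 / t + 1) = \<Phi> (- 1 / (t - 1) - 1)" unfolding F_def e by simp
      also have "\<dots> = \<Phi> (- 1 / (t - 1) - 1 + 2)" by (rule \<Phi>2[symmetric]) (use im in simp)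
      finally show ?thesis by (simp add: F_def)
    qed
    moreover have "F 2 (- 1 / t + 1) = F 1 (t - 1)" unfolding F_def e by simp
    ultimately show ?thesis unfolding V_def I_def m by auto
  qed
  have VS: "V (- 1 / t) = V t" if "Im t > 0" for t
  proof
    show "V (- 1 / t) \<subseteq> V t" by (rule VS1[OF that])
    have "t \<noteq> 0" using that by auto
    thus "V t \<subseteq> V (- 1 / t)" using VS1[OF Im_minus_inverse[OF that]] by simp
  qed
  \<comment> \<open>The modulus of \<open>qpow 4 t\<close> on the line Im t = 1/2.\<close>
  define \<rho> where "\<rho> = exp (- pi / 2)"
  have \<rho>: "\<rho> < 1" "\<rho> > 0" by (simp_all add: \<rho>_def)
  define K where "K = cball (0::complex) \<rho>"
  have K: "K \<subseteq> ball 0 1" "compact K" using \<rho> by (auto simp: K_def)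
  have inK: "qpow 4 w \<in> K" if "Im w \<ge> 1 / 2" for w
  proof -
    have "norm (qpow 4 w) \<le> \<rho>"
      unfolding norm_qpow \<rho>_def using that by (simp add: field_simps)
    thus ?thesis by (simp add: K_def)
  qed
  have bound: "\<exists>i\<in>I. \<exists>x\<in>K. F i' t = G i x" if t: "Im t > 0" and i': "i' \<in> I" for t i'
  proof -
    obtain w where w: "Im w \<ge> 1 / 2" "V w = V t" using reduce_to_half_plane[of V t] VT VS t by blast
    have "F i' t \<in> V w" unfolding w(2) using i' by (auto simp: V_def)
    then obtain i w' where "i \<in> I" "F i' t = F i w'" "w' = w \<or> w' = w + 1" unfolding V_def by auto
    moreover from this have "Im w' \<ge> 1 / 2" using w by auto
    ultimately show ?thesis using FG[of w' i] inK[of w'] by (intro bexI[of _ i] bexI[of _ "qpow 4 w'"]) auto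
  qed
  have holG: "G i holomorphic_on ball 0 1" for i using hol by (simp add: G_def)
  have "\<exists>x\<in>K. \<forall>y\<in>K. norm (G i y) \<le> norm (G i x)" for i
  proof (rule continuous_attains_sup)
    show "compact K" "K \<noteq> {}" using K \<rho> by (auto simp: K_def)
    show "continuous_on K (\<lambda>x. norm (G i x))"
      using holomorphic_on_imp_continuous_on[OF holG] K by (intro continuous_intros) (rule continuous_on_subset)
  qed
  then obtain x where x: "\<And>i. x i \<in> K" "\<And>i y. y \<in> K \<Longrightarrow> norm (G i y) \<le> norm (G i (x i))" by metis
  define m where "m = Max ((\<lambda>i. norm (G i (x i))) ` I)"
  have "m \<in> (\<lambda>i. norm (G i (x i))) ` I" unfolding m_def by (rule Max_in) (auto simp: I_def)
  then obtain i where i: "i \<in> I" "m = norm (G i (x i))" by auto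
  have m: "norm (G j y) \<le> m" if "j \<in> I" "y \<in> K" for j y
  proof -
    have "norm (G j (x j)) \<le> m" unfolding m_def using that by (intro Max_ge) (auto simp: I_def)
    thus ?thesis using x(2)[OF that(2), of j] by simp
  qed
  \<comment> \<open>The centre y = 0 is not of the form \<open>qpow 4 t\<close>, but it lies in
    \<open>K\<close>, where the bound m holds by choice.\<close>
  have le: "norm (G i y) \<le> norm (G i (x i))" if y: "y \<in> ball 0 1" for y
  proof (cases "y = 0")
    case True
    thus ?thesis using m[OF i(1), of 0] \<rho> i by (simp add: K_def)
  next
    case False
    then obtain t where t: "Im t > 0" "qpow 4 t = y" using ex_qpow[of y 4] y by auto
    then obtain j z where "j \<in> I" "z \<in> K" "F i t = G j z" using bound[OF t(1) i(1)] by blast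
    thus ?thesis using m[of j z] FG[OF t(1), of i] t(2) i by simp
  qed
  have "G i constant_on ball 0 1"
    by (rule maximum_modulus_principle[OF holG open_ball connected_ball open_ball order_refl, of "x i"])
       (use le x(1)[of i] K in auto)
  then obtain c where c: "\<And>y. y \<in> ball 0 1 \<Longrightarrow> G i y = c" by (auto simp: constant_on_def)
  have Fc: "F i t = c" if "Im t > 0" for t
    using FG[OF that, of i] c norm_qpow_less_1[OF that, of 4] by simp
  have "\<Phi> t = c" if t: "Im t > 0" for t
  proof -
    have im: "Im (- 1 / t) > 0" "Im (- 1 / (t - 1)) > 0"
      using t Im_minus_inverse[of t] Im_minus_inverse[of "t - 1"] by auto
    have t0: "t \<noteq> 0" "t - 1 \<noteq> 0" using t by auto
    consider "i = 0" | "i = 1" | "i = 2" using i(1) by (auto simp: I_def)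
    thus ?thesis
    proof cases
      case 1
      thus ?thesis using Fc[OF t] by (simp add: F_def)
    next
      case 2
      thus ?thesis using Fc[OF im(1)] t0 by (simp add: F_def)
    next
      case 3
      thus ?thesis using Fc[OF im(2)] t0 by (simp add: F_def field_simps)
    qed
  qed
  thus ?thesis using that by blast
qed

text \<open>With \<open>t = 8 z\<close>, \<open>\<eta>\<^sup>2\<close> at \<open>8 z\<close>, \<open>4 z\<close> and \<open>16 z\<close>; \<open>fz2\<close> is \<open>\<eta>\<^sup>2((t + 1) / 2)\<close>
  normalised to have leading coefficient 1. In these terms \<open>g\<^sub>2 = fz1\<^sup>3\<close> and \<open>L\<^sub>2 = fz2 / fz3\<close>.\<close>

definition fz0 :: "complex \<Rightarrow> complex" where "fz0 t = eta2 t"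
definition fz1 :: "complex \<Rightarrow> complex" where "fz1 t = eta2 (t / 2)"
definition fz3 :: "complex \<Rightarrow> complex" where "fz3 t = eta2 (2 * t)"
definition fz2 :: "complex \<Rightarrow> complex" where
  "fz2 t = exp (of_real pi * \<i> * t / 12 + 2 * log_E (- qpow 4 t))"

lemma fz_nonzero [simp]: "fz0 t \<noteq> 0" "fz1 t \<noteq> 0" "fz2 t \<noteq> 0" "fz3 t \<noteq> 0"
  by (simp_all add: fz0_def fz1_def fz2_def fz3_def)

text \<open>The four eta squares stripped of their leading powers of q, in the variable x =
  \<open>qpow 4 t\<close>. As exponentials they have no zeros in the disc, so all their quotients
  are holomorphic there.\<close>

definition u0 :: "complex \<Rightarrow> complex" where "u0 x = exp (2 * log_E (x\<^sup>2))"
definition u1 :: "complex \<Rightarrow> complex" where "u1 x = exp (2 * log_E x)"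
definition u2 :: "complex \<Rightarrow> complex" where "u2 x = exp (2 * log_E (- x))"
definition u3 :: "complex \<Rightarrow> complex" where "u3 x = exp (2 * log_E (x ^ 4))"

lemma u_nonzero [simp]: "u0 x \<noteq> 0" "u1 x \<noteq> 0" "u2 x \<noteq> 0" "u3 x \<noteq> 0"
  by (simp_all add: u0_def u1_def u2_def u3_def)

lemma holomorphic_u [holomorphic_intros]:
  "u0 holomorphic_on ball 0 1" "u1 holomorphic_on ball 0 1" "u2 holomorphic_on ball 0 1" "u3 holomorphic_on ball 0 1"
  unfolding u0_def[abs_def] u1_def[abs_def] u2_def[abs_def] u3_def[abs_def]
  by (auto intro!: holomorphic_intros simp: norm_power power_less_one_iff)

lemma u_product:
  assumes "norm x < 1"
  shows "u1 x * u2 x * u3 x = u0 x ^ 3"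
proof -
  have "u1 x * u2 x * u3 x = exp (2 * (log_E x + log_E (- x) + log_E (x ^ 4)))"
    by (simp add: u1_def u2_def u3_def exp_add[symmetric] algebra_simps)
  also have "\<dots> = u0 x ^ 3"
    unfolding log_E_quadruple[OF assms] by (simp add: u0_def exp_of_nat_mult[symmetric] algebra_simps)
  finally show ?thesis .
qed

text \<open>This is q^(n/3): the eta squares have leading exponents in thirds of an integer, which
  become integral only in combinations.\<close>

definition q12 :: "int \<Rightarrow> complex \<Rightarrow> complex" where "q12 n t = exp (of_real pi * \<i> * of_int n * t / 12)"

lemma q12_add: "q12 (m + n) t = q12 m t * q12 n t"
  by (simp add: q12_def exp_add[symmetric] field_simps)

lemma q12_power: "q12 n t ^ k = q12 (n * int k) t"
  by (simp add: q12_def exp_of_nat_mult[symmetric] field_simps)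

lemma q12_nonzero [simp]: "q12 n t \<noteq> 0"
  by (simp add: q12_def)

lemma q12_divide: "q12 m t / q12 n t = q12 (m - n) t"
  by (simp add: q12_def exp_diff[symmetric] field_simps)

lemma q12_eq_qpow: "q12 (3 * n) t = qpow n t"
  unfolding q12_def qpow_def by (rule arg_cong[of _ _ exp]) simp

lemma fz_eq_u:
  "fz0 t = q12 2 t * u0 (qpow 4 t)" "fz1 t = q12 1 t * u1 (qpow 4 t)"
  "fz2 t = q12 1 t * u2 (qpow 4 t)" "fz3 t = q12 4 t * u3 (qpow 4 t)"
proof -
  have p: "qpow 4 t ^ n = exp (of_nat n * (of_real pi * \<i> * t))" for n
    unfolding qpow_def exp_of_nat_mult[symmetric] by (rule arg_cong[of _ _ exp]) simp
  have p1: "qpow 4 t = exp (of_real pi * \<i> * t)" using p[of 1] by simp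
  show "fz0 t = q12 2 t * u0 (qpow 4 t)" "fz3 t = q12 4 t * u3 (qpow 4 t)"
    unfolding fz0_def fz3_def eta2_def q12_def u0_def u3_def p exp_add by (simp_all add: mult_ac)
  show "fz1 t = q12 1 t * u1 (qpow 4 t)" "fz2 t = q12 1 t * u2 (qpow 4 t)"
    unfolding fz1_def fz2_def eta2_def q12_def u1_def u2_def p1 exp_add by (simp_all add: mult_ac)
qed

lemma fz_product:
  assumes "Im t > 0"
  shows "fz1 t * fz2 t * fz3 t = fz0 t ^ 3"
proof -
  have "fz1 t * fz2 t * fz3 t = (q12 1 t * q12 1 t * q12 4 t) * (u1 (qpow 4 t) * u2 (qpow 4 t) * u3 (qpow 4 t))"
    by (simp add: fz_eq_u mult_ac)
  also have "\<dots> = q12 6 t * u0 (qpow 4 t) ^ 3"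
    unfolding u_product[OF norm_qpow_less_1[OF assms, of 4, simplified]] by (simp flip: q12_add)
  also have "\<dots> = fz0 t ^ 3" by (simp add: fz_eq_u power_mult_distrib q12_power)
  finally show ?thesis .
qed

text \<open>The eta formula applies directly at t, 2t and t/2, the inversion exchanging the last
  two. For \<open>fz2\<close>, which lives at (t + 1)/2, the formula follows by cancelling the other
  factors in \<open>fz_product\<close>.\<close>

lemma fz_inversion:
  assumes t: "Im t > 0"
  shows "fz0 (- 1 / t) = - \<i> * t * fz0 t" "fz1 (- 1 / t) = - \<i> * t * (2 * fz3 t)"
    "fz2 (- 1 / t) = - \<i> * t * fz2 t" "fz3 (- 1 / t) = - \<i> * t * (fz1 t / 2)"
proof -
  have t0: "t \<noteq> 0" using t by auto
  show f0: "fz0 (- 1 / t) = - \<i> * t * fz0 t" unfolding fz0_def by (rule eta2_inversion[OF t])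
  have "Im (2 * t) > 0" "Im (t / 2) > 0" using t by auto
  from eta2_inversion[OF this(1)] eta2_inversion[OF this(2)]
  show f1: "fz1 (- 1 / t) = - \<i> * t * (2 * fz3 t)" and f3: "fz3 (- 1 / t) = - \<i> * t * (fz1 t / 2)"
    by (simp_all add: fz1_def fz3_def mult_ac)
  have "fz1 (- 1 / t) * fz2 (- 1 / t) * fz3 (- 1 / t) = (- \<i> * t) ^ 3 * (fz1 t * fz2 t * fz3 t)"
    unfolding fz_product[OF t] fz_product[OF Im_minus_inverse[OF t]] f0 by (simp only: power_mult_distrib)
  hence "(- \<i> * t) ^ 2 * (fz1 t * fz3 t) * fz2 (- 1 / t) = (- \<i> * t) ^ 2 * (fz1 t * fz3 t) * (- \<i> * t * fz2 t)"
    unfolding f1 f3 by (simp add: power2_eq_square power3_eq_cube mult_ac)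
  thus "fz2 (- 1 / t) = - \<i> * t * fz2 t"
    by (subst (asm) mult_left_cancel) (use t0 in simp_all)
qed

lemma qpow_4_plus_1: "qpow 4 (t + 1) = - qpow 4 t"
proof -
  have "qpow 4 (t + 1) = qpow 4 t * exp (of_real pi * \<i>)"
    unfolding qpow_def exp_add[symmetric] by (rule arg_cong[of _ _ exp]) (simp add: field_simps)
  thus ?thesis by simp
qed

lemma q12_plus_1: "q12 n (t + 1) = q12 n 1 * q12 n t"
  by (simp add: q12_def exp_add[symmetric] field_simps)

lemma fz_shift:
  "fz0 (t + 1) = q12 2 1 * fz0 t" "fz1 (t + 1) = q12 1 1 * fz2 t"
  "fz2 (t + 1) = q12 1 1 * fz1 t" "fz3 (t + 1) = q12 4 1 * fz3 t"
  by (simp_all add: fz_eq_u q12_plus_1 qpow_4_plus_1 u0_def u1_def u2_def u3_def)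

section \<open>Weakly holomorphic forms with poles at infinity only\<close>

lemma has_sum_multiples:
  fixes g :: "int \<Rightarrow> complex"
  assumes "p \<noteq> 0"
  shows "((\<lambda>n. if p dvd n then g n else 0) has_sum S) UNIV \<longleftrightarrow> ((\<lambda>m. g (p * m)) has_sum S) UNIV"
proof -
  define h where "h = (\<lambda>m::int. p * m)"
  define G where "G = (\<lambda>n. if p dvd n then g n else 0)"
  have inj: "inj h" using assms by (auto simp: inj_on_def h_def)
  have "(G has_sum S) UNIV \<longleftrightarrow> (G has_sum S) (range h)"
    by (rule has_sum_cong_neutral) (auto simp: G_def h_def)
  also have "\<dots> \<longleftrightarrow> ((G \<circ> h) has_sum S) UNIV" by (rule has_sum_reindex[OF inj])
  also have "G \<circ> h = (\<lambda>m. g (p * m))" by (auto simp: G_def h_def fun_eq_iff)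
  finally show ?thesis by (simp add: G_def)
qed

lemma has_sum_sum':
  fixes f :: "nat \<Rightarrow> 'b \<Rightarrow> complex"
  assumes "\<And>j. (f j has_sum S j) A"
  shows "((\<lambda>n. \<Sum>j<p. f j n) has_sum (\<Sum>j<p. S j)) A"
  by (induction p) (auto intro!: has_sum_add assms)

lemma sum_unity_roots:
  assumes "p > 0"
  shows "(\<Sum>j<p. exp (2 * of_real pi * \<i> * of_int n / of_nat p) ^ j) = (if int p dvd n then of_nat p else (0::complex))"
proof -
  define w where "w = exp (2 * of_real pi * \<i> * of_int n / of_nat p)"
  have wp: "w ^ p = 1"
  proof -
    have "w ^ p = exp (2 * of_int n * of_real pi * \<i>)"
      unfolding w_def exp_of_nat_mult[symmetric] by (rule arg_cong[of _ _ exp]) (use assms in simp)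
    also have "\<dots> = 1" by (subst exp_eq_1) (auto intro!: exI[of _ n])
    finally show ?thesis .
  qed
  show ?thesis
  proof (cases "int p dvd n")
    case True
    then obtain k where k: "n = int p * k" by auto
    have "w = exp (2 * of_int k * of_real pi * \<i>)"
      unfolding w_def by (rule arg_cong[of _ _ exp]) (use assms k in simp)
    also have "\<dots> = 1" by (subst exp_eq_1) (auto intro!: exI[of _ k])
    finally show ?thesis using True by (simp add: w_def)
  next
    case False
    have "w \<noteq> 1"
    proof
      assume "w = 1"
      then obtain k :: int where "Im (2 * of_real pi * \<i> * of_int n / of_nat p) = of_int (2 * k) * pi"
        unfolding w_def exp_eq_1 by auto
      hence "of_int n = (of_int (int p * k) :: real)" using assms by (simp add: field_simps)
      hence "n = int p * k" by (simp only: of_int_eq_iff)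
      thus False using False by simp
    qed
    hence "(\<Sum>j<p. w ^ j) = 0" using geometric_sum[of w p] wp by simp
    thus ?thesis using False by (simp add: w_def)
  qed
qed

text \<open>The sum over j is a sum over p-th roots of unity that keeps only the exponents divisible
  by p, giving U(p), while f (p t) spreads the exponents by the factor p, giving V(p).\<close>

lemma has_qexp_hecke:
  assumes f: "has_qexp f c" and p: "p > 0"
  shows "has_qexp (hecke p f) (\<lambda>n. c (int p * n) - of_nat p ^ 2 * (if int p dvd n then c (n div int p) else 0))"
  unfolding has_qexp_def
proof (intro conjI allI impI)
  obtain N where N: "\<And>n. c n \<noteq> 0 \<Longrightarrow> N \<le> n" using has_qexp_lower[OF f] by blast
  have "c (int p * n) = 0 \<and> (int p dvd n \<longrightarrow> c (n div int p) = 0)" if n: "n < int p * (- \<bar>N\<bar>)" for n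
  proof (intro conjI impI)
    have "n < - \<bar>N\<bar>"
      using n p mult_right_mono_neg[of 1 "int p" "- \<bar>N\<bar>"] by simp
    hence "n < 0" by simp
    hence "int p * n \<le> n" using p mult_right_mono_neg[of 1 "int p" n] by simp
    hence "int p * n < N" using \<open>n < - \<bar>N\<bar>\<close> by linarith
    thus "c (int p * n) = 0" using N[of "int p * n"] by auto
    assume "int p dvd n"
    then obtain k where k: "n = int p * k" by auto
    have "k < - \<bar>N\<bar>" by (rule mult_left_less_imp_less[OF n[unfolded k]]) simp
    hence "k < N" by linarith
    thus "c (n div int p) = 0" using N[of k] p k by auto
  qed
  thus "\<exists>N. \<forall>n<N. c (int p * n) - of_nat p ^ 2 * (if int p dvd n then c (n div int p) else 0) = 0"
    by (intro exI[of _ "int p * (- \<bar>N\<bar>)"]) auto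
next
  fix t :: complex assume t: "Im t > 0"
  have qe: "((\<lambda>n. c n * qpow n s) has_sum f s) UNIV" if "Im s > 0" for s
    using f that by (simp add: has_qexp_def)
  define w where "w n = exp (2 * of_real pi * \<i> * of_int n / of_nat p)" for n :: int
  have q: "qpow n ((t + 8 * of_nat j) / of_nat p) = qpow n (t / of_nat p) * w n ^ j" for n j
    unfolding qpow_def w_def exp_of_nat_mult[symmetric] exp_add[symmetric]
    by (rule arg_cong[of _ _ exp]) (use p in \<open>simp add: field_simps\<close>)
  have "((\<lambda>n. \<Sum>j<p. c n * qpow n ((t + 8 * of_nat j) / of_nat p)) has_sum (\<Sum>j<p. f ((t + 8 * of_nat j) / of_nat p))) UNIV"
    by (rule has_sum_sum') (rule qe, use t p in simp)
  moreover have "(\<Sum>j<p. c n * qpow n ((t + 8 * of_nat j) / of_nat p)) = (if int p dvd n then of_nat p * (c n * qpow n (t / of_nat p)) else 0)" for n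
  proof -
    have "(\<Sum>j<p. c n * qpow n ((t + 8 * of_nat j) / of_nat p)) = c n * qpow n (t / of_nat p) * (\<Sum>j<p. w n ^ j)"
      unfolding q sum_distrib_left by (simp add: mult_ac)
    thus ?thesis unfolding w_def sum_unity_roots[OF p] by simp
  qed
  ultimately have "((\<lambda>m. of_nat p * (c (int p * m) * qpow (int p * m) (t / of_nat p))) has_sum (\<Sum>j<p. f ((t + 8 * of_nat j) / of_nat p))) UNIV"
    using has_sum_multiples[of "int p" "\<lambda>n. of_nat p * (c n * qpow n (t / of_nat p))"] p by simp
  hence "((\<lambda>m. inverse (of_nat p) * (of_nat p * (c (int p * m) * qpow (int p * m) (t / of_nat p)))) has_sum (inverse (of_nat p) * (\<Sum>j<p. f ((t + 8 * of_nat j) / of_nat p)))) UNIV"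
    by (rule has_sum_cmult_right)
  moreover have "inverse (of_nat p) * (of_nat p * (c (int p * m) * qpow (int p * m) (t / of_nat p))) = c (int p * m) * qpow m t" for m
  proof -
    have "qpow (int p * m) (t / of_nat p) = qpow m t"
      unfolding qpow_def by (rule arg_cong[of _ _ exp]) (use p in simp)
    thus ?thesis using p by simp
  qed
  ultimately have "((\<lambda>m. c (int p * m) * qpow m t) has_sum (inverse (of_nat p) * (\<Sum>j<p. f ((t + 8 * of_nat j) / of_nat p)))) UNIV"
    by (simp only:)
  hence A: "((\<lambda>m. c (int p * m) * qpow m t) has_sum ((\<Sum>j<p. f ((t + 8 * of_nat j) / of_nat p)) / of_nat p)) UNIV"
    unfolding divide_inverse mult.commute[of _ "inverse (of_nat p)"] .
  have "((\<lambda>m. c m * qpow m (of_nat p * t)) has_sum f (of_nat p * t)) UNIV"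
    by (rule qe) (use t p in simp)
  moreover have "c m * qpow m (of_nat p * t) = (\<lambda>n. c (n div int p) * qpow n t) (int p * m)" for m
  proof -
    have "qpow (int p * m) t = qpow m (of_nat p * t)"
      unfolding qpow_def by (rule arg_cong[of _ _ exp]) simp
    thus ?thesis using p by simp
  qed
  ultimately have "((\<lambda>n. if int p dvd n then c (n div int p) * qpow n t else 0) has_sum f (of_nat p * t)) UNIV"
    using has_sum_multiples[of "int p" "\<lambda>n. c (n div int p) * qpow n t"] p by simp
  hence "((\<lambda>n. - (of_nat p ^ 2) * (if int p dvd n then c (n div int p) * qpow n t else 0)) has_sum (- (of_nat p ^ 2) * f (of_nat p * t))) UNIV"
    by (rule has_sum_cmult_right)
  from has_sum_add[OF A this]
  have "((\<lambda>n. c (int p * n) * qpow n t + - (of_nat p ^ 2) * (if int p dvd n then c (n div int p) * qpow n t else 0)) has_sum hecke p f t) UNIV"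
    by (simp add: hecke_def)
  moreover have "c (int p * n) * qpow n t + - (of_nat p ^ 2) * (if int p dvd n then c (n div int p) * qpow n t else 0) =
     (c (int p * n) - of_nat p ^ 2 * (if int p dvd n then c (n div int p) else 0)) * qpow n t" for n
    by (simp add: algebra_simps)
  ultimately show "((\<lambda>n. (c (int p * n) - of_nat p ^ 2 * (if int p dvd n then c (n div int p) else 0)) * qpow n t) has_sum hecke p f t) UNIV"
    by simp
qed

text \<open>Taylor expansion of w in q^4. The second coefficient is recorded because it determines
  one of the unknowns in the recurrence of the constant terms.\<close>

lemma has_qexp_disc:
  assumes w: "w holomorphic_on ball 0 1" and f: "\<And>t. Im t > 0 \<Longrightarrow> f t = qpow r t * w (qpow 4 t)"
  shows "\<exists>c. has_qexp f c \<and> (\<forall>n. c n \<noteq> 0 \<longrightarrow> r \<le> n \<and> 4 dvd n - r) \<and> c r = w 0 \<and> c (r + 4) = deriv w 0"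
proof -
  define u where "u = fps_expansion w 0"
  have u: "w has_fps_expansion u" unfolding u_def
    by (rule has_fps_expansion_fps_expansion[of "ball 0 1"]) (use w in auto)
  have w': "w holomorphic_on eball 0 1" using w by (simp add: one_ereal_def)
  have r: "fps_conv_radius u \<ge> 1" by (rule holomorphic_on_imp_fps_conv_radius_ge[OF u w'])
  have e: "eval_fps u x = w x" if "norm x < 1" for x
    by (rule has_fps_expansion_imp_eval_fps_eq[OF u that w])
  have "has_qexp f (\<lambda>n. if r \<le> n \<and> 4 dvd n - r then fps_nth u (nat ((n - r) div 4)) else 0)"
    by (rule has_qexp_fpsI[OF r]) (use f e norm_qpow_less_1 in auto)
  moreover have "fps_nth u 0 = w 0" using e[of 0] by (simp add: eval_fps_at_0)
  moreover have "fps_nth u 1 = deriv w 0" by (simp add: u_def fps_expansion_def)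
  ultimately show ?thesis
    by (intro exI[of _ "\<lambda>n. if r \<le> n \<and> 4 dvd n - r then fps_nth u (nat ((n - r) div 4)) else 0"]) auto
qed

lemma qpow_shift_2: "qpow r (t + 2) = exp (of_real pi * \<i> * of_int r / 2) * qpow r t"
  unfolding qpow_def exp_add[symmetric] by (rule arg_cong[of _ _ exp]) (simp add: field_simps)

lemma exp_quarter_power_4: "exp (of_real pi * \<i> * of_int r / 2) ^ 4 = 1"
proof -
  have "exp (of_real pi * \<i> * of_int r / 2) ^ 4 = exp (2 * of_int r * of_real pi * \<i>)"
    unfolding exp_of_nat_mult[symmetric] by (rule arg_cong[of _ _ exp]) simp
  also have "\<dots> = 1" by (subst exp_eq_1) (auto intro!: exI[of _ r])
  finally show ?thesis .
qed

lemma qpow_4_plus_2: "qpow 4 (t + 2) = qpow 4 t"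
  using qpow_4_plus_1[of t] qpow_4_plus_1[of "t + 1"] by (simp add: add.assoc)

lemma disc_form_shift_2:
  assumes f: "\<And>t. Im t > 0 \<Longrightarrow> f t = qpow r t * w (qpow 4 t)" and t: "Im t > 0"
  shows "f (t + 2) = exp (of_real pi * \<i> * of_int r / 2) * f t"
proof -
  have "f (t + 2) = qpow r (t + 2) * w (qpow 4 (t + 2))" by (rule f) (use t in simp)
  thus ?thesis unfolding qpow_4_plus_2 f[OF t] by (simp add: qpow_shift_2)
qed

text \<open>The form \<open>g\<^sub>2 L\<^sub>2 ^ k\<close>, its translate by \<open>1\<close>, and its expansions at the other two cusps.\<close>

definition fA where "fA k t = fz1 t ^ 3 * (fz2 t / fz3 t) ^ k"
definition fA' where "fA' k t = fz2 t ^ 3 * (fz1 t / fz3 t) ^ k"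
definition fB where "fB k t = fz3 t ^ 3 * (fz2 t / fz1 t) ^ k"
definition fD where "fD k t = fz2 t ^ 3 * (fz3 t / fz1 t) ^ k"
definition wA where "wA k x = u1 x ^ 3 * (u2 x / u3 x) ^ k"
definition wB where "wB k x = u3 x ^ 3 * (u2 x / u1 x) ^ k"
definition wD where "wD k x = u2 x ^ 3 * (u3 x / u1 x) ^ k"

lemma holomorphic_w [holomorphic_intros]:
  "wA k holomorphic_on ball 0 1" "wB k holomorphic_on ball 0 1" "wD k holomorphic_on ball 0 1"
  unfolding wA_def[abs_def] wB_def[abs_def] wD_def[abs_def] by (auto intro!: holomorphic_intros)

lemma w_nonzero [simp]: "wA k x \<noteq> 0" "wB k x \<noteq> 0" "wD k x \<noteq> 0"
  by (simp_all add: wA_def wB_def wD_def)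

lemma f_nonzero [simp]: "fA k t \<noteq> 0" "fB k t \<noteq> 0" "fD k t \<noteq> 0"
  by (simp_all add: fA_def fB_def fD_def)

lemma log_E_0 [simp]: "log_E 0 = 0"
  by (simp add: log_E_def eval_fps_at_0)

lemma u_0 [simp]: "u0 0 = 1" "u1 0 = 1" "u2 0 = 1" "u3 0 = 1"
  by (simp_all add: u0_def u1_def u2_def u3_def)

lemma w_0 [simp]: "wA k 0 = 1" "wB k 0 = 1" "wD k 0 = 1"
  by (simp_all add: wA_def wB_def wD_def)

lemma quotient_form:
  "(q12 m t * u) ^ 3 * ((q12 n t * v) / (q12 l t * w)) ^ k = q12 (3 * m + int k * (n - l)) t * (u ^ 3 * (v / w) ^ k)"
  by (simp add: power_mult_distrib q12_power q12_add q12_divide[symmetric] power_divide mult_ac right_diff_distrib flip: q12_divide)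

lemma f_disc:
  "fA k t = qpow (1 - int k) t * wA k (qpow 4 t)"
  "fB k t = qpow 4 t * wB k (qpow 4 t)" "fD k t = qpow (1 + int k) t * wD k (qpow 4 t)"
  unfolding fA_def fB_def fD_def fz_eq_u quotient_form wA_def wB_def wD_def
  by (simp_all add: q12_eq_qpow[symmetric] algebra_simps)

text \<open>Each factor has weight 1 up to a constant, so g / h has weight 0 and the cube has weight
  3; the i comes from (-i)^3 = i.\<close>

lemma inv3_quotient:
  fixes f g h F G K :: "complex \<Rightarrow> complex"
  assumes "f (- 1 / t) = - \<i> * t * (a * F t)" "g (- 1 / t) = - \<i> * t * (b * G t)" "h (- 1 / t) = - \<i> * t * (c * K t)" "t \<noteq> 0"
  shows "inv3 (\<lambda>t. f t ^ 3 * (g t / h t) ^ k) t = (\<i> * a ^ 3 * (b / c) ^ k) * (F t ^ 3 * (G t / K t) ^ k)"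
proof -
  have "(- \<i> * t * (b * G t)) / (- \<i> * t * (c * K t)) = (b / c) * (G t / K t)"
    using assms(4) by simp
  moreover have "(- \<i> * t * (a * F t)) ^ 3 = t ^ 3 * (\<i> * a ^ 3 * F t ^ 3)"
  proof -
    have "(- \<i>) ^ 3 = \<i>" by (simp add: power3_eq_cube)
    thus ?thesis by (simp only: power_mult_distrib mult_ac)
  qed
  ultimately have "inv3 (\<lambda>t. f t ^ 3 * (g t / h t) ^ k) t = t ^ 3 * (\<i> * a ^ 3 * F t ^ 3) * ((b / c) * (G t / K t)) ^ k / t ^ 3"
    unfolding inv3_def assms(1-3) by (simp only:)
  thus ?thesis using assms(4) by (simp only: power_mult_distrib) simp
qed

lemma inv3_fA: "\<exists>a. a \<noteq> 0 \<and> (\<forall>t. Im t > 0 \<longrightarrow> inv3 (fA k) t = a * fB k t)"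
proof -
  have "inv3 (fA k) t = (\<i> * 2 ^ 3 * (1 / (1 / 2)) ^ k) * fB k t" if t: "Im t > 0" for t
    unfolding fA_def[abs_def] fB_def by (rule inv3_quotient) (use fz_inversion[OF t] t in auto)
  thus ?thesis by (intro exI[of _ "\<i> * 2 ^ 3 * (1 / (1 / 2)) ^ k"]) simp
qed

lemma inv3_fA': "\<exists>a. a \<noteq> 0 \<and> (\<forall>t. Im t > 0 \<longrightarrow> inv3 (fA' k) t = a * fD k t)"
proof -
  have "inv3 (fA' k) t = (\<i> * 1 ^ 3 * (2 / (1 / 2)) ^ k) * fD k t" if t: "Im t > 0" for t
    unfolding fA'_def[abs_def] fD_def by (rule inv3_quotient) (use fz_inversion[OF t] t in auto)
  thus ?thesis by (intro exI[of _ "\<i> * 1 ^ 3 * (2 / (1 / 2)) ^ k"]) simp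
qed

lemma fA_shift: "\<exists>a. a \<noteq> 0 \<and> (\<forall>t. fA k (t + 1) = a * fA' k t)"
  by (intro exI[of _ "q12 1 1 ^ 3 * (q12 1 1 / q12 4 1) ^ k"])
     (simp add: fA_def fA'_def fz_shift power_mult_distrib power_divide)

lemma inv3_cmult: "inv3 (\<lambda>t. a * f t) t = a * inv3 f t"
  by (simp add: inv3_def)

lemma inv3_cong:
  assumes "Im t > 0" "\<And>t. Im t > 0 \<Longrightarrow> f t = g t"
  shows "inv3 f t = inv3 g t"
  using assms Im_minus_inverse by (simp add: inv3_def)

text \<open>The behaviour at the cusp 1: the translation by 1 exchanges \<open>fz1\<close> and
  \<open>fz2\<close> up to constants, and the inversion then exchanges \<open>fz1\<close> and
  \<open>fz3\<close>.\<close>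

lemma inv3_fA_shift: "\<exists>a. a \<noteq> 0 \<and> (\<forall>t. Im t > 0 \<longrightarrow> inv3 (\<lambda>t. fA k (t + 1)) t = a * fD k t)"
proof -
  obtain a where a: "a \<noteq> 0" "\<And>t. fA k (t + 1) = a * fA' k t" using fA_shift by blast
  obtain b where b: "b \<noteq> 0" "\<And>t. Im t > 0 \<Longrightarrow> inv3 (fA' k) t = b * fD k t" using inv3_fA' by blast
  show ?thesis using a b by (intro exI[of _ "a * b"]) (simp add: inv3_cmult)
qed


lemma shifted_inversion: "inv3 (\<lambda>t. f (t + 1)) t = f (1 - 1 / t) / t ^ 3"
  by (simp add: inv3_def)

lemma has_qexp_fA:
  obtains c where "has_qexp (fA k) c" "\<And>n. c n \<noteq> 0 \<Longrightarrow> 1 - int k \<le> n \<and> 4 dvd n - (1 - int k)" "c (1 - int k) = 1"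
  using has_qexp_disc[OF holomorphic_w(1) f_disc(1)] by fastforce

text \<open>The excess poles at infinity are removed one at a time, and what remains is a bounded invariant
  function.\<close>

lemma form_structure:
  assumes "has_qexp \<psi> c" "\<And>n. c n \<noteq> 0 \<Longrightarrow> 1 - int k - 4 * int M \<le> n \<and> 4 dvd n - (1 - int k)"
    and "has_qexp (inv3 \<psi>) c0" "\<And>n. c0 n \<noteq> 0 \<Longrightarrow> 4 \<le> n \<and> 4 dvd n - 4"
    and "has_qexp (inv3 (\<lambda>t. \<psi> (t + 1))) c1" "\<And>n. c1 n \<noteq> 0 \<Longrightarrow> 1 + int k \<le> n \<and> 4 dvd n - (1 + int k)"
  shows "\<exists>a. \<forall>t. Im t > 0 \<longrightarrow> \<psi> t = (\<Sum>j\<le>M. a j * fA (k + 4 * j) t)"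
  using assms
proof (induction M arbitrary: \<psi> c c0 c1)
  case 0
  define v where "v = eval_fps (Abs_fps (\<lambda>j. c (1 - int k + 4 * int j)))"
  define v0 where "v0 = eval_fps (Abs_fps (\<lambda>j. c0 (4 + 4 * int j)))"
  define v1 where "v1 = eval_fps (Abs_fps (\<lambda>j. c1 (1 + int k + 4 * int j)))"
  have p4: "(0::int) < 4" by simp
  have s: "1 - int k \<le> n \<and> 4 dvd n - (1 - int k)" if "c n \<noteq> 0" for n using 0(2)[OF that] by simp
  have v: "\<psi> t = qpow (1 - int k) t * v (qpow 4 t)" if "Im t > 0" for t
    unfolding v_def by (rule has_qexp_fpsD(2)[OF 0(1) p4 s that])
  have v0: "inv3 \<psi> t = qpow 4 t * v0 (qpow 4 t)" if "Im t > 0" for t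
    unfolding v0_def by (rule has_qexp_fpsD(2)[OF 0(3) p4 0(4) that])
  have v1: "inv3 (\<lambda>t. \<psi> (t + 1)) t = qpow (1 + int k) t * v1 (qpow 4 t)" if "Im t > 0" for t
    unfolding v1_def by (rule has_qexp_fpsD(2)[OF 0(5) p4 0(6) that])
  have hol: "eval_fps u holomorphic_on ball 0 1" if "fps_conv_radius u \<ge> 1" for u :: "complex fps"
    by (rule holomorphic_on_eval_fps, rule ball_eball_mono) (use that in \<open>simp add: one_ereal_def\<close>)
  have hv: "v holomorphic_on ball 0 1" "v0 holomorphic_on ball 0 1" "v1 holomorphic_on ball 0 1"
    unfolding v_def v0_def v1_def
    using hol has_qexp_fpsD(1)[OF 0(1) p4 s] has_qexp_fpsD(1)[OF 0(3) p4 0(4)] has_qexp_fpsD(1)[OF 0(5) p4 0(6)] by blast+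
  obtain a0 where a0: "a0 \<noteq> 0" "\<And>t. Im t > 0 \<Longrightarrow> inv3 (fA k) t = a0 * fB k t" using inv3_fA by blast
  obtain a1 where a1: "a1 \<noteq> 0" "\<And>t. Im t > 0 \<Longrightarrow> inv3 (\<lambda>t. fA k (t + 1)) t = a1 * fD k t" using inv3_fA_shift by blast
  \<comment> \<open>\<open>fA k\<close> has no zeros in the half plane, and its orders 1 - k, 4 and
    1 + k at the three cusps are exactly the lower bounds assumed of \<psi>; hence the quotient
    extends over the centre of each disc.\<close>
  define \<Phi> where "\<Phi> t = \<psi> t / fA k t" for t
  obtain b where b: "\<And>t. Im t > 0 \<Longrightarrow> \<Phi> t = b"
  proof (rule gamma2_invariant_constant)
    show "(\<lambda>x. v x / wA k x) holomorphic_on ball 0 1" "(\<lambda>x. v0 x / (a0 * wB k x)) holomorphic_on ball 0 1"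
      "(\<lambda>x. v1 x / (a1 * wD k x)) holomorphic_on ball 0 1"
      using a0 a1 by (auto intro!: holomorphic_intros hv)
    fix t :: complex assume t: "Im t > 0"
    hence t0: "t \<noteq> 0" by auto
    show "\<Phi> t = v (qpow 4 t) / wA k (qpow 4 t)" by (simp add: \<Phi>_def v[OF t] f_disc)
    have "\<Phi> (- 1 / t) = inv3 \<psi> t / inv3 (fA k) t" using t0 by (simp add: \<Phi>_def inv3_def)
    thus "\<Phi> (- 1 / t) = v0 (qpow 4 t) / (a0 * wB k (qpow 4 t))"
      by (simp add: v0[OF t] a0(2)[OF t] f_disc)
    have "\<Phi> (1 - 1 / t) = inv3 (\<lambda>t. \<psi> (t + 1)) t / inv3 (\<lambda>t. fA k (t + 1)) t"
      using t0 by (simp add: \<Phi>_def shifted_inversion)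
    thus "\<Phi> (1 - 1 / t) = v1 (qpow 4 t) / (a1 * wD k (qpow 4 t))"
      unfolding a1(2)[OF t] v1[OF t] by (simp add: f_disc)
  qed blast
  have "\<psi> t = b * fA k t" if "Im t > 0" for t using b[OF that] by (simp add: \<Phi>_def field_simps)
  thus ?case by (intro exI[of _ "\<lambda>_. b"]) simp
next
  case (Suc M)
  define K where "K = k + 4 * Suc M"
  define N where "N = 1 - int K"
  have K: "int K = int k + 4 + 4 * int M" by (simp add: K_def)
  obtain d where d: "has_qexp (fA K) d" "\<And>n. d n \<noteq> 0 \<Longrightarrow> 1 - int K \<le> n \<and> 4 dvd n - (1 - int K)" "d (1 - int K) = 1"
    by (rule has_qexp_fA[of K]) blast
  obtain d0 where d0: "has_qexp (fB K) d0" "\<And>n. d0 n \<noteq> 0 \<Longrightarrow> 4 \<le> n \<and> 4 dvd n - 4"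
    using has_qexp_disc[OF holomorphic_w(2) f_disc(2)] by blast
  obtain d1 where d1: "has_qexp (fD K) d1" "\<And>n. d1 n \<noteq> 0 \<Longrightarrow> 1 + int K \<le> n \<and> 4 dvd n - (1 + int K)"
    using has_qexp_disc[OF holomorphic_w(3) f_disc(3)] by blast
  obtain a0 where a0: "a0 \<noteq> 0" "\<And>t. Im t > 0 \<Longrightarrow> inv3 (fA K) t = a0 * fB K t" using inv3_fA by blast
  obtain a1 where a1: "a1 \<noteq> 0" "\<And>t. Im t > 0 \<Longrightarrow> inv3 (\<lambda>t. fA K (t + 1)) t = a1 * fD K t" using inv3_fA_shift by blast
  \<comment> \<open>N is the lowest exponent allowed, and \<open>fA K\<close> is monic there.
    Cancelling this term raises the bound by 4, since exponents stay in one class mod 4; the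
    conditions at the other cusps persist because K >= k.\<close>
  define e where "e = - c N"
  define \<psi>' where "\<psi>' t = \<psi> t + e * fA K t" for t
  have "\<exists>a. \<forall>t. Im t > 0 \<longrightarrow> \<psi>' t = (\<Sum>j\<le>M. a j * fA (k + 4 * j) t)"
  proof (rule Suc.IH)
    show "has_qexp \<psi>' (\<lambda>n. c n + e * d n)"
      unfolding \<psi>'_def by (intro has_qexp_add has_qexp_cmult Suc.prems d)
    show "1 - int k - 4 * int M \<le> n \<and> 4 dvd n - (1 - int k)" if "c n + e * d n \<noteq> 0" for n
    proof -
      have "c n \<noteq> 0 \<or> d n \<noteq> 0" using that by auto
      moreover have "N \<le> n \<and> 4 dvd n - (1 - int k)" if "c n \<noteq> 0"
        using Suc.prems(2)[OF that] by (simp add: N_def K)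
      moreover have "N \<le> n \<and> 4 dvd n - (1 - int k)" if "d n \<noteq> 0"
      proof -
        note dn = d(2)[OF that]
        have "4 dvd (n - (1 - int K)) - 4 * (1 + int M)" by (rule dvd_diff[OF conjunct2[OF dn] dvd_triv_left])
        thus ?thesis using dn by (simp add: N_def K algebra_simps)
      qed
      ultimately have n: "N \<le> n" "4 dvd n - (1 - int k)" by blast+
      have "n \<noteq> N" using that d(3) by (auto simp: e_def N_def)
      moreover obtain z where z: "n - (1 - int k) = 4 * z" using n(2) by auto
      ultimately have "4 * (- 1 - int M) \<le> 4 * z" "z \<noteq> - 1 - int M" using n(1) by (auto simp: N_def K)
      hence "- 1 - int M < z" by (simp add: order_less_le)
      hence "- int M \<le> z" by linarith
      thus ?thesis using z n(2) by simp
    qed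
    have "has_qexp (\<lambda>t. inv3 \<psi> t + e * a0 * fB K t) (\<lambda>n. c0 n + e * a0 * d0 n)"
      by (intro has_qexp_add has_qexp_cmult Suc.prems d0)
    thus "has_qexp (inv3 \<psi>') (\<lambda>n. c0 n + e * a0 * d0 n)"
    proof (rule has_qexp_cong)
      fix t :: complex assume "Im t > 0"
      from a0(2)[OF this] show "inv3 \<psi> t + e * a0 * fB K t = inv3 \<psi>' t"
        by (simp add: inv3_def \<psi>'_def add_divide_distrib flip: times_divide_eq_right)
    qed
    show "4 \<le> n \<and> 4 dvd n - 4" if "c0 n + e * a0 * d0 n \<noteq> 0" for n
    proof -
      have "c0 n \<noteq> 0 \<or> d0 n \<noteq> 0" using that by auto
      thus ?thesis using Suc.prems(4) d0(2) by blast
    qed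
    have "has_qexp (\<lambda>t. inv3 (\<lambda>t. \<psi> (t + 1)) t + e * a1 * fD K t) (\<lambda>n. c1 n + e * a1 * d1 n)"
      by (intro has_qexp_add has_qexp_cmult Suc.prems d1)
    thus "has_qexp (inv3 (\<lambda>t. \<psi>' (t + 1))) (\<lambda>n. c1 n + e * a1 * d1 n)"
    proof (rule has_qexp_cong)
      fix t :: complex assume "Im t > 0"
      from a1(2)[OF this] show "inv3 (\<lambda>t. \<psi> (t + 1)) t + e * a1 * fD K t = inv3 (\<lambda>t. \<psi>' (t + 1)) t"
        by (simp add: inv3_def \<psi>'_def add_divide_distrib flip: times_divide_eq_right)
    qed
    show "1 + int k \<le> n \<and> 4 dvd n - (1 + int k)" if "c1 n + e * a1 * d1 n \<noteq> 0" for n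
    proof -
      have "c1 n \<noteq> 0 \<or> d1 n \<noteq> 0" using that by auto
      thus ?thesis
      proof
        assume "d1 n \<noteq> 0"
        hence 1: "1 + int K \<le> n" "4 dvd n - (1 + int K)" using d1(2) by blast+
        have "4 dvd (n - (1 + int K)) + 4 * (1 + int M)" by (rule dvd_add[OF 1(2) dvd_triv_left])
        thus ?thesis using 1(1) by (simp add: K algebra_simps)
      qed (use Suc.prems(6) in blast)
    qed
  qed
  then obtain a where a: "\<And>t. Im t > 0 \<Longrightarrow> \<psi>' t = (\<Sum>j\<le>M. a j * fA (k + 4 * j) t)" by blast
  have "\<psi> t = (\<Sum>j\<le>Suc M. (a(Suc M := - e)) j * fA (k + 4 * j) t)" if "Im t > 0" for t
  proof -
    have "(\<Sum>j\<le>M. (a(Suc M := - e)) j * fA (k + 4 * j) t) = (\<Sum>j\<le>M. a j * fA (k + 4 * j) t)"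
      by (rule sum.cong) auto
    thus ?thesis using a[OF that] by (simp add: \<psi>'_def K_def algebra_simps)
  qed
  thus ?case by blast
qed

section \<open>Stability of the space under T(p)\<close>

lemma hecke_cong:
  assumes "Im t > 0" "p > 0" "\<And>t. Im t > 0 \<Longrightarrow> f t = g t"
  shows "hecke p f t = hecke p g t"
proof -
  have "f ((t + 8 * of_nat j) / of_nat p) = g ((t + 8 * of_nat j) / of_nat p)" for j
    using assms by (intro assms(3)) simp
  moreover have "f (of_nat p * t) = g (of_nat p * t)" using assms by (intro assms(3)) simp
  ultimately show ?thesis by (simp add: hecke_def)
qed

lemma hecke_cmult: "hecke p (\<lambda>t. a * f t) t = a * hecke p f t"
  by (simp add: hecke_def sum_distrib_left algebra_simps)

text \<open>p = -1 mod 4, so multiplying or dividing an exponent by p negates its class mod 4.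
  Positivity of all exponents, that is, vanishing at a cusp, is preserved.\<close>

lemma hecke_support:
  fixes n r :: int
  assumes p: "p mod 4 = 3"
    and nz: "c (int p * n) - of_nat p ^ 2 * (if int p dvd n then c (n div int p) else 0) \<noteq> (0 :: complex)"
    and c: "\<And>n. c n \<noteq> 0 \<Longrightarrow> r \<le> n \<and> 4 dvd n - r"
  shows "4 dvd n + r" "r > 0 \<Longrightarrow> n > 0"
proof -
  have p0: "int p > 0" using p by (cases "p = 0") auto
  have p1: "4 dvd int p + 1"
  proof -
    have "(p + 1) mod 4 = 0" using p by presburger
    hence "4 dvd p + 1" by presburger
    hence "int 4 dvd int (p + 1)" by (simp only: int_dvd_int_iff)
    thus ?thesis by (simp add: add.commute)
  qed
  have "c (int p * n) \<noteq> 0 \<or> int p dvd n \<and> c (n div int p) \<noteq> 0" using nz by (auto split: if_splits)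
  hence "4 dvd n + r \<and> (r > 0 \<longrightarrow> n > 0)"
  proof
    assume "c (int p * n) \<noteq> 0"
    from c[OF this] have 1: "r \<le> int p * n" "4 dvd int p * n - r" by auto
    have "4 dvd (int p + 1) * n - (int p * n - r)" by (intro dvd_diff dvd_mult2 p1 1(2))
    moreover have "(int p + 1) * n - (int p * n - r) = n + r" by (simp add: algebra_simps)
    moreover have "n > 0" if "r > 0"
    proof -
      have "int p * n > 0" using that 1(1) by linarith
      thus ?thesis using p0 by (simp add: zero_less_mult_iff)
    qed
    ultimately show ?thesis by simp
  next
    assume "int p dvd n \<and> c (n div int p) \<noteq> 0"
    then obtain m where m: "n = int p * m" "c m \<noteq> 0" using p0 by auto
    from c[OF m(2)] have 1: "r \<le> m" "4 dvd m - r" by auto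
    have "4 dvd (int p + 1) * m - (m - r)" by (intro dvd_diff dvd_mult2 p1 1(2))
    moreover have "(int p + 1) * m - (m - r) = n + r" by (simp add: m algebra_simps)
    ultimately show ?thesis using 1(1) p0 by (simp add: m)
  qed
  thus "4 dvd n + r" "r > 0 \<Longrightarrow> n > 0" by auto
qed

text \<open>T(p) carries the exponent class 1 - k to k - 1 = 1 - k' mod 4. At the other two cusps
  only positive exponents in the classes of 4 and 1 + k' remain; as k' < 4, these two numbers are
  the least positive members of their classes, which gives the orders that
  \<open>form_structure\<close> asks for.\<close>

lemma hecke_fA:
  assumes p: "prime p" "p mod 4 = 3" and k: "4 dvd k + k' + 2" "k' < 4"
  shows "\<exists>M a. \<forall>t. Im t > 0 \<longrightarrow> hecke p (fA k) t = (\<Sum>j\<le>M. a j * fA (k' + 4 * j) t)"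
proof -
  have p0: "p > 0" using p(1) by (rule prime_gt_0_nat)
  have po: "odd p" using p(2) by presburger
  obtain z where z: "k + k' + 2 = 4 * z" using k(1) by auto
  have z': "int k + int k' + 2 = 4 * int z" using arg_cong[OF z, of int] by simp
  obtain c where c: "has_qexp (fA k) c" "\<And>n. c n \<noteq> 0 \<Longrightarrow> 1 - int k \<le> n \<and> 4 dvd n - (1 - int k)"
    by (rule has_qexp_fA[of k]) blast
  obtain c0 where c0: "has_qexp (fB k) c0" "\<And>n. c0 n \<noteq> 0 \<Longrightarrow> 4 \<le> n \<and> 4 dvd n - 4"
    using has_qexp_disc[OF holomorphic_w(2) f_disc(2)] by blast
  obtain c1 where c1: "has_qexp (fD k) c1" "\<And>n. c1 n \<noteq> 0 \<Longrightarrow> 1 + int k \<le> n \<and> 4 dvd n - (1 + int k)"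
    using has_qexp_disc[OF holomorphic_w(3) f_disc(3)] by blast
  obtain a0 where a0: "a0 \<noteq> 0" "\<And>t. Im t > 0 \<Longrightarrow> inv3 (fA k) t = a0 * fB k t" using inv3_fA by blast
  obtain a1 where a1: "a1 \<noteq> 0" "\<And>t. Im t > 0 \<Longrightarrow> inv3 (\<lambda>t. fA k (t + 1)) t = a1 * fD k t" using inv3_fA_shift by blast
  define \<alpha> where "\<alpha> = exp (of_real pi * \<i> * of_int (1 - int k) / 2)"
  have \<alpha>: "\<alpha> ^ 4 = 1" "\<alpha> \<noteq> 0" unfolding \<alpha>_def by (rule exp_quarter_power_4) simp
  have T: "fA k (t + 2) = \<alpha> * fA k t" if "Im t > 0" for t
    unfolding \<alpha>_def by (rule disc_form_shift_2[OF f_disc(1) that])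
  have T1: "fA k (t + 1 + 2) = \<alpha> * fA k (t + 1)" if "Im t > 0" for t
    by (rule T) (use that in simp)
  have T1': "fA k (t + 2 + 1) = \<alpha> * fA k (t + 1)" if "Im t > 0" for t
    using T1[OF that] by (simp add: add_ac)
  have T8: "fA k (t + 8) = fA k t" if t: "Im t > 0" for t
  proof -
    have "fA k (t + 8) = \<alpha> * (\<alpha> * (\<alpha> * (\<alpha> * fA k t)))"
      using T[of t] T[of "t + 2"] T[of "t + 4"] T[of "t + 6"] t by (simp add: add.assoc)
    also have "\<dots> = \<alpha> ^ 4 * fA k t" by (simp add: power4_eq_xxxx mult_ac)
    finally show ?thesis using \<alpha> by simp
  qed
  define \<beta> where "\<beta> r = exp (of_real pi * \<i> * of_int r / 2)" for r
  have \<beta>: "\<beta> r ^ 4 = 1" for r unfolding \<beta>_def by (rule exp_quarter_power_4)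
  have S: "inv3 (fA k) (t + 2) = \<beta> 4 * inv3 (fA k) t" if t: "Im t > 0" for t
    using a0(2)[of t] a0(2)[of "t + 2"] disc_form_shift_2[of "fB k" 4 "wB k", OF f_disc(2) t] t by (simp add: \<beta>_def)
  have S1: "inv3 (\<lambda>t. fA k (t + 1)) (t + 2) = \<beta> (1 + int k) * inv3 (\<lambda>t. fA k (t + 1)) t" if t: "Im t > 0" for t
    using a1(2)[of t] a1(2)[of "t + 2"] disc_form_shift_2[of "fD k" "1 + int k" "wD k", OF f_disc(3) t] t by (simp add: \<beta>_def)
  define e where "e c n = c (int p * n) - of_nat p ^ 2 * (if int p dvd n then c (n div int p) else 0)" for c :: "int \<Rightarrow> complex" and n
  have eh: "has_qexp (hecke p f) (e c)" if "has_qexp f c" for f c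
    using has_qexp_hecke[OF that p0] unfolding e_def[abs_def] .
  obtain N where N: "\<And>n. e c n \<noteq> 0 \<Longrightarrow> N \<le> n" using has_qexp_lower[OF eh[OF c(1)]] by blast
  define b where "b = - a0"
  define b1 where "b1 = - (\<alpha> ^ ((p - 1) div 2) * a1)"
  have b: "b \<noteq> 0" "b1 \<noteq> 0" using a0 a1 \<alpha> by (simp_all add: b_def b1_def)
  have "\<exists>a. \<forall>t. Im t > 0 \<longrightarrow> hecke p (fA k) t = (\<Sum>j\<le>nat \<bar>N\<bar> + 1. a j * fA (k' + 4 * j) t)"
  proof (rule form_structure)
    show "has_qexp (hecke p (fA k)) (e c)" by (rule eh[OF c(1)])
    show "1 - int k' - 4 * int (nat \<bar>N\<bar> + 1) \<le> n \<and> 4 dvd n - (1 - int k')" if nz: "e c n \<noteq> 0" for n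
    proof
      show "1 - int k' - 4 * int (nat \<bar>N\<bar> + 1) \<le> n" using N[OF nz] by simp
      have "4 dvd n + (1 - int k)" by (rule hecke_support(1)[OF p(2) nz[unfolded e_def] c(2)])
      hence "4 dvd (n + (1 - int k)) + 4 * (int z - 1)" by (rule dvd_add[OF _ dvd_triv_left]) 
      moreover have "(n + (1 - int k)) + 4 * (int z - 1) = n - (1 - int k')" using z' by simp
      ultimately show "4 dvd n - (1 - int k')" by (simp only:)
    qed
    have "has_qexp (\<lambda>t. b * hecke p (fB k) t) (\<lambda>n. b * e c0 n)" by (intro has_qexp_cmult eh c0)
    thus "has_qexp (inv3 (hecke p (fA k))) (\<lambda>n. b * e c0 n)"
    proof (rule has_qexp_cong)
      fix t :: complex assume t: "Im t > 0"
      have "inv3 (hecke p (fA k)) t = - hecke p (inv3 (fA k)) t"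
        by (rule hecke_inv3[of "fA k", OF T \<alpha>(1) S \<beta> p t])
      also have "hecke p (inv3 (fA k)) t = hecke p (\<lambda>t. a0 * fB k t) t" by (rule hecke_cong[OF t p0 a0(2)])
      finally show "b * hecke p (fB k) t = inv3 (hecke p (fA k)) t" by (simp add: hecke_cmult b_def)
    qed
    show "4 \<le> n \<and> 4 dvd n - 4" if "b * e c0 n \<noteq> 0" for n
    proof -
      have nz: "e c0 n \<noteq> 0" using that by auto
      have "4 dvd n + 4" by (rule hecke_support(1)[OF p(2) nz[unfolded e_def] c0(2)])
      moreover have "n > 0" by (rule hecke_support(2)[OF p(2) nz[unfolded e_def] c0(2) zero_less_numeral])
      ultimately show ?thesis by (auto dest: zdvd_imp_le)
    qed
    have "has_qexp (\<lambda>t. b1 * hecke p (fD k) t) (\<lambda>n. b1 * e c1 n)" by (intro has_qexp_cmult eh c1)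
    thus "has_qexp (inv3 (\<lambda>t. hecke p (fA k) (t + 1))) (\<lambda>n. b1 * e c1 n)"
    proof (rule has_qexp_cong)
      fix t :: complex assume t: "Im t > 0"
      have "inv3 (\<lambda>t. hecke p (fA k) (t + 1)) t = inv3 (\<lambda>t. \<alpha> ^ ((p - 1) div 2) * hecke p (\<lambda>t. fA k (t + 1)) t) t"
        by (rule inv3_cong[OF t]) (rule hecke_shift[of "fA k", OF T8 T1 \<alpha>(2) po])
      also have "\<dots> = \<alpha> ^ ((p - 1) div 2) * inv3 (hecke p (\<lambda>t. fA k (t + 1))) t" by (simp only: inv3_cmult)
      also have "inv3 (hecke p (\<lambda>t. fA k (t + 1))) t = - hecke p (inv3 (\<lambda>t. fA k (t + 1))) t"
        by (rule hecke_inv3[of "\<lambda>t. fA k (t + 1)", OF T1' \<alpha>(1) S1 \<beta> p t])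
      also have "hecke p (inv3 (\<lambda>t. fA k (t + 1))) t = hecke p (\<lambda>t. a1 * fD k t) t" by (rule hecke_cong[OF t p0 a1(2)])
      finally show "b1 * hecke p (fD k) t = inv3 (\<lambda>t. hecke p (fA k) (t + 1)) t" by (simp add: hecke_cmult b1_def)
    qed
    show "1 + int k' \<le> n \<and> 4 dvd n - (1 + int k')" if "b1 * e c1 n \<noteq> 0" for n
    proof -
      have nz: "e c1 n \<noteq> 0" using that by auto
      have "4 dvd n + (1 + int k)" by (rule hecke_support(1)[OF p(2) nz[unfolded e_def] c1(2)])
      then obtain y where "n + (1 + int k) = 4 * y" by auto
      hence y: "n = 1 + int k' + 4 * (y - int z)" using z' by simp
      have "n > 0" by (rule hecke_support(2)[OF p(2) nz[unfolded e_def] c1(2)]) simp_all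
      hence "4 * (y - int z) > - 4" using y k(2) by linarith
      hence "y - int z \<ge> 0" by simp
      thus ?thesis using y by simp
    qed
  qed
  thus ?thesis by blast
qed

section \<open>Bol's identity and a relation between constant terms\<close>

text \<open>The derivative of t h(-1/t) is h + h'/t evaluated at -1/t; in the second derivative the
  two terms with h' cancel and h''/t^3 is left.\<close>

lemma bol:
  assumes h: "\<And>t. Im t > 0 \<Longrightarrow> (h has_field_derivative h' t) (at t)" "\<And>t. Im t > 0 \<Longrightarrow> (h' has_field_derivative h'' t) (at t)"
    and g: "\<And>t. Im t > 0 \<Longrightarrow> (g has_field_derivative g' t) (at t)" "\<And>t. Im t > 0 \<Longrightarrow> (g' has_field_derivative g'' t) (at t)"
    and hg: "\<And>t. Im t > 0 \<Longrightarrow> t * h (- 1 / t) = g t" and t: "Im t > 0"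
  shows "inv3 h'' t = g'' t"
proof -
  have ev: "eventually (\<lambda>t. Im t > 0) (nhds t)" if "Im t > 0" for t
    using eventually_nhds_in_open[OF open_halfspace_Im_gt[of 0], of t] that by simp
  have i: "((\<lambda>t. - 1 / t) has_field_derivative 1 / t\<^sup>2) (at t)" if "Im t > 0" for t
    using that by (auto intro!: derivative_eq_intros simp: power2_eq_square)
  have g': "g' t = h (- 1 / t) + h' (- 1 / t) / t" if t: "Im t > 0" for t
  proof -
    have t0: "t \<noteq> 0" using t by auto
    have "((\<lambda>t. h (- 1 / t)) has_field_derivative h' (- 1 / t) * (1 / t\<^sup>2)) (at t)"
      by (rule DERIV_chain2[of h _ "\<lambda>t. - 1 / t", OF h(1)[OF Im_minus_inverse[OF t]] i[OF t]])
    from DERIV_mult[OF DERIV_ident this]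
    have "((\<lambda>t. t * h (- 1 / t)) has_field_derivative h (- 1 / t) + h' (- 1 / t) / t) (at t)"
      using t0 by (simp add: power2_eq_square algebra_simps)
    moreover have "((\<lambda>t. t * h (- 1 / t)) has_field_derivative g' t) (at t)"
      by (subst DERIV_cong_ev[OF refl eventually_mono[OF ev[OF t] hg] refl]) (use g(1)[OF t] in auto)
    ultimately show ?thesis by (metis DERIV_unique)
  qed
  have t0: "t \<noteq> 0" using t by auto
  have 1: "((\<lambda>t. h (- 1 / t)) has_field_derivative h' (- 1 / t) * (1 / t\<^sup>2)) (at t)"
    by (rule DERIV_chain2[of h _ "\<lambda>t. - 1 / t", OF h(1)[OF Im_minus_inverse[OF t]] i[OF t]])
  have 2: "((\<lambda>t. h' (- 1 / t)) has_field_derivative h'' (- 1 / t) * (1 / t\<^sup>2)) (at t)"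
    by (rule DERIV_chain2[of h' _ "\<lambda>t. - 1 / t", OF h(2)[OF Im_minus_inverse[OF t]] i[OF t]])
  from DERIV_add[OF 1 DERIV_divide[OF 2 DERIV_ident t0]]
  have "((\<lambda>t. h (- 1 / t) + h' (- 1 / t) / t) has_field_derivative h'' (- 1 / t) / t ^ 3) (at t)"
    by (rule DERIV_cong) (use t0 in \<open>simp add: field_simps power2_eq_square power3_eq_cube\<close>)
  moreover have "((\<lambda>t. h (- 1 / t) + h' (- 1 / t) / t) has_field_derivative g'' t) (at t)"
    by (subst DERIV_cong_ev[OF refl eventually_mono[OF ev[OF t] g'[symmetric]] refl]) (use g(2)[OF t] in auto)
  ultimately show ?thesis unfolding inv3_def by (rule DERIV_unique)
qed

lemma has_qexp_second_deriv:
  assumes "has_qexp f c"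
  obtains f' f'' where "\<And>t. Im t > 0 \<Longrightarrow> (f has_field_derivative f' t) (at t)"
    "\<And>t. Im t > 0 \<Longrightarrow> (f' has_field_derivative f'' t) (at t)"
    "has_qexp f'' (\<lambda>n. (of_real pi * \<i> / 4) ^ 2 * of_int n ^ 2 * c n)"
proof -
  obtain f' where f': "\<And>t. Im t > 0 \<Longrightarrow> (f has_field_derivative f' t) (at t)"
    "has_qexp f' (\<lambda>n. of_real pi * \<i> * of_int n / 4 * c n)"
    using has_qexp_deriv[OF assms] by blast
  obtain f'' where f'': "\<And>t. Im t > 0 \<Longrightarrow> (f' has_field_derivative f'' t) (at t)"
    "has_qexp f'' (\<lambda>n. of_real pi * \<i> * of_int n / 4 * (of_real pi * \<i> * of_int n / 4 * c n))"
    using has_qexp_deriv[OF f'(2)] by blast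
  have "(\<lambda>n. of_real pi * \<i> * of_int n / 4 * (of_real pi * \<i> * of_int n / 4 * c n)) = (\<lambda>n. (of_real pi * \<i> / 4) ^ 2 * of_int n ^ 2 * c n)"
    by (simp add: fun_eq_iff power2_eq_square)
  note eq = this
  show ?thesis by (rule that[OF f'(1) f''(1) f''(2)[unfolded eq]])
qed

lemma u_deriv_0:
  "(u0 has_field_derivative 0) (at 0)" "(u1 has_field_derivative - 2) (at 0)"
  "(u2 has_field_derivative 2) (at 0)" "(u3 has_field_derivative 0) (at 0)"
proof -
  have "0 < fps_conv_radius log_euler" using fps_conv_radius_log_euler by (rule less_le_trans[rotated]) simp
  hence "ereal (norm (0::complex)) < fps_conv_radius log_euler" by (simp add: zero_ereal_def)
  from has_field_derivative_eval_fps[OF this, of UNIV]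
  have l: "(log_E has_field_derivative - 1) (at 0)"
    by (simp add: log_E_def eval_fps_at_0 log_euler_nth)
  have c: "((\<lambda>x. exp (2 * log_E (f x))) has_field_derivative 2 * (- 1 * d)) (at 0)"
    if "(f has_field_derivative d) (at 0)" "f 0 = 0" for f d
    using DERIV_chain2[of log_E "- 1" f 0 d UNIV] l that by (auto intro!: derivative_eq_intros)
  have "((\<lambda>x::complex. x\<^sup>2) has_field_derivative 0) (at 0)" "((\<lambda>x::complex. x) has_field_derivative 1) (at 0)"
    "((\<lambda>x::complex. - x) has_field_derivative - 1) (at 0)" "((\<lambda>x::complex. x ^ 4) has_field_derivative 0) (at 0)"
    by (auto intro!: derivative_eq_intros)
  from c[OF this(1)] c[OF this(2)] c[OF this(3)] c[OF this(4)]
  show "(u0 has_field_derivative 0) (at 0)" "(u1 has_field_derivative - 2) (at 0)"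
    "(u2 has_field_derivative 2) (at 0)" "(u3 has_field_derivative 0) (at 0)"
    unfolding u0_def[abs_def] u1_def[abs_def] u2_def[abs_def] u3_def[abs_def] by simp_all
qed

lemma weight_minus_one_quotient:
  "(q12 m t * u) ^ i * (q12 2 t * v) / (q12 l t * w) ^ n = q12 (m * int i + 2 - l * int n) t * (u ^ i * v / w ^ n)"
proof -
  have "q12 (m * int i + 2 - l * int n) t = q12 (m * int i) t * q12 2 t / q12 (l * int n) t"
    by (simp only: q12_divide q12_add[symmetric])
  thus ?thesis by (simp add: power_mult_distrib q12_power)
qed

lemma weight_minus_one_inversion:
  assumes "f (- 1 / t) = - \<i> * t * (a * F t)" "g (- 1 / t) = - \<i> * t * G t" "h (- 1 / t) = - \<i> * t * (c * K t)" "t \<noteq> 0"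
  shows "t * (f (- 1 / t) ^ i * g (- 1 / t) / h (- 1 / t) ^ (i + 2)) = (\<i> * a ^ i / c ^ (i + 2)) * (F t ^ i * G t / K t ^ (i + 2))"
proof -
  define s where "s = - \<i> * t"
  have s: "s \<noteq> 0" "t = \<i> * s" using assms(4) by (simp_all add: s_def)
  have "t * (f (- 1 / t) ^ i * g (- 1 / t) / h (- 1 / t) ^ (i + 2)) = \<i> * s * ((s * (a * F t)) ^ i * (s * G t) / (s * (c * K t)) ^ (i + 2))"
    unfolding assms(1-3) s_def[symmetric] using s(2) by simp
  also have "\<dots> = (\<i> * a ^ i / c ^ (i + 2)) * (F t ^ i * G t / K t ^ (i + 2))"
    using s(1) by (simp add: power_mult_distrib mult_ac)
  finally show ?thesis .
qed

text \<open>Bol's identity: \<open>D\<^sup>2\<close> maps weight \<open>-1\<close> to weight \<open>3\<close>.  Applied to \<open>L\<^sub>2 ^ n\<close> times the eta quotient \<open>fz0 / fz2\<^sup>2\<close>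
  of weight \<open>-1\<close> it gives a two-term relation, whose constant term is the recurrence of the squared
  central binomial coefficients.\<close>

lemma constant_term_recurrence:
  fixes n :: nat
  assumes n: "4 dvd n" "n > 0"
    and c: "has_qexp (fA (n + 1)) c" and d: "has_qexp (fA (n - 3)) d"
  shows "of_nat n ^ 2 * c 0 = 16 * (of_nat n - 2) ^ 2 * d 0"
proof -
  define i where "i = n - 2"
  have n4: "n \<ge> 4" using n by (auto dest: dvd_imp_le)
  have ni: "n = i + 2" "int i = int n - 2" using n4 by (simp_all add: i_def)
  define \<kappa> where "\<kappa> = (of_real pi * \<i> / 4 :: complex) ^ 2"
  have \<kappa>: "\<kappa> \<noteq> 0" by (simp add: \<kappa>_def)
  \<comment> \<open>This is (fz2 / fz3)^n times fz0 / fz2^2, whence the exponent i = n - 2;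
    \<open>gB\<close> and \<open>gD\<close> are, up to constants, its transforms at the cusps 0 and
    1.\<close>
  define h where "h t = fz2 t ^ i * fz0 t / fz3 t ^ n" for t
  define gB where "gB t = fz2 t ^ i * fz0 t / fz1 t ^ n" for t
  define gD where "gD t = fz3 t ^ i * fz0 t / fz1 t ^ n" for t
  define wh where "wh x = u2 x ^ i * u0 x / u3 x ^ n" for x
  define wB where "wB x = u2 x ^ i * u0 x / u1 x ^ n" for x
  define wD where "wD x = u3 x ^ i * u0 x / u1 x ^ n" for x
  have disc: "h t = qpow (- int n) t * wh (qpow 4 t)" "gB t = qpow 0 t * wB (qpow 4 t)" "gD t = qpow (int n - 2) t * wD (qpow 4 t)" for t
    unfolding h_def gB_def gD_def fz_eq_u weight_minus_one_quotient wh_def wB_def wD_def q12_eq_qpow[symmetric] ni(2)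
    by (simp_all add: algebra_simps)
  have hol: "wh holomorphic_on ball 0 1" "wB holomorphic_on ball 0 1" "wD holomorphic_on ball 0 1"
    unfolding wh_def[abs_def] wB_def[abs_def] wD_def[abs_def] by (auto intro!: holomorphic_intros)
  obtain ch where ch: "has_qexp h ch" "\<And>m. ch m \<noteq> 0 \<Longrightarrow> - int n \<le> m \<and> 4 dvd m - (- int n)" "ch (- int n) = wh 0"
    "ch (- int n + 4) = deriv wh 0"
    using has_qexp_disc[OF hol(1) disc(1)] by blast
  obtain cB where cB: "has_qexp gB cB" "\<And>m. cB m \<noteq> 0 \<Longrightarrow> 0 \<le> m \<and> 4 dvd m - 0"
    using has_qexp_disc[OF hol(2) disc(2)] by blast
  obtain cD where cD: "has_qexp gD cD" "\<And>m. cD m \<noteq> 0 \<Longrightarrow> int n - 2 \<le> m \<and> 4 dvd m - (int n - 2)"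
    using has_qexp_disc[OF hol(3) disc(3)] by blast
  define aB where "aB = \<i> * 1 ^ i / (1 / 2) ^ (i + 2)"
  have SB: "t * h (- 1 / t) = aB * gB t" if t: "Im t > 0" for t
    unfolding h_def gB_def ni(1) aB_def by (rule weight_minus_one_inversion) (use fz_inversion[OF t] t in auto)
  define s where "s = q12 1 1 ^ i * q12 2 1 / q12 4 1 ^ n"
  have h1: "h (t + 1) = s * (fz1 t ^ i * fz0 t / fz3 t ^ n)" for t
    by (simp add: h_def fz_shift power_mult_distrib s_def)
  define aD where "aD = s * (\<i> * 2 ^ i / (1 / 2) ^ (i + 2))"
  have SD: "t * h (- 1 / t + 1) = aD * gD t" if t: "Im t > 0" for t
  proof -
    have "t * (fz1 (- 1 / t) ^ i * fz0 (- 1 / t) / fz3 (- 1 / t) ^ (i + 2)) = (\<i> * 2 ^ i / (1 / 2) ^ (i + 2)) * (fz3 t ^ i * fz0 t / fz1 t ^ (i + 2))"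
      by (rule weight_minus_one_inversion) (use fz_inversion[OF t] t in auto)
    note e = this
    have "t * h (- 1 / t + 1) = s * (t * (fz1 (- 1 / t) ^ i * fz0 (- 1 / t) / fz3 (- 1 / t) ^ (i + 2)))"
      unfolding h1 ni(1) by (simp only: mult.left_commute)
    thus ?thesis unfolding e gD_def ni(1) aD_def by (simp only: mult.assoc)
  qed
  obtain h' h'' where hd: "\<And>t. Im t > 0 \<Longrightarrow> (h has_field_derivative h' t) (at t)" "\<And>t. Im t > 0 \<Longrightarrow> (h' has_field_derivative h'' t) (at t)"
    "has_qexp h'' (\<lambda>m. \<kappa> * of_int m ^ 2 * ch m)"
    by (rule has_qexp_second_deriv[OF ch(1)]) (auto simp: \<kappa>_def)
  obtain B' B'' where Bd: "\<And>t. Im t > 0 \<Longrightarrow> ((\<lambda>t. aB * gB t) has_field_derivative B' t) (at t)" "\<And>t. Im t > 0 \<Longrightarrow> (B' has_field_derivative B'' t) (at t)"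
    "has_qexp B'' (\<lambda>m. \<kappa> * of_int m ^ 2 * (aB * cB m))"
    by (rule has_qexp_second_deriv[OF has_qexp_cmult[OF cB(1), of aB]]) (auto simp: \<kappa>_def)
  obtain D' D'' where Dd: "\<And>t. Im t > 0 \<Longrightarrow> ((\<lambda>t. aD * gD t) has_field_derivative D' t) (at t)" "\<And>t. Im t > 0 \<Longrightarrow> (D' has_field_derivative D'' t) (at t)"
    "has_qexp D'' (\<lambda>m. \<kappa> * of_int m ^ 2 * (aD * cD m))"
    by (rule has_qexp_second_deriv[OF has_qexp_cmult[OF cD(1), of aD]]) (auto simp: \<kappa>_def)
  have iB: "inv3 h'' t = B'' t" if "Im t > 0" for t
    by (rule bol[OF hd(1,2) Bd(1,2) SB that])
  have iD: "inv3 (\<lambda>t. h'' (t + 1)) t = D'' t" if "Im t > 0" for t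
  proof (rule bol[OF _ _ Dd(1,2) SD that])
    fix t :: complex assume "Im t > 0"
    hence t1: "Im (t + 1) > 0" by simp
    show "((\<lambda>t. h (t + 1)) has_field_derivative h' (t + 1)) (at t)"
      using hd(1)[OF t1] by (simp add: DERIV_shift)
    show "((\<lambda>t. h' (t + 1)) has_field_derivative h'' (t + 1)) (at t)"
      using hd(2)[OF t1] by (simp add: DERIV_shift)
  qed
  have k: "int (n - 3) = int n - 3" using n4 by simp
  \<comment> \<open>The orders of h'' are at least -n, 4 and n - 2, those allowed for k = n - 3 and
    M = 1. At the cusp 0 the expansion of \<open>gB\<close> begins with a constant, but the factor
    m^2 of the second derivative removes it.\<close>
  have "\<exists>a. \<forall>t. Im t > 0 \<longrightarrow> h'' t = (\<Sum>j\<le>1. a j * fA (n - 3 + 4 * j) t)"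
  proof (rule form_structure)
    show "has_qexp h'' (\<lambda>m. \<kappa> * of_int m ^ 2 * ch m)" by (rule hd(3))
    show "1 - int (n - 3) - 4 * int 1 \<le> m \<and> 4 dvd m - (1 - int (n - 3))" if "\<kappa> * of_int m ^ 2 * ch m \<noteq> 0" for m
    proof -
      have m: "- int n \<le> m" "4 dvd m + int n" using that ch(2)[of m] by auto
      have "4 dvd (m + int n) - 4" using m(2) by simp
      thus ?thesis using m(1) unfolding k by (simp add: algebra_simps)
    qed
    show "has_qexp (inv3 h'') (\<lambda>m. \<kappa> * of_int m ^ 2 * (aB * cB m))" by (rule has_qexp_cong[OF Bd(3) iB[symmetric]])
    show "4 \<le> m \<and> 4 dvd m - 4" if "\<kappa> * of_int m ^ 2 * (aB * cB m) \<noteq> 0" for m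
    proof -
      have "m \<noteq> 0" "0 \<le> m" "4 dvd m" using that cB(2)[of m] by auto
      thus ?thesis by (auto dest: zdvd_imp_le)
    qed
    show "has_qexp (inv3 (\<lambda>t. h'' (t + 1))) (\<lambda>m. \<kappa> * of_int m ^ 2 * (aD * cD m))" by (rule has_qexp_cong[OF Dd(3) iD[symmetric]])
    show "1 + int (n - 3) \<le> m \<and> 4 dvd m - (1 + int (n - 3))" if "\<kappa> * of_int m ^ 2 * (aD * cD m) \<noteq> 0" for m
      using that cD(2)[of m] unfolding k by (auto simp: algebra_simps)
  qed
  then obtain a where a: "\<And>t. Im t > 0 \<Longrightarrow> h'' t = (\<Sum>j\<le>1. a j * fA (n - 3 + 4 * j) t)" by blast
  have n1: "n - 3 + 4 * 1 = n + 1" using n4 by simp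
  have "h'' t = a 0 * fA (n - 3) t + a 1 * fA (n + 1) t" if "Im t > 0" for t
    using a[OF that] n1 by simp
  hence "has_qexp h'' (\<lambda>m. a 0 * d m + a 1 * c m)"
    by (intro has_qexp_cong[OF has_qexp_add[OF has_qexp_cmult[OF d] has_qexp_cmult[OF c]]]) auto
  from has_qexp_unique[OF hd(3) this] have eq: "\<kappa> * of_int m ^ 2 * ch m = a 0 * d m + a 1 * c m" for m
    by (simp add: fun_eq_iff)
  obtain d' where d': "has_qexp (fA (n - 3)) d'" "\<And>m. d' m \<noteq> 0 \<Longrightarrow> 1 - int (n - 3) \<le> m \<and> 4 dvd m - (1 - int (n - 3))" "d' (1 - int (n - 3)) = 1"
    by (rule has_qexp_fA[of "n - 3"]) blast
  have d'd: "d' = d" by (rule has_qexp_unique[OF d'(1) d])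
  obtain c' where c': "has_qexp (fA (n + 1)) c'" "c' (1 - int (n + 1)) = wA (n + 1) 0" "c' (1 - int (n + 1) + 4) = deriv (wA (n + 1)) 0"
    using has_qexp_disc[OF holomorphic_w(1) f_disc(1)] by blast
  have c'c: "c' = c" by (rule has_qexp_unique[OF c'(1) c])
  have vals: "d (- int n) = 0" "d (4 - int n) = 1" "c (- int n) = 1" "ch (- int n) = 1"
    using d'(2)[of "- int n"] d'(3) c'(2) ch(3) unfolding d'd c'c k by (auto simp: wh_def)
  have "(wh has_field_derivative 2 * (of_nat n - 2)) (at 0)"
    unfolding wh_def[abs_def] using n4
    by (auto intro!: derivative_eq_intros u_deriv_0 simp: ni(1))
  hence ch4: "ch (4 - int n) = 2 * (of_nat n - 2)" using ch(4) by (simp add: DERIV_imp_deriv)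
  have "(wA (n + 1) has_field_derivative 2 * (of_nat n - 2)) (at 0)"
    unfolding wA_def[abs_def]
    by (auto intro!: derivative_eq_intros u_deriv_0 simp: algebra_simps)
  hence c4: "c (4 - int n) = 2 * (of_nat n - 2)" using c'(3) unfolding c'c by (simp add: DERIV_imp_deriv)
  \<comment> \<open>The exponents -n and 4 - n determine a 1 and a 0. Exponent 0, where m^2
    vanishes, then yields the relation between the constant terms.\<close>
  have a1: "a 1 = \<kappa> * of_nat n ^ 2" using eq[of "- int n"] vals by simp
  have "a 0 = \<kappa> * (of_int (4 - int n) ^ 2 - of_nat n ^ 2) * (2 * (of_nat n - 2))"
    using eq[of "4 - int n"] unfolding vals ch4 c4 a1 by (simp add: algebra_simps)
  also have "\<dots> = - \<kappa> * (16 * (of_nat n - 2) ^ 2)" by (simp add: algebra_simps power2_eq_square)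
  finally have a0: "a 0 = - \<kappa> * (16 * (of_nat n - 2) ^ 2)" .
  have "\<kappa> * (of_nat n ^ 2 * c 0) - \<kappa> * (16 * (of_nat n - 2) ^ 2 * d 0) = a 0 * d 0 + a 1 * c 0"
    unfolding a0 a1 by (simp only: mult_minus_left mult.assoc add_uminus_conv_diff[symmetric] add.commute)
  also have "\<dots> = 0" using eq[of 0] by simp
  finally have "\<kappa> * (of_nat n ^ 2 * c 0) = \<kappa> * (16 * (of_nat n - 2) ^ 2 * d 0)" by (simp only: right_minus_eq)
  thus ?thesis by (rule mult_left_cancel[OF \<kappa>, THEN iffD1])
qed

section \<open>Rational expansions\<close>

text \<open>In characteristic 0 a power series is determined by its constant term and its
  logarithmic derivative; s lists the coefficients of the latter up to sign.\<close>

lemma fps_log_deriv_recursion_unique: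
  fixes F G :: "'a :: field_char_0 fps"
  assumes F: "\<And>k. of_nat k * fps_nth F k = - (\<Sum>i=1..k. s i * fps_nth F (k - i))"
    and G: "\<And>k. of_nat k * fps_nth G k = - (\<Sum>i=1..k. s i * fps_nth G (k - i))"
    and "fps_nth F 0 = fps_nth G 0"
  shows "F = G"
proof -
  have "fps_nth F k = fps_nth G k" for k
  proof (induction k rule: less_induct)
    case (less k)
    show ?case
    proof (cases "k = 0")
      case False
      have "(\<Sum>i=1..k. s i * fps_nth F (k - i)) = (\<Sum>i=1..k. s i * fps_nth G (k - i))"
        by (rule sum.cong) (use less False in auto)
      hence "of_nat k * fps_nth F k = of_nat k * fps_nth G k" unfolding F G by simp
      thus ?thesis using False by simp
    qed (use assms in auto)
  qed
  thus ?thesis by (simp add: fps_eq_iff)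
qed

text \<open>The coefficient of q^k in minus q d/dq of the logarithm of the product of the 1 - q^(a
  n).\<close>

definition divsum_scaled :: "nat \<Rightarrow> nat \<Rightarrow> nat" where
  "divsum_scaled a k = (if a dvd k then a * divsum (k div a) else 0)"

lemma divsum_scaled_eq:
  assumes "a > 0" "k > 0" "k \<le> N"
  shows "divsum_scaled a k = (\<Sum>n\<in>{1..N}. if a * n dvd k then a * n else 0)"
proof (cases "a dvd k")
  case True
  then obtain m where m: "k = a * m" by auto
  have m0: "m > 0" "m \<le> N" using assms m by (auto intro: order_trans[rotated])
  have "(\<Sum>n\<in>{1..N}. if a * n dvd k then a * n else 0) = (\<Sum>n\<in>{n\<in>{1..N}. n dvd m}. a * n)"
    unfolding m by (subst sum.inter_filter) (use assms in auto)
  also have "{n\<in>{1..N}. n dvd m} = {n. n dvd m}"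
    using m0 by (auto dest: dvd_imp_le intro: Suc_leI dvd_pos_nat)
  finally show ?thesis using assms by (simp add: divsum_scaled_def divsum_def m sum_distrib_left)
next
  case False
  hence "\<not> a * n dvd k" for n by (metis dvd_mult_left)
  thus ?thesis using False by (simp add: divsum_scaled_def)
qed

lemma euler_prod_finite_log_deriv:
  fixes a :: nat
  assumes a: "a > 0"
  defines "P \<equiv> \<lambda>N. \<Prod>n\<in>{1..N}. (1 - fps_X ^ (a * n) :: rat fps)"
  shows "fps_X * fps_deriv (P N) = - (Abs_fps (\<lambda>k. if k = 0 then 0 else of_nat (\<Sum>n\<in>{1..N}. if a * n dvd k then a * n else 0))) * P N"
proof (induction N)
  case 0
  have "Abs_fps (\<lambda>k. if k = 0 then 0 else of_nat (\<Sum>n\<in>{1..0::nat}. if a * n dvd k then a * n else 0)) = (0 :: rat fps)"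
    by (simp add: fps_eq_iff)
  thus ?case by (simp add: P_def)
next
  case (Suc N)
  define m where "m = a * Suc N"
  have m: "m > 0" using a by (simp add: m_def)
  \<comment> \<open>The series m q^m / (1 - q^m), the share of the new factor; index 0 is excluded
    by hand because m divides 0.\<close>
  define T :: "rat fps" where "T = Abs_fps (\<lambda>k. if k \<noteq> 0 \<and> m dvd k then of_nat m else 0)"
  define G :: "nat \<Rightarrow> rat fps" where "G N = Abs_fps (\<lambda>k. if k = 0 then 0 else of_nat (\<Sum>n\<in>{1..N}. if a * n dvd k then a * n else 0))" for N
  have G: "G (Suc N) = G N + T"
    by (auto simp: G_def T_def fps_eq_iff m_def)
  have T: "T * (1 - fps_X ^ m) = of_nat m * fps_X ^ m"
  proof (rule fps_ext)
    fix k
    have "fps_nth (T * (1 - fps_X ^ m)) k = fps_nth T k - (if k < m then 0 else fps_nth T (k - m))"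
      by (simp add: right_diff_distrib fps_X_power_mult_right_nth)
    also have "\<dots> = (if k = m then of_nat m else 0)"
    proof -
      consider "k < m" | "k = m" | "k > m" by linarith
      thus ?thesis
      proof cases
        case 1
        thus ?thesis by (auto simp: T_def dest: dvd_imp_le)
      next
        case 2
        thus ?thesis using m by (simp add: T_def)
      next
        case 3
        hence "m dvd k - m \<longleftrightarrow> m dvd k" by (metis dvd_minus_self less_or_eq_imp_le not_less dvd_diff_nat dvd_refl less_imp_le_nat le_add_diff_inverse dvd_add_right_iff)
        thus ?thesis using 3 by (simp add: T_def)
      qed
    qed
    also have "\<dots> = fps_nth (of_nat m * fps_X ^ m) k" by (simp add: fps_X_power_nth fps_of_nat[symmetric] del: fps_of_nat)
    finally show "fps_nth (T * (1 - fps_X ^ m)) k = fps_nth (of_nat m * fps_X ^ m) k" .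
  qed
  have d: "fps_X * fps_deriv (1 - fps_X ^ m :: rat fps) = - (of_nat m * fps_X ^ m)"
  proof (rule fps_ext)
    fix k
    show "fps_nth (fps_X * fps_deriv (1 - fps_X ^ m :: rat fps)) k = fps_nth (- (of_nat m * fps_X ^ m)) k"
      using m by (cases k) (simp_all add: fps_X_power_nth fps_of_nat[symmetric] del: fps_of_nat of_nat_Suc)
  qed
  have P: "P (Suc N) = P N * (1 - fps_X ^ m)"
    by (simp add: P_def m_def mult.commute)
  have IH: "fps_X * fps_deriv (P N) = - G N * P N" using Suc by (simp add: G_def)
  have "fps_X * fps_deriv (P (Suc N)) = (fps_X * fps_deriv (P N)) * (1 - fps_X ^ m) + P N * (fps_X * fps_deriv (1 - fps_X ^ m))"
    unfolding P by (simp add: algebra_simps)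
  also have "\<dots> = - G N * P (Suc N) - P N * (T * (1 - fps_X ^ m))"
    unfolding IH d T P by (simp add: algebra_simps)
  also have "\<dots> = - G (Suc N) * P (Suc N)" unfolding G P by (simp add: algebra_simps)
  finally show ?case by (simp add: G_def)
qed

text \<open>A factor of index n > k affects only exponents above k. This replaces the products of
  varying length in the definition by a single one.\<close>

lemma euler_prod_nth_eq:
  assumes a: "a > 0" and k: "k \<le> N"
  shows "fps_nth (euler_prod a) k = fps_nth (\<Prod>n\<in>{1..N}. (1 - fps_X ^ (a * n))) k"
  using k
proof (induction N rule: dec_induct)
  case base
  show ?case by (simp add: euler_prod_def)
next
  case (step N)
  have "k < a * Suc N" using step a by (metis le_less_trans less_Suc_eq_le mult_le_mono1 nat_mult_1 Suc_leI One_nat_def le_trans leD leI)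
  hence "fps_nth ((\<Prod>n\<in>{1..N}. (1 - fps_X ^ (a * n))) * (1 - fps_X ^ (a * Suc N)) :: rat fps) k = fps_nth (\<Prod>n\<in>{1..N}. (1 - fps_X ^ (a * n))) k"
    by (simp add: right_diff_distrib fps_X_power_mult_right_nth)
  thus ?case using step by (simp add: mult.commute)
qed

lemma euler_prod_0 [simp]: "fps_nth (euler_prod a) 0 = 1"
  by (simp add: euler_prod_def)

lemma euler_prod_recursion:
  assumes a: "a > 0"
  shows "of_nat k * fps_nth (euler_prod a) k = - (\<Sum>i=1..k. of_nat (divsum_scaled a i) * fps_nth (euler_prod a) (k - i))"
proof -
  define P :: "rat fps" where "P = (\<Prod>n\<in>{1..k}. (1 - fps_X ^ (a * n)))"
  define G :: "rat fps" where "G = Abs_fps (\<lambda>j. if j = 0 then 0 else of_nat (\<Sum>n\<in>{1..k}. if a * n dvd j then a * n else 0))"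
  have E: "fps_nth (euler_prod a) j = fps_nth P j" if "j \<le> k" for j
    unfolding P_def by (rule euler_prod_nth_eq[OF a that])
  have "of_nat k * fps_nth P k = fps_nth (fps_X * fps_deriv P) k"
    by (cases k) simp_all
  also have "\<dots> = - (\<Sum>i=0..k. fps_nth G i * fps_nth P (k - i))"
    using euler_prod_finite_log_deriv[OF a, of k] by (simp add: P_def G_def fps_mult_nth)
  also have "(\<Sum>i=0..k. fps_nth G i * fps_nth P (k - i)) = (\<Sum>i=1..k. fps_nth G i * fps_nth P (k - i))"
    by (rule sum.mono_neutral_right) (auto simp: G_def Suc_le_eq)
  also have "\<dots> = (\<Sum>i=1..k. of_nat (divsum_scaled a i) * fps_nth (euler_prod a) (k - i))"
    by (rule sum.cong) (use divsum_scaled_eq[OF a, of _ k] E in \<open>auto simp: G_def\<close>)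
  finally show ?thesis by (simp add: E)
qed

definition fps_complex :: "rat fps \<Rightarrow> complex fps" where
  "fps_complex F = Abs_fps (\<lambda>n. of_rat (fps_nth F n))"

lemma fps_complex_nth [simp]: "fps_nth (fps_complex F) n = of_rat (fps_nth F n)"
  by (simp add: fps_complex_def)

lemma fps_complex_mult: "fps_complex (F * G) = fps_complex F * fps_complex G"
  by (simp add: fps_eq_iff fps_mult_nth of_rat_sum of_rat_mult)

lemma fps_complex_1: "fps_complex 1 = 1"
  by (simp add: fps_eq_iff)

lemma fps_complex_power: "fps_complex (F ^ n) = fps_complex F ^ n"
  by (induction n) (simp_all add: fps_complex_1 fps_complex_mult)

lemma fps_complex_inverse:
  assumes "fps_nth F 0 \<noteq> 0"
  shows "fps_complex (inverse F) = inverse (fps_complex F)"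
proof -
  have "fps_complex (inverse F) * fps_complex F = 1"
    unfolding fps_complex_mult[symmetric] inverse_mult_eq_1[OF assms] by (rule fps_complex_1)
  thus ?thesis using assms by (metis fps_inverse_unique mult.commute fps_complex_nth of_rat_eq_0_iff)
qed

text \<open>The bridge from the formal product to the analytic function: both satisfy the recursion
  of the same logarithmic derivative, and both begin with 1.\<close>

lemma euler_prod_expansion:
  assumes a: "a > 0"
  shows "(\<lambda>q. exp (log_E (q ^ a))) has_fps_expansion fps_complex (euler_prod a)"
proof -
  define X :: "complex fps" where "X = fps_X ^ a"
  define L where "L = log_euler oo X"
  have X0: "fps_nth X 0 = 0" using a by (simp add: X_def)
  have "log_E has_fps_expansion log_euler"
    unfolding log_E_def by (rule eval_fps_has_fps_expansion)
      (use fps_conv_radius_log_euler in \<open>auto intro: less_le_trans[rotated]\<close>)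
  moreover have "(\<lambda>q::complex. q ^ a) has_fps_expansion X" unfolding X_def by (intro fps_expansion_intros)
  ultimately have "(log_E \<circ> (\<lambda>q. q ^ a)) has_fps_expansion L"
    unfolding L_def using X0 by (rule has_fps_expansion_compose)
  moreover have L0: "fps_nth L 0 = 0" by (simp add: L_def)
  moreover have "exp has_fps_expansion fps_exp (1::complex)" by (rule has_fps_expansion_exp1)
  ultimately have "(exp \<circ> (log_E \<circ> (\<lambda>q. q ^ a))) has_fps_expansion (fps_exp 1 oo L)"
    by (intro has_fps_expansion_compose)
  hence e: "(\<lambda>q. exp (log_E (q ^ a))) has_fps_expansion (fps_exp 1 oo L)" by (simp add: o_def)
  define F where "F = fps_exp 1 oo L"
  have Ln: "fps_nth L k = (if a dvd k then fps_nth log_euler (k div a) else 0)" for k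
    unfolding L_def X_def using a by (simp add: fps_nth_compose_X_power)
  have tL: "fps_nth (fps_X * fps_deriv L) k = - of_nat (divsum_scaled a k)" for k
  proof -
    have "fps_nth (fps_X * fps_deriv L) k = of_nat k * fps_nth L k" by (cases k) simp_all
    also have "\<dots> = - of_nat (divsum_scaled a k)"
    proof (cases "a dvd k")
      case True
      then obtain m where m: "k = a * m" by auto
      show ?thesis using a by (cases "m = 0") (auto simp: Ln m divsum_scaled_def log_euler_nth)
    qed (simp add: Ln divsum_scaled_def)
    finally show ?thesis .
  qed
  have dF: "fps_X * fps_deriv F = F * (fps_X * fps_deriv L)"
    unfolding F_def fps_compose_deriv[OF L0] by (simp add: algebra_simps)
  have rec: "of_nat k * fps_nth F k = - (\<Sum>i=1..k. of_nat (divsum_scaled a i) * fps_nth F (k - i))" for k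
  proof -
    have "of_nat k * fps_nth F k = fps_nth (fps_X * fps_deriv F) k" by (cases k) simp_all
    also have "\<dots> = (\<Sum>i=0..k. fps_nth (fps_X * fps_deriv L) i * fps_nth F (k - i))"
      unfolding dF mult.commute[of F] by (rule fps_mult_nth)
    also have "\<dots> = - (\<Sum>i=0..k. of_nat (divsum_scaled a i) * fps_nth F (k - i))"
      unfolding tL by (simp add: sum_negf)
    also have "(\<Sum>i=0..k. of_nat (divsum_scaled a i) * fps_nth F (k - i)) = (\<Sum>i=1..k. of_nat (divsum_scaled a i) * fps_nth F (k - i))"
      by (rule sum.mono_neutral_right) (auto simp: divsum_scaled_def Suc_le_eq)
    finally show ?thesis .
  qed
  have rec': "of_nat k * fps_nth (fps_complex (euler_prod a)) k = - (\<Sum>i=1..k. of_nat (divsum_scaled a i) * fps_nth (fps_complex (euler_prod a)) (k - i))" for k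
  proof -
    have "of_nat k * fps_nth (fps_complex (euler_prod a)) k = of_rat (of_nat k * fps_nth (euler_prod a) k)"
      by (simp add: of_rat_mult)
    also have "\<dots> = - (\<Sum>i=1..k. of_nat (divsum_scaled a i) * fps_nth (fps_complex (euler_prod a)) (k - i))"
      unfolding euler_prod_recursion[OF a] by (simp add: of_rat_minus of_rat_sum of_rat_mult)
    finally show ?thesis .
  qed
  have "F = fps_complex (euler_prod a)"
    by (rule fps_log_deriv_recursion_unique[OF rec rec']) (simp add: F_def)
  thus ?thesis using e by (simp add: F_def)
qed

definition L2_fps :: "rat fps" where
  "L2_fps = euler_prod 8 ^ 6 * inverse (euler_prod 4 ^ 2 * euler_prod 16 ^ 4)"

definition gL_fps :: "nat \<Rightarrow> rat fps" where
  "gL_fps k = euler_prod 4 ^ 6 * L2_fps ^ k"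

definition gL_coeff :: "nat \<Rightarrow> int \<Rightarrow> rat" where
  "gL_coeff k n = fls_nth (g2 * L2 ^ k) n"

lemma L2_denominator_0: "fps_nth (euler_prod 4 ^ 2 * euler_prod 16 ^ 4) 0 = 1"
  by (simp add: fps_power_zeroth)

lemma L2_eq: "L2 = fls_X_intpow (- 1) * fps_to_fls L2_fps"
proof -
  have "fps_to_fls (euler_prod 8 ^ 6) / fps_to_fls (euler_prod 4 ^ 2 * euler_prod 16 ^ 4) = fps_to_fls L2_fps"
  proof -
    have "subdegree (euler_prod 4 ^ 2 * euler_prod 16 ^ 4) = 0"
      by (rule subdegreeI) (simp_all add: L2_denominator_0 del: fps_mult_nth_0)
    from fls_inverse_fps_to_fls[OF this] show ?thesis
      unfolding L2_fps_def by (simp only: divide_inverse fls_times_fps_to_fls[of "euler_prod 8 ^ 6"])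
  qed
  thus ?thesis unfolding L2_def times_divide_eq_right[symmetric] by (simp only:)
qed

lemma gL_eq: "g2 * L2 ^ k = fls_X_intpow (1 - int k) * fps_to_fls (gL_fps k)"
proof -
  have "g2 * L2 ^ k = fls_X_intpow 1 * (fls_X_intpow (- 1)) ^ k * (fps_to_fls (euler_prod 4 ^ 6) * fps_to_fls L2_fps ^ k)"
    unfolding g2_def L2_eq by (simp only: power_mult_distrib mult_ac)
  also have "fls_X_intpow 1 * (fls_X_intpow (- 1)) ^ k = (fls_X_intpow (1 - int k) :: rat fls)"
    unfolding fls_X_intpow_power fls_X_intpow_times_fls_X_intpow by simp
  also have "fps_to_fls (euler_prod 4 ^ 6) * fps_to_fls L2_fps ^ k = fps_to_fls (gL_fps k)"
    unfolding gL_fps_def by (simp only: fls_times_fps_to_fls fps_to_fls_power)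
  finally show ?thesis .
qed

lemma gL_coeff_eq: "gL_coeff k n = (if 1 - int k \<le> n then fps_nth (gL_fps k) (nat (n - (1 - int k))) else 0)"
  unfolding gL_coeff_def gL_eq fls_X_intpow_times_conv_shift(1) by (auto simp: algebra_simps)

text \<open>L_2 is defined as u0^3 / (u1 u3^2), whereas \<open>wA\<close> uses u2 / u3; the two
  agree by \<open>u_product\<close>.\<close>

lemma gL_expansion: "(\<lambda>q. wA k (q ^ 4)) has_fps_expansion fps_complex (gL_fps k)"
proof -
  have r: "u1 (q ^ 4) = exp (log_E (q ^ 4)) ^ 2" "u3 (q ^ 4) = exp (log_E (q ^ 16)) ^ 2" "u0 (q ^ 4) = exp (log_E (q ^ 8)) ^ 2" for q
    by (simp_all add: u1_def u3_def u0_def exp_of_nat_mult[symmetric] flip: power_mult)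
  define W where "W q = exp (log_E (q ^ 4)) ^ 6 * (exp (log_E (q ^ 8)) ^ 6 * inverse (exp (log_E (q ^ 4)) ^ 2 * exp (log_E (q ^ 16)) ^ 4)) ^ k" for q
  have "W has_fps_expansion fps_complex (gL_fps k)"
    unfolding W_def[abs_def] gL_fps_def L2_fps_def fps_complex_mult fps_complex_power fps_complex_inverse[of "euler_prod 4 ^ 2 * euler_prod 16 ^ 4", simplified]
    by (intro fps_expansion_intros euler_prod_expansion) auto
  moreover have "wA k (q ^ 4) = W q" if "q \<in> ball 0 1" for q
  proof -
    have "norm (q ^ 4) < 1" using that by (simp add: norm_power power_less_one_iff)
    hence "u2 (q ^ 4) = u0 (q ^ 4) ^ 3 / (u1 (q ^ 4) * u3 (q ^ 4))"
      using u_product[of "q ^ 4"] by (simp add: field_simps)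
    hence "u2 (q ^ 4) / u3 (q ^ 4) = u0 (q ^ 4) ^ 3 / (u1 (q ^ 4) * u3 (q ^ 4) ^ 2)" by (simp add: power2_eq_square)
    thus ?thesis unfolding wA_def W_def r by (simp add: divide_inverse flip: power_mult)
  qed
  hence "eventually (\<lambda>q. W q = wA k (q ^ 4)) (nhds 0)"
    by (intro eventually_mono[OF eventually_nhds_in_open[of "ball 0 1"]]) auto
  ultimately show ?thesis by (rule has_fps_expansion_cong[THEN iffD1, rotated -1]) auto
qed

lemma has_qexp_gL: "has_qexp (fA k) (\<lambda>n. of_rat (gL_coeff k n))"
proof -
  define w where "w = (\<lambda>q. wA k (q ^ 4))"
  have hol: "w holomorphic_on ball 0 1"
  proof -
    have "wA k \<circ> (\<lambda>q. q ^ 4) holomorphic_on ball 0 1"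
      by (rule holomorphic_on_compose_gen[OF _ holomorphic_w(1)])
         (auto intro!: holomorphic_intros simp: norm_power power_less_one_iff)
    thus ?thesis by (simp add: w_def o_def)
  qed
  have e: "w has_fps_expansion fps_complex (gL_fps k)" unfolding w_def by (rule gL_expansion)
  have r: "fps_conv_radius (fps_complex (gL_fps k)) \<ge> 1"
    by (rule holomorphic_on_imp_fps_conv_radius_ge[OF e]) (use hol in \<open>simp add: one_ereal_def\<close>)
  have "has_qexp (fA k) (\<lambda>n. if 1 - int k \<le> n \<and> 1 dvd n - (1 - int k) then fps_nth (fps_complex (gL_fps k)) (nat ((n - (1 - int k)) div 1)) else 0)"
  proof (rule has_qexp_fpsI[OF r])
    fix t :: complex assume t: "Im t > 0"
    have "eval_fps (fps_complex (gL_fps k)) (qpow 1 t) = w (qpow 1 t)"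
      by (rule has_fps_expansion_imp_eval_fps_eq[OF e norm_qpow_less_1[OF t] hol]) simp
    also have "\<dots> = wA k (qpow 4 t)" using qpow_mult_nat[of 1 4 t] by (simp add: w_def)
    finally show "fA k t = qpow (1 - int k) t * eval_fps (fps_complex (gL_fps k)) (qpow 1 t)" by (simp add: f_disc)
  qed simp
  moreover have "(\<lambda>n. if 1 - int k \<le> n \<and> 1 dvd n - (1 - int k) then fps_nth (fps_complex (gL_fps k)) (nat ((n - (1 - int k)) div 1)) else 0) = (\<lambda>n. of_rat (gL_coeff k n))"
    by (auto simp: gL_coeff_eq fun_eq_iff)
  ultimately show ?thesis by simp
qed

text \<open>That only every fourth exponent occurs is read off from the analytic expansion in
  \<open>qpow 4\<close> and carried over to the formal series by uniqueness.\<close>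

lemma gL_coeff_support: "gL_coeff k n \<noteq> 0 \<Longrightarrow> 1 - int k \<le> n \<and> 4 dvd n - (1 - int k)"
  and gL_coeff_lead: "gL_coeff k (1 - int k) = 1"
proof -
  obtain c where c: "has_qexp (fA k) c" "\<And>n. c n \<noteq> 0 \<Longrightarrow> 1 - int k \<le> n \<and> 4 dvd n - (1 - int k)" "c (1 - int k) = 1"
    by (rule has_qexp_fA[of k]) blast
  have e: "c = (\<lambda>n. of_rat (gL_coeff k n))" by (rule has_qexp_unique[OF c(1) has_qexp_gL])
  show "gL_coeff k n \<noteq> 0 \<Longrightarrow> 1 - int k \<le> n \<and> 4 dvd n - (1 - int k)" using c(2)[of n] by (simp add: e)
  show "gL_coeff k (1 - int k) = 1" using c(3) by (simp add: e)
qed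

section \<open>Integrality of the coefficients\<close>

definition fps_integral :: "rat fps \<Rightarrow> bool" where "fps_integral F \<longleftrightarrow> (\<forall>n. fps_nth F n \<in> \<int>)"

lemma fps_integral_mult: "fps_integral F \<Longrightarrow> fps_integral G \<Longrightarrow> fps_integral (F * G)"
  by (auto simp: fps_integral_def fps_mult_nth intro!: Ints_sum Ints_mult)

lemma fps_integral_power: "fps_integral F \<Longrightarrow> fps_integral (F ^ n)"
proof (induction n)
  case 0
  show ?case by (simp add: fps_integral_def)
qed (simp add: fps_integral_mult)

lemma fps_integral_inverse:
  assumes F: "fps_integral F" "fps_nth F 0 = 1"
  shows "fps_integral (inverse F)"
proof -
  have "fps_nth (inverse F) n \<in> \<int>" for n
  proof (induction n rule: less_induct)
    case (less n)
    have "F * inverse F = 1" by (rule inverse_mult_eq_1') (use F in simp)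
    hence "(\<Sum>i=0..n. fps_nth F i * fps_nth (inverse F) (n - i)) = fps_nth 1 n" by (metis fps_mult_nth)
    hence "fps_nth (inverse F) n = fps_nth 1 n - (\<Sum>i=1..n. fps_nth F i * fps_nth (inverse F) (n - i))"
      using F(2) by (simp add: sum.atLeast_Suc_atMost)
    also have "\<dots> \<in> \<int>"
      using F(1) less by (auto intro!: Ints_diff Ints_sum Ints_mult simp: fps_integral_def)
    finally show ?case .
  qed
  thus ?thesis by (simp add: fps_integral_def)
qed

lemma fps_integral_euler_prod: "fps_integral (euler_prod a)"
proof -
  have "fps_integral (\<Prod>n\<in>A. (1 - fps_X ^ (a * n)))" if "finite A" for A :: "nat set"
    using that
  proof (induction A rule: finite_induct)
    case (insert n A)
    have "fps_integral (1 - fps_X ^ (a * n))" by (auto simp: fps_integral_def fps_X_power_nth)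
    thus ?case using insert by (auto intro: fps_integral_mult)
  qed (auto simp: fps_integral_def)
  thus ?thesis by (auto simp: fps_integral_def euler_prod_def)
qed

lemma gL_coeff_Ints: "gL_coeff k n \<in> \<int>"
proof -
  have "fps_integral (gL_fps k)"
    unfolding gL_fps_def L2_fps_def
    by (intro fps_integral_mult fps_integral_power fps_integral_inverse fps_integral_euler_prod L2_denominator_0)
  thus ?thesis by (auto simp: gL_coeff_eq fps_integral_def)
qed

section \<open>Congruences\<close>

definition gL_int :: "nat \<Rightarrow> int \<Rightarrow> int" where "gL_int k n = \<lfloor>gL_coeff k n\<rfloor>"

lemma of_int_gL_int: "of_int (gL_int k n) = gL_coeff k n"
  using gL_coeff_Ints[of k n] by (auto simp: gL_int_def elim!: Ints_cases)

lemma complex_gL_int: "of_rat (gL_coeff k n) = (of_int (gL_int k n) :: complex)"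
  unfolding of_int_gL_int[symmetric] by simp

lemma has_qexp_gL_int: "has_qexp (fA k) (\<lambda>n. of_int (gL_int k n))"
  using has_qexp_gL[of k] by (simp add: complex_gL_int)

lemma gL_int_support: "gL_int k n \<noteq> 0 \<Longrightarrow> 1 - int k \<le> n \<and> 4 dvd n - (1 - int k)"
proof -
  assume "gL_int k n \<noteq> 0"
  hence "gL_coeff k n \<noteq> 0" unfolding of_int_gL_int[symmetric] by simp
  thus ?thesis by (rule gL_coeff_support)
qed

lemma gL_int_lead: "gL_int k (1 - int k) = 1"
  using gL_coeff_lead[of k] by (simp add: gL_int_def)

text \<open>The multiples are taken inside the complex numbers: the coefficients supplied by
  \<open>form_structure\<close> are a priori complex, and their integrality comes out together with
  their divisibility.\<close>

definition int_multiples :: "int \<Rightarrow> complex set" where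
  "int_multiples N = range (\<lambda>z. of_int (N * z))"

lemma int_multiplesI: "x = of_int (N * z) \<Longrightarrow> x \<in> int_multiples N"
  by (auto simp: int_multiples_def)

lemma int_multiples_0: "0 \<in> int_multiples N"
  by (rule int_multiplesI[of _ _ 0]) simp

lemma int_multiples_add:
  assumes "x \<in> int_multiples N" "y \<in> int_multiples N"
  shows "x + y \<in> int_multiples N"
proof -
  obtain u v where "x = of_int (N * u)" "y = of_int (N * v)" using assms by (auto simp: int_multiples_def)
  thus ?thesis by (intro int_multiplesI[of _ _ "u + v"]) (simp add: algebra_simps)
qed

lemma int_multiples_mult:
  assumes "x \<in> int_multiples N"
  shows "x * of_int m \<in> int_multiples N"
proof -
  obtain u where "x = of_int (N * u)" using assms by (auto simp: int_multiples_def)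
  thus ?thesis by (intro int_multiplesI[of _ _ "u * m"]) (simp add: algebra_simps)
qed

lemma int_multiples_minus: "x \<in> int_multiples N \<Longrightarrow> - x \<in> int_multiples N"
  using int_multiples_mult[of x N "- 1"] by simp

lemma int_multiples_sum: "(\<And>i. i \<in> A \<Longrightarrow> f i \<in> int_multiples N) \<Longrightarrow> sum f A \<in> int_multiples N"
  by (induction A rule: infinite_finite_induct) (auto intro: int_multiples_0 int_multiples_add)

text \<open>Triangular elimination: \<open>g\<^sub>2 L\<^sub>2 ^ k\<close> is monic in \<open>q ^ (1 - k)\<close>.\<close>

lemma gL_combination_divisible:
  assumes c: "\<And>n. c n = (\<Sum>j\<le>M. a j * of_int (gL_int (k + 4 * j) n))"
    and R: "\<And>n. n \<le> 1 - int (k + 4 * j0) \<Longrightarrow> c n \<in> int_multiples N"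
    and j: "j0 \<le> j" "j \<le> M"
  shows "a j \<in> int_multiples N"
  using j
proof (induction "M - j" arbitrary: j rule: less_induct)
  case less
  \<comment> \<open>The exponent at which the j-th form is monic: forms of smaller index begin only
    later, and those of larger index are covered by the induction, which descends from M.\<close>
  define n where "n = 1 - int (k + 4 * j)"
  have z: "gL_int (k + 4 * i) n = 0" if "i < j" for i
    using gL_int_support[of "k + 4 * i" n] that by (auto simp: n_def)
  have "{..M} = insert j ({..<j} \<union> {j<..M})" using less.prems by auto
  hence "c n = a j * of_int (gL_int (k + 4 * j) n) + (\<Sum>i\<in>{..<j} \<union> {j<..M}. a i * of_int (gL_int (k + 4 * i) n))"
    unfolding c by (simp add: sum.insert)
  also have "(\<Sum>i\<in>{..<j} \<union> {j<..M}. a i * of_int (gL_int (k + 4 * i) n)) = (\<Sum>i\<in>{j<..M}. a i * of_int (gL_int (k + 4 * i) n))"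
    by (rule sum.mono_neutral_right) (auto simp: z)
  also have "gL_int (k + 4 * j) n = 1" unfolding n_def by (rule gL_int_lead)
  finally have "a j = c n + - (\<Sum>i\<in>{j<..M}. a i * of_int (gL_int (k + 4 * i) n))" by simp
  also have "\<dots> \<in> int_multiples N"
  proof (rule int_multiples_add[OF R int_multiples_minus[OF int_multiples_sum[OF int_multiples_mult]]])
    show "n \<le> 1 - int (k + 4 * j0)" using less.prems by (simp add: n_def)
    fix i assume "i \<in> {j<..M}"
    hence "M - i < M - j" "j0 \<le> i" "i \<le> M" using less.prems by auto
    thus "a i \<in> int_multiples N" by (rule less.hyps)
  qed
  finally show ?case .
qed

definition hecke_coeff :: "nat \<Rightarrow> (int \<Rightarrow> complex) \<Rightarrow> int \<Rightarrow> complex" where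
  "hecke_coeff p c n = c (int p * n) - of_nat p ^ 2 * (if int p dvd n then c (n div int p) else 0)"

definition gL_span :: "nat \<Rightarrow> (int \<Rightarrow> complex) \<Rightarrow> bool" where
  "gL_span k c \<longleftrightarrow> (\<exists>M a. \<forall>n. c n = (\<Sum>j\<le>M. a j * of_int (gL_int (k + 4 * j) n)))"

lemma gL_span_mono_bound:
  assumes "\<And>n. c n = (\<Sum>j\<le>M. a j * of_int (gL_int (k + 4 * j) n))" "M \<le> M'"
  shows "\<exists>a. \<forall>n. c n = (\<Sum>j\<le>M'. a j * of_int (gL_int (k + 4 * j) n))"
proof (intro exI allI)
  fix n
  have "(\<Sum>j\<le>M'. (if j \<le> M then a j else 0) * of_int (gL_int (k + 4 * j) n)) =
     (\<Sum>j\<le>M. (if j \<le> M then a j else 0) * of_int (gL_int (k + 4 * j) n))"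
    by (rule sum.mono_neutral_right) (use assms(2) in auto)
  thus "c n = (\<Sum>j\<le>M'. (if j \<le> M then a j else 0) * of_int (gL_int (k + 4 * j) n))"
    by (simp add: assms(1))
qed

lemma gL_span_add:
  assumes "gL_span k c" "gL_span k d"
  shows "gL_span k (\<lambda>n. c n + x * d n)"
proof -
  obtain M a where a: "\<And>n. c n = (\<Sum>j\<le>M. a j * of_int (gL_int (k + 4 * j) n))"
    using assms(1) unfolding gL_span_def by (elim exE) (rule that, erule spec)
  obtain M' b where b: "\<And>n. d n = (\<Sum>j\<le>M'. b j * of_int (gL_int (k + 4 * j) n))"
    using assms(2) unfolding gL_span_def by (elim exE) (rule that, erule spec)
  obtain a' where a': "\<And>n. c n = (\<Sum>j\<le>max M M'. a' j * of_int (gL_int (k + 4 * j) n))"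
    using gL_span_mono_bound[where c = c and M = M and a = a and k = k and M' = "max M M'", OF a max.cobounded1] by (elim exE) (rule that, erule spec)
  obtain b' where b': "\<And>n. d n = (\<Sum>j\<le>max M M'. b' j * of_int (gL_int (k + 4 * j) n))"
    using gL_span_mono_bound[where c = d and M = M' and a = b and k = k and M' = "max M M'", OF b max.cobounded2] by (elim exE) (rule that, erule spec)
  have "c n + x * d n = (\<Sum>j\<le>max M M'. (a' j + x * b' j) * of_int (gL_int (k + 4 * j) n))" for n
    unfolding a' b' by (simp add: sum_distrib_left sum.distrib algebra_simps)
  thus ?thesis unfolding gL_span_def by (intro exI allI)
qed

lemma gL_span_sum:
  assumes "\<And>i. i \<in> I \<Longrightarrow> gL_span k (f i)" "finite I"
  shows "gL_span k (\<lambda>n. \<Sum>i\<in>I. a i * f i n)"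
  using assms(2,1)
proof (induction I rule: finite_induct)
  case empty
  show ?case unfolding gL_span_def by (intro exI[of _ 0] exI[of _ "\<lambda>_. 0"]) simp
next
  case (insert i I)
  hence "gL_span k (\<lambda>n. (\<Sum>i\<in>I. a i * f i n) + a i * f i n)" by (intro gL_span_add) auto
  thus ?case using insert by (simp add: add.commute)
qed

lemma gL_span_hecke:
  assumes p: "prime p" "p mod 4 = 3" and k: "4 dvd k + k' + 2" "k' < 4" and c: "gL_span k c"
  shows "gL_span k' (hecke_coeff p c)"
proof -
  have p0: "p > 0" using p(1) by (rule prime_gt_0_nat)
  obtain M a where a: "\<And>n. c n = (\<Sum>j\<le>M. a j * of_int (gL_int (k + 4 * j) n))"
    using c unfolding gL_span_def by (elim exE) (rule that, erule spec)
  have "gL_span k' (hecke_coeff p (\<lambda>n. of_int (gL_int (k + 4 * j) n)))" for j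
  proof -
    have "4 dvd k + k' + 2 + 4 * j" using k(1) by (rule dvd_add) simp
    hence "4 dvd (k + 4 * j) + k' + 2" by (simp add: algebra_simps)
    then obtain M b where b: "\<And>t. Im t > 0 \<Longrightarrow> hecke p (fA (k + 4 * j)) t = (\<Sum>i\<le>M. b i * fA (k' + 4 * i) t)"
      using hecke_fA[OF p _ k(2), of "k + 4 * j"] by blast
    have "has_qexp (hecke p (fA (k + 4 * j))) (hecke_coeff p (\<lambda>n. of_int (gL_int (k + 4 * j) n)))"
      using has_qexp_hecke[OF has_qexp_gL_int p0, of "k + 4 * j"] unfolding hecke_coeff_def[abs_def] .
    moreover have "has_qexp (\<lambda>t. \<Sum>i\<le>M. b i * fA (k' + 4 * i) t) (\<lambda>n. \<Sum>i\<le>M. b i * of_int (gL_int (k' + 4 * i) n))"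
      by (intro has_qexp_sum has_qexp_cmult has_qexp_gL_int) auto
    hence "has_qexp (hecke p (fA (k + 4 * j))) (\<lambda>n. \<Sum>i\<le>M. b i * of_int (gL_int (k' + 4 * i) n))"
      by (rule has_qexp_cong) (simp add: b)
    ultimately have "hecke_coeff p (\<lambda>n. of_int (gL_int (k + 4 * j) n)) = (\<lambda>n. \<Sum>i\<le>M. b i * of_int (gL_int (k' + 4 * i) n))"
      by (rule has_qexp_unique)
    thus ?thesis unfolding gL_span_def by (intro exI allI) (erule fun_cong)
  qed
  hence "gL_span k' (\<lambda>n. \<Sum>j\<le>M. a j * hecke_coeff p (\<lambda>n. of_int (gL_int (k + 4 * j) n)) n)"
    by (intro gL_span_sum) auto
  moreover have "(\<Sum>j\<le>M. a j * hecke_coeff p (\<lambda>n. of_int (gL_int (k + 4 * j) n)) n) = hecke_coeff p c n" for n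
  proof -
    have "(\<Sum>j\<le>M. a j * hecke_coeff p (\<lambda>n. of_int (gL_int (k + 4 * j) n)) n) =
      (\<Sum>j\<le>M. a j * of_int (gL_int (k + 4 * j) (int p * n))) - of_nat p ^ 2 * (\<Sum>j\<le>M. a j * (if int p dvd n then of_int (gL_int (k + 4 * j) (n div int p)) else 0))"
      unfolding hecke_coeff_def sum_distrib_left sum_subtractf[symmetric] by (rule sum.cong) (simp_all add: algebra_simps)
    also have "\<dots> = hecke_coeff p c n" by (simp add: hecke_coeff_def a)
    finally show ?thesis .
  qed
  ultimately show ?thesis by simp
qed

text \<open>The coefficients of \<open>H | T(p ^ k)\<close>; the nebentypus contributes the sign \<open>\<chi>(p) = -1\<close>.\<close>

fun hecke_pow :: "nat \<Rightarrow> nat \<Rightarrow> int \<Rightarrow> int" where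
  "hecke_pow p 0 n = gL_int 2 n"
| "hecke_pow p (Suc k) n = gL_int 2 (int p ^ Suc k * n) - int p ^ 2 * (if int p dvd n then hecke_pow p k (n div int p) else 0)"

text \<open>Hecke's relation T(p^(k+2)) = T(p) T(p^(k+1)) - \<chi>(p) p^2 T(p^k); \<chi>(p) = -1
  turns the last sign into plus.\<close>

lemma hecke_pow_step:
  assumes "p > 0"
  shows "of_int (hecke_pow p (Suc (Suc k)) n) =
    hecke_coeff p (\<lambda>n. of_int (hecke_pow p (Suc k) n)) n + of_nat p ^ 2 * of_int (hecke_pow p k n)"
proof -
  have "int p ^ Suc k * (int p * n) = int p ^ Suc (Suc k) * n" by simp
  hence 1: "hecke_pow p (Suc k) (int p * n) = gL_int 2 (int p ^ Suc (Suc k) * n) - int p ^ 2 * hecke_pow p k n"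
    unfolding hecke_pow.simps(2)[of p k "int p * n"] using assms by (simp only: dvd_triv_left if_True) simp
  show ?thesis unfolding hecke_coeff_def 1 hecke_pow.simps(2)[of p "Suc k" n]
    by (simp del: power_Suc hecke_pow.simps)
qed

lemma hecke_pow_span:
  assumes p: "prime p" "p mod 4 = 3"
  shows "gL_span (if even k then 2 else 0) (\<lambda>n. of_int (hecke_pow p k n))"
proof (induction k rule: less_induct)
  case (less k)
  have p0: "p > 0" using p(1) by (rule prime_gt_0_nat)
  have four: "4 dvd (2 + 0 + 2 :: nat)" "4 dvd (0 + 2 + 2 :: nat)"
    by (simp_all del: add_2_eq_Suc add_2_eq_Suc')
  have base: "gL_span 2 (\<lambda>n. of_int (gL_int 2 n))"
    unfolding gL_span_def by (intro exI[of _ 0] exI[of _ "\<lambda>_. 1"]) simp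
  consider "k = 0" | "k = 1" | l where "k = Suc (Suc l)" by (metis One_nat_def old.nat.exhaust)
  thus ?case
  proof cases
    case 1
    thus ?thesis using base by simp
  next
    case 2
    have "gL_span 0 (hecke_coeff p (\<lambda>n. of_int (gL_int 2 n)))"
      by (rule gL_span_hecke[OF p four(1) _ base]) simp
    moreover have "hecke_coeff p (\<lambda>n. of_int (gL_int 2 n)) = (\<lambda>n. of_int (hecke_pow p k n))"
      by (auto simp: 2 hecke_coeff_def fun_eq_iff)
    ultimately show ?thesis using 2 by simp
  next
    case (3 l)
    have "gL_span (if even k then 2 else 0) (hecke_coeff p (\<lambda>n. of_int (hecke_pow p (Suc l) n)))"
    proof (rule gL_span_hecke[OF p _ _ less.IH[of "Suc l"]])
      show "4 dvd (if even (Suc l) then 2 else 0) + (if even k then 2 else 0) + (2 :: nat)"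
        using four unfolding 3 by (cases "even l") simp_all
    qed (use 3 in auto)
    moreover have "gL_span (if even k then 2 else 0) (\<lambda>n. of_int (hecke_pow p l n))"
      using less.IH[of l] 3 by simp
    ultimately have "gL_span (if even k then 2 else 0) (\<lambda>n. hecke_coeff p (\<lambda>n. of_int (hecke_pow p (Suc l) n)) n + of_nat p ^ 2 * of_int (hecke_pow p l n))"
      by (rule gL_span_add)
    thus ?thesis unfolding 3 hecke_pow_step[OF p0] .
  qed
qed

section \<open>Divisibility for the powers of T(p)\<close>

text \<open>For n <= 0 the U-part contributes nothing: a pole of H sits only at exponent -1, which
  is no multiple of p, and exponent 0 lies outside the class -1 mod 4. What remains is p^2 V(p), and
  each step supplies one p^2.\<close>

lemma hecke_pow_polar:
  assumes p: "p \<ge> 2" and n: "n \<le> 0"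
  shows "int p ^ (2 * k) dvd hecke_pow p k n"
  using n
proof (induction k arbitrary: n)
  case (Suc k)
  have "gL_int 2 (int p ^ Suc k * n) = 0"
  proof (rule ccontr)
    assume nz: "gL_int 2 (int p ^ Suc k * n) \<noteq> 0"
    hence s: "- 1 \<le> int p ^ Suc k * n" "4 dvd int p ^ Suc k * n + 1"
      using gL_int_support[OF nz] by auto
    have "2 * 1 \<le> int p * int p ^ k" using p by (intro mult_mono) auto
    hence P: "int p ^ Suc k \<ge> 2" by simp
    have "n \<noteq> 0" using s(2) by auto
    hence "n \<le> - 1" using Suc.prems by simp
    hence "int p ^ Suc k * n \<le> int p ^ Suc k * (- 1)" using P by (intro mult_left_mono) auto
    thus False using s(1) P by linarith
  qed
  moreover have "int p ^ (2 * Suc k) dvd int p ^ 2 * (if int p dvd n then hecke_pow p k (n div int p) else 0)"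
  proof (cases "int p dvd n")
    case True
    have "n div int p \<le> 0" using Suc.prems p by (simp add: div_nonpos_pos_le0)
    from mult_dvd_mono[OF dvd_refl Suc.IH[OF this], of "int p ^ 2"] show ?thesis
      using True by (simp add: power_add[symmetric] numeral_2_eq_2)
  qed simp
  ultimately show ?case by (simp del: power_Suc)
qed simp

lemma int_multiples_of_int: "of_int x \<in> int_multiples N \<longleftrightarrow> N dvd x"
proof
  assume "of_int x \<in> int_multiples N"
  then obtain z where "(of_int x :: complex) = of_int (N * z)" by (auto simp: int_multiples_def)
  hence "x = N * z" by (simp only: of_int_eq_iff)
  thus "N dvd x" by simp
qed (auto elim!: dvdE intro: int_multiplesI)

text \<open>Every form in the class k = 2 has leading exponent at most -1, so the polar part
  controls all coefficients of the combination.\<close>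

lemma hecke_pow_even:
  assumes p: "prime p" "p mod 4 = 3" and k: "even k"
  shows "int p ^ (2 * k) dvd hecke_pow p k n"
proof -
  have p2: "p \<ge> 2" using p(1) by (rule prime_ge_2_nat)
  obtain M a where a: "\<And>n. of_int (hecke_pow p k n) = (\<Sum>j\<le>M. a j * of_int (gL_int (2 + 4 * j) n) :: complex)"
    using hecke_pow_span[OF p, of k] k unfolding gL_span_def by auto
  have "a j \<in> int_multiples (int p ^ (2 * k))" if "j \<le> M" for j
  proof (rule gL_combination_divisible[OF a, of 0])
    fix n assume "n \<le> 1 - int (2 + 4 * 0)"
    thus "of_int (hecke_pow p k n) \<in> int_multiples (int p ^ (2 * k))"
      unfolding int_multiples_of_int by (intro hecke_pow_polar p2) simp
  qed (use that in auto)
  hence "of_int (hecke_pow p k n) \<in> int_multiples (int p ^ (2 * k))"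
    unfolding a by (intro int_multiples_sum int_multiples_mult) auto
  thus ?thesis by (simp only: int_multiples_of_int)
qed

text \<open>In the class k = 0 the polar part controls every coefficient except that of g_2. This
  one is read off at q^1, where g_2 has coefficient 1, with an error that is itself a multiple of
  the modulus.\<close>

lemma hecke_pow_odd:
  assumes p: "prime p" "p mod 4 = 3" and k: "odd k"
  shows "int p ^ (2 * k) dvd hecke_pow p k n - hecke_pow p k 1 * gL_int 0 n"
proof -
  have p2: "p \<ge> 2" using p(1) by (rule prime_ge_2_nat)
  let ?R = "int_multiples (int p ^ (2 * k))"
  obtain M a where a: "\<And>n. of_int (hecke_pow p k n) = (\<Sum>j\<le>M. a j * of_int (gL_int (0 + 4 * j) n) :: complex)"
    using hecke_pow_span[OF p, of k] k unfolding gL_span_def by auto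
  have aj: "a j \<in> ?R" if "1 \<le> j" "j \<le> M" for j
  proof (rule gL_combination_divisible[OF a, of 1])
    fix n assume "n \<le> 1 - int (0 + 4 * 1)"
    thus "of_int (hecke_pow p k n) \<in> ?R"
      unfolding int_multiples_of_int by (intro hecke_pow_polar p2) simp
  qed (use that in auto)
  have split: "{..M} = insert 0 {1..M}" by auto
  have r: "of_int (hecke_pow p k n) + - (a 0 * of_int (gL_int 0 n)) \<in> ?R" for n
  proof -
    have "of_int (hecke_pow p k n) + - (a 0 * of_int (gL_int 0 n)) = (\<Sum>j\<in>{1..M}. a j * of_int (gL_int (0 + 4 * j) n))"
      unfolding a split by simp
    also have "\<dots> \<in> ?R" using aj by (intro int_multiples_sum int_multiples_mult) auto
    finally show ?thesis .
  qed
  have "gL_int 0 1 = 1" using gL_int_lead[of 0] by simp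
  hence "of_int (hecke_pow p k 1) + - a 0 \<in> ?R" using r[of 1] by simp
  from int_multiples_add[OF r[of n] int_multiples_minus[OF int_multiples_mult[OF this, of "gL_int 0 n"]]]
  have "of_int (hecke_pow p k n - hecke_pow p k 1 * gL_int 0 n) \<in> ?R"
    by (simp add: algebra_simps)
  thus ?thesis by (simp only: int_multiples_of_int)
qed

lemma hecke_pow_1:
  assumes "p \<ge> 2"
  shows "hecke_pow p k 1 = gL_int 2 (int p ^ k)"
  using assms by (cases k) (auto simp: zdvd1_eq)

section \<open>C(p) modulo p\<close>

text \<open>For n = 4j the recurrence reads j^2 c_j = 4 (2j - 1)^2 c_(j-1), so c_j = binom(2j, j)^2.
  As long as n <= p + 1, the factor n - 2 lies strictly between 0 and p, and p is odd; hence p never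
  divides the right side.\<close>

lemma gL_int_constant_term_unit:
  assumes p: "prime p" "p mod 4 = 3" and j: "4 * j \<le> p + 1"
  shows "\<not> int p dvd gL_int (4 * j + 1) 0"
  using j
proof (induction j)
  case 0
  have "\<not> int p dvd 1" using p(1) by (simp add: zdvd1_eq prime_nat_iff)
  thus ?case using gL_int_lead[of 1] by simp
next
  case (Suc j)
  define n where "n = 4 * Suc j"
  have pp: "prime (int p)" using p(1) by simp
  have "of_nat n ^ 2 * of_int (gL_int (n + 1) 0) = 16 * (of_nat n - 2) ^ 2 * (of_int (gL_int (n - 3) 0) :: complex)"
    by (rule constant_term_recurrence[OF _ _ has_qexp_gL_int has_qexp_gL_int]) (simp_all add: n_def)
  hence "of_int (int n ^ 2 * gL_int (n + 1) 0) = (of_int (16 * (int n - 2) ^ 2 * gL_int (n - 3) 0) :: complex)"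
    by simp
  hence eq: "int n ^ 2 * gL_int (n + 1) 0 = 16 * (int n - 2) ^ 2 * gL_int (n - 3) 0"
    by (simp only: of_int_eq_iff)
  show ?case
  proof
    assume "int p dvd gL_int (4 * Suc j + 1) 0"
    hence "int p dvd int n ^ 2 * gL_int (n + 1) 0" unfolding n_def by (rule dvd_mult)
    moreover have "(16 :: int) = 2 ^ 4" by simp
    ultimately have "int p dvd 2 ^ 4 * (int n - 2) ^ 2 * gL_int (n - 3) 0" unfolding eq by (simp only:)
    hence "int p dvd 2 \<or> int p dvd int n - 2 \<or> int p dvd gL_int (n - 3) 0"
      using pp by (meson prime_dvd_multD prime_dvd_power)
    moreover have "\<not> int p dvd 2"
    proof
      assume "int p dvd 2"
      hence "int p \<le> 2" by (rule zdvd_imp_le) simp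
      hence "p = 0 \<or> p = 1 \<or> p = 2" by linarith
      thus False using p(2) by auto
    qed
    moreover have "\<not> int p dvd int n - 2"
    proof
      assume "int p dvd int n - 2"
      hence "int p \<le> int n - 2" by (rule zdvd_imp_le) (simp add: n_def)
      thus False using Suc.prems by (simp add: n_def)
    qed
    moreover have "n - 3 = 4 * j + 1" by (simp add: n_def)
    ultimately show False using Suc by simp
  qed
qed

lemma L2_fps_0: "fps_nth L2_fps 0 = 1"
  by (simp add: L2_fps_def fps_power_zeroth)

text \<open>g_2 and g_2 L_2 have exponents in one class mod 4 each, so no coefficient follows
  directly on the leading one. The gap makes the p-th power of the remainder begin at q^(2p), beyond
  the range p + 1 in which L_2^p is needed.\<close>

lemma L2_fps_1: "fps_nth L2_fps 1 = 0"
proof -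
  have "gL_coeff 1 1 = 0" "gL_coeff 0 2 = 0" using gL_coeff_support[of 1 1] gL_coeff_support[of 0 2] by auto
  hence "fps_nth (gL_fps 1) 1 = 0" "fps_nth (gL_fps 0) 1 = 0" by (simp_all add: gL_coeff_eq)
  moreover have "gL_fps 1 = gL_fps 0 * L2_fps" by (simp add: gL_fps_def)
  moreover have "fps_nth (gL_fps 0) 0 = 1" by (simp add: gL_fps_def fps_power_zeroth)
  ultimately show ?thesis by (simp add: fps_mult_nth_1 L2_fps_0)
qed

lemma fps_integral_L2: "fps_integral L2_fps"
  unfolding L2_fps_def
  by (intro fps_integral_mult fps_integral_power fps_integral_inverse fps_integral_euler_prod L2_denominator_0)

text \<open>\<open>L\<^sub>2 ^ p\<close> agrees with \<open>L\<^sub>2 (q ^ p)\<close>, hence with its leading term, modulo \<open>p\<close> in this range.\<close>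

lemma L2_fps_power_prime:
  assumes p: "prime p" "p > 2" and n: "0 < n" "n \<le> p + 1"
  shows "\<exists>z. fps_nth (L2_fps ^ p) n = of_int (int p * z)"
proof -
  define Y where "Y = fps_X ^ 2 * fps_shift 2 L2_fps"
  have L: "L2_fps = Y + 1"
  proof (rule fps_ext)
    fix n
    consider "n = 0" | "n = 1" | m where "n = Suc (Suc m)" by (metis One_nat_def old.nat.exhaust)
    thus "fps_nth L2_fps n = fps_nth (Y + 1) n"
      by cases (simp_all add: Y_def L2_fps_0 L2_fps_1[unfolded One_nat_def] fps_X_power_mult_nth)
  qed
  have "fps_integral Y"
    using fps_integral_L2 by (auto simp: Y_def fps_integral_def fps_X_power_mult_nth)
  hence iY: "fps_integral (Y ^ k)" for k by (rule fps_integral_power)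
  have "\<exists>z. fps_nth (of_nat (p choose k) * Y ^ k) n = of_int (int p * z)" if kp: "k \<le> p" for k
  proof -
    have nth: "fps_nth (of_nat (p choose k) * Y ^ k) n = of_nat (p choose k) * fps_nth (Y ^ k) n"
      by (simp add: fps_of_nat[symmetric] del: fps_of_nat)
    obtain y where y: "fps_nth (Y ^ k) n = of_int y" using iY[of k] by (auto simp: fps_integral_def elim: Ints_cases)
    consider "k = 0" | "0 < k" "k < p" | "k = p" using kp by linarith
    thus ?thesis
    proof cases
      case 1
      thus ?thesis using n by (intro exI[of _ 0]) simp
    next
      case 2
      hence "p dvd p choose k" using p by (intro dvd_choose_prime) auto
      then obtain z where "p choose k = p * z" by auto
      thus ?thesis unfolding nth y by (intro exI[of _ "int z * y"]) simp
    next
      case 3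
      have "fps_nth (Y ^ p) n = 0"
        unfolding Y_def power_mult_distrib power_mult[symmetric] using p n by (simp add: fps_X_power_mult_nth)
      thus ?thesis unfolding nth 3 by (intro exI[of _ 0]) simp
    qed
  qed
  then obtain z where z: "\<And>k. k \<le> p \<Longrightarrow> fps_nth (of_nat (p choose k) * Y ^ k) n = of_int (int p * z k)" by metis
  have "fps_nth (L2_fps ^ p) n = (\<Sum>k\<le>p. fps_nth (of_nat (p choose k) * Y ^ k) n)"
    unfolding L binomial_ring by (simp add: fps_sum_nth)
  also have "\<dots> = (\<Sum>k\<le>p. of_int (int p * z k))" by (rule sum.cong) (use z in auto)
  also have "\<dots> = of_int (int p * (\<Sum>k\<le>p. z k))" by (simp add: sum_distrib_left)
  finally show ?thesis by blast
qed

lemma H_coeff_prime_unit: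
  assumes p: "prime p" "p mod 4 = 3"
  shows "\<not> int p dvd gL_int 2 (int p)"
proof
  assume d: "int p dvd gL_int 2 (int p)"
  have p2: "p > 2"
  proof -
    have "p \<noteq> 0" "p \<noteq> 1" "p \<noteq> 2" using p(2) by auto
    thus ?thesis by linarith
  qed
  have e: "gL_fps (p + 2) = L2_fps ^ p * gL_fps 2" by (simp add: gL_fps_def power_add mult_ac power2_eq_square)
  have "fps_integral (gL_fps 2)"
    unfolding gL_fps_def by (intro fps_integral_mult fps_integral_power fps_integral_euler_prod fps_integral_L2)
  hence int2: "\<exists>y. fps_nth (gL_fps 2) i = of_int y" for i
    unfolding fps_integral_def by (meson Ints_cases)
  then obtain y where y: "\<And>i. fps_nth (gL_fps 2) i = of_int (y i)" by metis
  obtain z where z: "\<And>n. 0 < n \<Longrightarrow> n \<le> p + 1 \<Longrightarrow> fps_nth (L2_fps ^ p) n = of_int (int p * z n)"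
    using L2_fps_power_prime[OF p(1) p2] by metis
  \<comment> \<open>The leading exponent is -(p + 1), so the constant term has index p + 1; so does
    C(p) in H, whose leading exponent is -1.\<close>
  have "gL_coeff (p + 2) 0 = fps_nth (gL_fps (p + 2)) (p + 1)" by (simp add: gL_coeff_eq nat_add_distrib)
  also have "\<dots> = (\<Sum>i=0..p + 1. fps_nth (L2_fps ^ p) i * fps_nth (gL_fps 2) (p + 1 - i))"
    unfolding e by (rule fps_mult_nth)
  also have "\<dots> = fps_nth (gL_fps 2) (p + 1) + (\<Sum>i=1..p + 1. fps_nth (L2_fps ^ p) i * fps_nth (gL_fps 2) (p + 1 - i))"
    by (simp add: sum.atLeast_Suc_atMost fps_power_zeroth L2_fps_0)
  also have "fps_nth (gL_fps 2) (p + 1) = gL_coeff 2 (int p)" by (simp add: gL_coeff_eq nat_add_distrib)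
  also have "(\<Sum>i=1..p + 1. fps_nth (L2_fps ^ p) i * fps_nth (gL_fps 2) (p + 1 - i)) = (\<Sum>i=1..p + 1. of_int (int p * z i * y (p + 1 - i)))"
    by (rule sum.cong) (use z y in auto)
  also have "\<dots> = of_int (int p * (\<Sum>i=1..p + 1. z i * y (p + 1 - i)))"
    by (simp only: sum_distrib_left of_int_sum mult.assoc)
  finally have "of_int (gL_int (p + 2) 0) = (of_int (gL_int 2 (int p) + int p * (\<Sum>i=1..p + 1. z i * y (p + 1 - i))) :: rat)"
    unfolding of_int_gL_int[symmetric] of_int_add .
  hence "gL_int (p + 2) 0 = gL_int 2 (int p) + int p * (\<Sum>i=1..p + 1. z i * y (p + 1 - i))"
    by (simp only: of_int_eq_iff)
  hence "int p dvd gL_int (p + 2) 0" using d by simp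
  \<comment> \<open>For p = 3 mod 4 this is (p + 1)/4, so p + 2 = 4j + 1 is the last index within
    reach of the recurrence.\<close>
  moreover define j where "j = p div 4 + 1"
  have "4 * j = p + 1" using p(2) mult_div_mod_eq[of 4 p] by (simp add: j_def)
  hence "p + 2 = 4 * j + 1" "4 * j \<le> p + 1" by simp_all
  ultimately show False using gL_int_constant_term_unit[OF p, of j] by (simp only:)
qed

section \<open>From the powers of T(p) back to H\<close>

text \<open>The coefficient of H | T(p^(2m+2)) at q^p is C(p^(2m+3)) - p^2 C(p^(2m+1)), and it is
  divisible by p^(4m+4). As 4m + 4 > 2m + 2, the valuation rises by exactly 2.\<close>

lemma H_coeff_valuation:
  assumes p: "prime p" "p mod 4 = 3"
  shows "\<exists>w. gL_int 2 (int p ^ (2 * m + 1)) = int p ^ (2 * m) * w \<and> \<not> int p dvd w"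
proof (induction m)
  case 0
  show ?case using H_coeff_prime_unit[OF p] by (intro exI[of _ "gL_int 2 (int p)"]) simp
next
  case (Suc m)
  then obtain w where w: "gL_int 2 (int p ^ (2 * m + 1)) = int p ^ (2 * m) * w" "\<not> int p dvd w" by blast
  have p2: "p \<ge> 2" using p(1) by (rule prime_ge_2_nat)
  have "int p ^ (2 * (2 * Suc m)) dvd hecke_pow p (2 * Suc m) (int p)"
    by (rule hecke_pow_even[OF p]) simp
  moreover have "hecke_pow p (2 * Suc m) (int p) = gL_int 2 (int p ^ (2 * Suc m + 1)) - int p ^ 2 * gL_int 2 (int p ^ (2 * m + 1))"
  proof -
    have "hecke_pow p (Suc (2 * m + 1)) (int p) = gL_int 2 (int p ^ Suc (2 * m + 1) * int p) - int p ^ 2 * hecke_pow p (2 * m + 1) 1"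
      unfolding hecke_pow.simps(2)[of p "2 * m + 1"] using p2 by simp
    moreover have "Suc (2 * m + 1) = 2 * Suc m" by simp
    moreover have "int p ^ (2 * Suc m) * int p = int p ^ (2 * Suc m + 1)" by (simp add: power_add)
    ultimately show ?thesis by (simp only: hecke_pow_1[OF p2])
  qed
  ultimately obtain z where z: "gL_int 2 (int p ^ (2 * Suc m + 1)) - int p ^ 2 * gL_int 2 (int p ^ (2 * m + 1)) = int p ^ (2 * (2 * Suc m)) * z"
    by (metis dvdE)
  have "2 * (2 * Suc m) = 2 * Suc m + (2 * m + 2)" by simp
  hence "int p ^ (2 * (2 * Suc m)) = int p ^ (2 * Suc m) * int p ^ (2 * m + 2)" by (simp only: power_add)
  moreover have "int p ^ (2 * Suc m) = int p ^ 2 * int p ^ (2 * m)" by (simp add: power_add power2_eq_square)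
  ultimately have "gL_int 2 (int p ^ (2 * Suc m + 1)) = int p ^ (2 * Suc m) * (w + int p ^ (2 * m + 2) * z)"
    using z unfolding w(1) by (simp add: algebra_simps del: power_Suc)
  moreover have "\<not> int p dvd w + int p ^ (2 * m + 2) * z"
    using w(2) by (simp add: dvd_add_left_iff)
  ultimately show ?case by blast
qed

text \<open>In U(p^(2m+1)) = T(p^(2m+1)) + p^2 V(p) T(p^(2m)) the first part is known modulo
  p^(2(2m+1)), and the second is divisible by p^2 p^(4m), the same power.\<close>

lemma H_coeff_congruence:
  assumes p: "prime p" "p mod 4 = 3"
  shows "int p ^ (4 * m + 2) dvd gL_int 2 (int p ^ (2 * m + 1) * n) - gL_int 2 (int p ^ (2 * m + 1)) * gL_int 0 n"
proof -
  have p2: "p \<ge> 2" using p(1) by (rule prime_ge_2_nat)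
  have 1: "int p ^ (4 * m + 2) dvd hecke_pow p (2 * m + 1) n - gL_int 2 (int p ^ (2 * m + 1)) * gL_int 0 n"
    using hecke_pow_odd[OF p, of "2 * m + 1" n] unfolding hecke_pow_1[OF p2] by simp
  have "int p ^ (2 + 4 * m) dvd int p ^ 2 * (if int p dvd n then hecke_pow p (2 * m) (n div int p) else 0)"
    unfolding power_add using hecke_pow_even[OF p, of "2 * m"] by (intro mult_dvd_mono) auto
  hence 2: "int p ^ (4 * m + 2) dvd int p ^ 2 * (if int p dvd n then hecke_pow p (2 * m) (n div int p) else 0)"
    by (simp only: add.commute)
  have "hecke_pow p (2 * m + 1) n = gL_int 2 (int p ^ (2 * m + 1) * n) - int p ^ 2 * (if int p dvd n then hecke_pow p (2 * m) (n div int p) else 0)"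
    using hecke_pow.simps(2)[of p "2 * m" n] by (simp only: Suc_eq_plus1)
  hence "gL_int 2 (int p ^ (2 * m + 1) * n) - gL_int 2 (int p ^ (2 * m + 1)) * gL_int 0 n =
    (hecke_pow p (2 * m + 1) n - gL_int 2 (int p ^ (2 * m + 1)) * gL_int 0 n) + int p ^ 2 * (if int p dvd n then hecke_pow p (2 * m) (n div int p) else 0)"
    by simp
  with dvd_add[OF 1 2] show ?thesis by (simp only:)
qed

section \<open>Valuations of rational numbers\<close>

lemma vp_rat_of_int:
  assumes p: "prime p" and w: "\<not> int p dvd w"
  shows "vp_rat p (of_int (int p ^ e * w)) = ereal (of_nat e)"
proof -
  have pp: "prime (int p)" using p by simp
  have w0: "w \<noteq> 0" using w by auto
  have p0: "int p \<noteq> 0" using p by (auto dest: prime_gt_0_nat)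
  have "multiplicity (int p) (int p ^ e * w) = e"
    using pp w w0 p0 by (simp add: prime_elem_multiplicity_mult_distrib not_dvd_imp_multiplicity_0 prime_imp_prime_elem)
  moreover have "quotient_of (of_int (int p ^ e * w)) = (int p ^ e * w, 1)"
    using quotient_of_int[of "int p ^ e * w"] by (simp only: Rat.of_int_def)
  ultimately show ?thesis using w0 p0 by (simp add: vp_rat_def)
qed

text \<open>In lowest terms a / b the denominator divides w, hence is prime to p, and p^e must
  divide a. For y = 0 the valuation is infinite.\<close>

lemma vp_rat_ge:
  assumes p: "prime p" and w: "\<not> int p dvd w"
  shows "vp_rat p (of_int (int p ^ e * y) / of_int w) \<ge> ereal (of_nat e)"
proof (cases "y = 0")
  case False
  have pp: "prime (int p)" using p by simp
  have w0: "w \<noteq> 0" using w by auto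
  have p0: "int p \<noteq> 0" using p by (auto dest: prime_gt_0_nat)
  define r :: rat where "r = of_int (int p ^ e * y) / of_int w"
  have r0: "r \<noteq> 0" using False w0 p0 by (simp add: r_def)
  obtain a b where q: "quotient_of r = (a, b)" by (cases "quotient_of r") auto
  have b: "b > 0" "coprime a b" "r = of_int a / of_int b"
    using quotient_of_denom_pos[OF q] quotient_of_coprime[OF q] quotient_of_div[OF q] by auto
  have "(of_int (int p ^ e * y) :: rat) / of_int w = of_int a / of_int b" using b(3) by (simp only: r_def)
  hence "(of_int (int p ^ e * y) :: rat) * of_int b = of_int a * of_int w" 
    by (subst (asm) frac_eq_eq) (use b(1) w0 in auto)
  hence "(of_int (int p ^ e * y * b) :: rat) = of_int (a * w)" by simp
  hence eq: "int p ^ e * y * b = a * w" by (simp only: of_int_eq_iff)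
  have a0: "a \<noteq> 0" using r0 b by auto
  have "b dvd a * w" unfolding eq[symmetric] by simp
  hence "b dvd w" using b(2) by (simp add: coprime_commute coprime_dvd_mult_right_iff)
  hence "\<not> int p dvd b" using w by (meson dvd_trans)
  hence mb: "multiplicity (int p) b = 0" by (rule not_dvd_imp_multiplicity_0)
  have "coprime (int p ^ e) w" using pp w by (simp add: prime_imp_coprime)
  moreover have "int p ^ e dvd a * w" unfolding eq[symmetric] by (simp add: mult.assoc)
  ultimately have "int p ^ e dvd a" by (simp add: coprime_dvd_mult_left_iff)
  moreover have "\<not> is_unit (int p)" using pp not_prime_unit by blast
  ultimately have "multiplicity (int p) a \<ge> e"
    using a0 by (simp add: multiplicity_geI)
  hence "vp_rat p r \<ge> ereal (of_nat e)" using r0 q mb by (simp add: vp_rat_def)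
  thus ?thesis unfolding r_def .
qed (simp add: vp_rat_def)

theorem theorem5p1:
  fixes p m :: nat
  assumes "prime p" and "p mod 4 = 3"
  shows "vp_rat p (C (int (p ^ (2*m+1)))) = ereal (of_nat (2*m))
       \<and> vp_fls p (U_op (p ^ (2*m+1)) H / fls_const (C (int (p ^ (2*m+1)))) - g2)
           \<ge> ereal (of_nat (2*m+2))"
proof -
  have p0: "p > 0" using assms(1) by (rule prime_gt_0_nat)
  define P where "P = int p ^ (2 * m + 1)"
  have P: "int (p ^ (2 * m + 1)) = P" by (simp add: P_def)
  have cH: "fls_nth H n = of_int (gL_int 2 n)" for n
    unfolding of_int_gL_int gL_coeff_def H_def ..
  have cg: "fls_nth g2 n = of_int (gL_int 0 n)" for n
    unfolding of_int_gL_int gL_coeff_def by simp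
  obtain w where w: "gL_int 2 P = int p ^ (2 * m) * w" "\<not> int p dvd w"
    using H_coeff_valuation[OF assms, of m] unfolding P_def by blast
  have w0: "w \<noteq> 0" using w(2) by auto
  have CP: "C (int (p ^ (2 * m + 1))) = of_int (int p ^ (2 * m) * w)"
    unfolding P C_def cH w(1) ..
  have v: "vp_rat p (C (int (p ^ (2*m+1)))) = ereal (of_nat (2*m))"
    unfolding CP by (rule vp_rat_of_int[OF assms(1) w(2)])
  have ge: "vp_rat p (fls_nth (U_op (p ^ (2*m+1)) H / fls_const (C (int (p ^ (2*m+1)))) - g2) n) \<ge> ereal (of_nat (2*m+2))" for n
  proof -
    obtain y where y: "gL_int 2 (P * n) - gL_int 2 P * gL_int 0 n = int p ^ (4 * m + 2) * y"
      using H_coeff_congruence[OF assms, of m n] unfolding P_def by (elim dvdE)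
    have U: "fls_nth (U_op (p ^ (2*m+1)) H) n = of_int (gL_int 2 (P * n))"
      using p0 by (simp add: U_op.rep_eq cH P_def)
    have "fls_nth (U_op (p ^ (2*m+1)) H / fls_const (C (int (p ^ (2*m+1)))) - g2) n =
      of_int (gL_int 2 (P * n)) / of_int (int p ^ (2 * m) * w) - of_int (gL_int 0 n)"
    proof -
      have "fls_nth (F / fls_const c - g2) n = fls_nth F n / c - fls_nth g2 n" for F c
        by (simp add: divide_inverse fls_inverse_const)
      thus ?thesis unfolding CP U cg by (simp only:) (simp only: U)
    qed
    also have "\<dots> = of_int (gL_int 2 (P * n) - gL_int 2 P * gL_int 0 n) / of_int (int p ^ (2 * m) * w)"
      unfolding w(1) using w0 p0 by (simp add: field_simps)
    also have "\<dots> = of_int (int p ^ (2 * m + 2) * y) / of_int w"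
    proof -
      \<comment> \<open>Cancelling the p^(2m) of C(p^(2m+1)) leaves 2m + 2 of the 4m + 2 factors
        p.\<close>
      have "int p ^ (4 * m + 2) = int p ^ (2 * m) * int p ^ (2 * m + 2)" by (simp flip: power_add)
      thus ?thesis unfolding y using p0 by simp
    qed
    finally show ?thesis using vp_rat_ge[OF assms(1) w(2), of "2 * m + 2" y] by (simp only:)
  qed
  have "vp_fls p (U_op (p ^ (2*m+1)) H / fls_const (C (int (p ^ (2*m+1)))) - g2) \<ge> ereal (of_nat (2*m+2))"
    unfolding vp_fls_def by (rule INF_greatest) (rule ge)
  with v show ?thesis by blast
qed

end
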